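(* The 2-reflection $\mathrm C\dashv\mathrm{EM}$ between $\mathbf{Cmd}$ and $\mathbf{LAdj}$ extends along the inclusion $\mathbf{LAdj}\hookrightarrow\mathbf{LAdj}^{\cong}$ to a bireflection $$\mathrm{C}^{\cong}\colon\mathbf{LAdj}^{\cong}\rightleftarrows\mathbf{Cmd}\,\colon\mathrm{EM}^{\cong},\qquad \mathrm C^{\cong}\dashv\mathrm{EM}^{\cong},$$ such that the counit is the identity $\mathrm C^{\cong}\circ\mathrm{EM}^{\cong}=\mathrm{Id}_{\mathbf{Cmd}}$. In particular, the right adjoint $\mathrm{EM}^{\cong}$ is injective on objects and fully faithful. The biadjunction restricts between the wide 2-full sub-2-categories on the pseudo morphisms, $\mathbf{Cmd}_{\mathbf{ps}}$ and $\mathbf{LAdj}^{\cong}_{\mathbf{ps}}$.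
   Context: "Wide" means with the same 0-cells; "2-full" means with all 2-cells between the retained 1-cells. A biadjunction between 2-functors has pseudo-natural unit and counit satisfying the triangle identities (up to invertible modification); a bireflection is a biadjunction whose counit is invertible (up to equivalence). **Comonads.** $\mathbf{Cmd}$: 0-cells are pairs of a category $\mathcal C$ and a comonad $(K,\epsilon,\nu)$ on it; a 1-cell $(K,\epsilon,\nu)\to(K',\epsilon',\nu')$ is a pair $(H,\theta)$ of a functor $H\colon\mathcal C\to\mathcal C'$ and a natural transformation $\theta\colon HK\Rightarrow K'H$ with $\epsilon'H\circ\theta=H\epsilon$ and $\nu'H\circ\theta=K'\theta\circ\theta K\circ H\nu$; it is pseudo if $\theta$ is invertible; composition $(H_2H_1,(\theta_2H_1)(H_2\theta_1))$; a 2-cell $(H_1,\theta_1)\to(H_2,\theta_2)$ is a natural transformation $\phi\colon H_1\Rightarrow H_2$ with $(K'\phi)\theta_1=\theta_2(\phi K)$. **Adjunctions.** $\mathbf{LAdj}^{\cong}$: 0-cells are adjunctions $(L,R,\eta,\epsilon)$ with $L\colon\mathcal D\to\mathcal C$ left adjoint to $R$; a 1-cell (left loose morphism) $(L,R,\eta,\epsilon)\to(L',R',\eta',\epsilon')$ is $(F\colon\mathcal C\to\mathcal C',G\colon\mathcal D\to\mathcal D',\zeta)$ with $\zeta\colon L'G\Rightarrow FL$ a natural isomorphism; its mate is $\zeta^\#=(R'F\epsilon)(R'\zeta R)(\eta'GR)\colon GR\Rightarrow R'F$; it is pseudo if $\zeta^\#$ is invertible; composition $(F_2F_1,G_2G_1,(F_2\zeta_1)(\zeta_2G_1))$;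 a 2-cell $(F_1,G_1,\zeta_1)\to(F_2,G_2,\zeta_2)$ is a pair $(\phi\colon F_1\Rightarrow F_2,\psi\colon G_1\Rightarrow G_2)$ with $\phi L\circ\zeta_1=\zeta_2\circ L'\psi$. $\mathbf{LAdj}$ is the wide 2-full sub-2-category on 1-cells with $\zeta=\mathrm{id}$. **The 2-functors.** $\mathrm{EM}\colon\mathbf{Cmd}\to\mathbf{LAdj}$ sends $K$ to the Eilenberg–Moore adjunction $\mathrm U_K\dashv\mathrm R_K$ ($\mathrm U_K\colon\mathrm{CoAlg}(K)\to\mathcal C$ forgetful), $(H,\theta)$ to $(H,\mathrm{CoAlg}(H,\theta))$ where $\mathrm{CoAlg}(H,\theta)(A,a)=(HA,\theta_A\circ Ha)$, and $\phi$ to $(\phi,\mathrm{CoAlg}(\phi))$ with $\mathrm{CoAlg}(\phi)_{(A,a)}=\phi_A$. $\mathrm{EM}^{\cong}$ is the composite of $\mathrm{EM}$ with $\mathbf{LAdj}\hookrightarrow\mathbf{LAdj}^{\cong}$. $\mathrm C^{\cong}\colon\mathbf{LAdj}^{\cong}\to\mathbf{Cmd}$ sends $(L,R,\eta,\epsilon)$ to $(LR,\epsilon,L\eta R)$, $(F,G,\zeta)$ to $(F,L'\zeta^\#\circ\zeta^{-1}R)$ and $(\phi,\psi)$ to $\phi$; $\mathrm C$ is its restriction to $\mathbf{LAdj}$. The 2-reflection $\mathrm C\dashv\mathrm{EM}$ is the strict 2-adjunction with identity counit and unit component at $(L,R,\eta,\epsilon)$ given by $(\mathrm{Id},\mathrm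 K_{L,R})$, where $\mathrm K_{L,R}\colon\mathcal D\to\mathrm{CoAlg}(LR)$, $A\mapsto(LA,L\eta_A)$, is the comparison functor. *)

theory Defs
  imports "HOL-Library.FuncSet"
begin

section \<open>Categories, functors, natural transformations\<close>

record ('o, 'a) cat =
  Ob :: "'o set"
  Ar :: "'a set"
  Dom :: "'a \<Rightarrow> 'o"
  Cod :: "'a \<Rightarrow> 'o"
  Idn :: "'o \<Rightarrow> 'a"
  Cmp :: "'a \<Rightarrow> 'a \<Rightarrow> 'a"

definition Hom :: "('o, 'a) cat \<Rightarrow> 'o \<Rightarrow> 'o \<Rightarrow> 'a set"
  where "Hom C A B = {f \<in> Ar C. Dom C f = A \<and> Cod C f = B}"

locale category =
  fixes C :: "('o, 'a) cat"
  assumes Dom_in: "f \<in> Ar C \<Longrightarrow> Dom C f \<in> Ob C"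
    and Cod_in: "f \<in> Ar C \<Longrightarrow> Cod C f \<in> Ob C"
    and Idn_in: "A \<in> Ob C \<Longrightarrow> Idn C A \<in> Hom C A A"
    and Cmp_in: "f \<in> Hom C A B \<Longrightarrow> g \<in> Hom C B D \<Longrightarrow> Cmp C g f \<in> Hom C A D"
    and Idn_left: "f \<in> Hom C A B \<Longrightarrow> Cmp C (Idn C B) f = f"
    and Idn_right: "f \<in> Hom C A B \<Longrightarrow> Cmp C f (Idn C A) = f"
    and assoc: "f \<in> Hom C A B \<Longrightarrow> g \<in> Hom C B D \<Longrightarrow> h \<in> Hom C D E
      \<Longrightarrow> Cmp C h (Cmp C g f) = Cmp C (Cmp C h g) f"

text \<open>
  HOL functions are total.  Categories, functors and natural transformations that serve as cells
  of a 2-category below have to take the value \<^const>\<open>undefined\<close> outside their domain, so that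
  equality of records is equality of the mathematical objects.  For functors and natural
  transformations this is part of the definition, for categories it is \<open>normalized\<close>.
\<close>

definition normalized :: "('o, 'a) cat \<Rightarrow> bool"
  where "normalized C \<longleftrightarrow>
    Dom C \<in> extensional (Ar C) \<and> Cod C \<in> extensional (Ar C) \<and> Idn C \<in> extensional (Ob C) \<and>
    (\<forall>g f. \<not> (f \<in> Ar C \<and> g \<in> Ar C \<and> Cod C f = Dom C g) \<longrightarrow> Cmp C g f = undefined)"

definition iso_ar :: "('o, 'a) cat \<Rightarrow> 'a \<Rightarrow> bool"
  where "iso_ar C f \<longleftrightarrow> f \<in> Ar C \<and>
    (\<exists>g \<in> Hom C (Cod C f) (Dom C f). Cmp C g f = Idn C (Dom C f) \<and> Cmp C f g = Idn C (Cod C f))"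

definition inv_ar :: "('o, 'a) cat \<Rightarrow> 'a \<Rightarrow> 'a"
  where "inv_ar C f = (THE g. g \<in> Hom C (Cod C f) (Dom C f) \<and>
    Cmp C g f = Idn C (Dom C f) \<and> Cmp C f g = Idn C (Cod C f))"

record ('o, 'a, 'p, 'b) ftr =
  Src :: "('o, 'a) cat"
  Tgt :: "('p, 'b) cat"
  Fo :: "'o \<Rightarrow> 'p"
  Fa :: "'a \<Rightarrow> 'b"

locale is_functor =
  fixes F :: "('o, 'a, 'p, 'b) ftr"
  assumes Src_category: "category (Src F)"
    and Tgt_category: "category (Tgt F)"
    and Fo_in: "A \<in> Ob (Src F) \<Longrightarrow> Fo F A \<in> Ob (Tgt F)"
    and Fa_in: "f \<in> Hom (Src F) A B \<Longrightarrow> Fa F f \<in> Hom (Tgt F) (Fo F A) (Fo F B)"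
    and Fa_Idn: "A \<in> Ob (Src F) \<Longrightarrow> Fa F (Idn (Src F) A) = Idn (Tgt F) (Fo F A)"
    and Fa_Cmp: "f \<in> Hom (Src F) A B \<Longrightarrow> g \<in> Hom (Src F) B D
      \<Longrightarrow> Fa F (Cmp (Src F) g f) = Cmp (Tgt F) (Fa F g) (Fa F f)"
    and Fo_ext: "Fo F \<in> extensional (Ob (Src F))"
    and Fa_ext: "Fa F \<in> extensional (Ar (Src F))"

definition fid :: "('o, 'a) cat \<Rightarrow> ('o, 'a, 'o, 'a) ftr"
  where "fid C = \<lparr>Src = C, Tgt = C, Fo = (\<lambda>A \<in> Ob C. A), Fa = (\<lambda>f \<in> Ar C. f)\<rparr>"

definition fcmp :: "('p, 'b, 'q, 'c) ftr \<Rightarrow> ('o, 'a, 'p, 'b) ftr \<Rightarrow> ('o, 'a, 'q, 'c) ftr"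
    (infixr \<open>\<odot>\<close> 75)
  where "G \<odot> F = \<lparr>Src = Src F, Tgt = Tgt G,
    Fo = (\<lambda>A \<in> Ob (Src F). Fo G (Fo F A)), Fa = (\<lambda>f \<in> Ar (Src F). Fa G (Fa F f))\<rparr>"

record ('o, 'a, 'p, 'b) ntr =
  Nsrc :: "('o, 'a, 'p, 'b) ftr"
  Ntgt :: "('o, 'a, 'p, 'b) ftr"
  Ncp :: "'o \<Rightarrow> 'b"

locale nat_trans =
  fixes \<alpha> :: "('o, 'a, 'p, 'b) ntr"
  assumes Nsrc_functor: "is_functor (Nsrc \<alpha>)"
    and Ntgt_functor: "is_functor (Ntgt \<alpha>)"
    and Src_eq: "Src (Ntgt \<alpha>) = Src (Nsrc \<alpha>)"
    and Tgt_eq: "Tgt (Ntgt \<alpha>) = Tgt (Nsrc \<alpha>)"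
    and Ncp_in: "A \<in> Ob (Src (Nsrc \<alpha>))
      \<Longrightarrow> Ncp \<alpha> A \<in> Hom (Tgt (Nsrc \<alpha>)) (Fo (Nsrc \<alpha>) A) (Fo (Ntgt \<alpha>) A)"
    and naturality: "f \<in> Hom (Src (Nsrc \<alpha>)) A B
      \<Longrightarrow> Cmp (Tgt (Nsrc \<alpha>)) (Ncp \<alpha> B) (Fa (Nsrc \<alpha>) f) = Cmp (Tgt (Nsrc \<alpha>)) (Fa (Ntgt \<alpha>) f) (Ncp \<alpha> A)"
    and Ncp_ext: "Ncp \<alpha> \<in> extensional (Ob (Src (Nsrc \<alpha>)))"

definition NT ::
    "('o, 'a, 'p, 'b) ftr \<Rightarrow> ('o, 'a, 'p, 'b) ftr \<Rightarrow> ('o, 'a, 'p, 'b) ntr set"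
  where "NT F G = {\<alpha>. nat_trans \<alpha> \<and> Nsrc \<alpha> = F \<and> Ntgt \<alpha> = G}"

definition nat_iso :: "('o, 'a, 'p, 'b) ntr \<Rightarrow> bool"
  where "nat_iso \<alpha> \<longleftrightarrow> nat_trans \<alpha> \<and>
    (\<forall>A \<in> Ob (Src (Nsrc \<alpha>)). iso_ar (Tgt (Nsrc \<alpha>)) (Ncp \<alpha> A))"

definition nid :: "('o, 'a, 'p, 'b) ftr \<Rightarrow> ('o, 'a, 'p, 'b) ntr"
  where "nid F = \<lparr>Nsrc = F, Ntgt = F, Ncp = (\<lambda>A \<in> Ob (Src F). Idn (Tgt F) (Fo F A))\<rparr>"

definition nvcmp ::
    "('o, 'a, 'p, 'b) ntr \<Rightarrow> ('o, 'a, 'p, 'b) ntr \<Rightarrow> ('o, 'a, 'p, 'b) ntr" (infixr \<open>\<bullet>\<close> 65)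
  where "\<beta> \<bullet> \<alpha> = \<lparr>Nsrc = Nsrc \<alpha>, Ntgt = Ntgt \<beta>,
    Ncp = (\<lambda>A \<in> Ob (Src (Nsrc \<alpha>)). Cmp (Tgt (Nsrc \<alpha>)) (Ncp \<beta> A) (Ncp \<alpha> A))\<rparr>"

definition nwl ::
    "('p, 'b, 'q, 'c) ftr \<Rightarrow> ('o, 'a, 'p, 'b) ntr \<Rightarrow> ('o, 'a, 'q, 'c) ntr" (infixr \<open>\<lhd>\<close> 72)
  where "G \<lhd> \<alpha> = \<lparr>Nsrc = G \<odot> Nsrc \<alpha>, Ntgt = G \<odot> Ntgt \<alpha>,
    Ncp = (\<lambda>A \<in> Ob (Src (Nsrc \<alpha>)). Fa G (Ncp \<alpha> A))\<rparr>"

definition nwr ::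
    "('p, 'b, 'q, 'c) ntr \<Rightarrow> ('o, 'a, 'p, 'b) ftr \<Rightarrow> ('o, 'a, 'q, 'c) ntr" (infixl \<open>\<rhd>\<close> 73)
  where "\<alpha> \<rhd> F = \<lparr>Nsrc = Nsrc \<alpha> \<odot> F, Ntgt = Ntgt \<alpha> \<odot> F,
    Ncp = (\<lambda>A \<in> Ob (Src F). Ncp \<alpha> (Fo F A))\<rparr>"

definition nhcmp ::
    "('p, 'b, 'q, 'c) ntr \<Rightarrow> ('o, 'a, 'p, 'b) ntr \<Rightarrow> ('o, 'a, 'q, 'c) ntr"
  where "nhcmp \<beta> \<alpha> = (\<beta> \<rhd> Ntgt \<alpha>) \<bullet> (Nsrc \<beta> \<lhd> \<alpha>)"

definition ninv :: "('o, 'a, 'p, 'b) ntr \<Rightarrow> ('o, 'a, 'p, 'b) ntr"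
  where "ninv \<alpha> = \<lparr>Nsrc = Ntgt \<alpha>, Ntgt = Nsrc \<alpha>,
    Ncp = (\<lambda>A \<in> Ob (Src (Nsrc \<alpha>)). inv_ar (Tgt (Nsrc \<alpha>)) (Ncp \<alpha> A))\<rparr>"

definition cat_equivalence :: "('o, 'a, 'p, 'b) ftr \<Rightarrow> bool"
  where "cat_equivalence F \<longleftrightarrow> is_functor F \<and>
    (\<exists>G \<eta> \<epsilon>. is_functor G \<and> Src G = Tgt F \<and> Tgt G = Src F \<and>
      nat_iso \<eta> \<and> \<eta> \<in> NT (fid (Src F)) (G \<odot> F) \<and> nat_iso \<epsilon> \<and> \<epsilon> \<in> NT (F \<odot> G) (fid (Tgt F)))"


section \<open>Strict 2-categories and biadjunctions\<close>

record ('o, 'm, 't) cat2 =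
  C0 :: "'o set"
  C1 :: "'m set"
  C2 :: "'t set"
  src1 :: "'m \<Rightarrow> 'o"
  tgt1 :: "'m \<Rightarrow> 'o"
  src2 :: "'t \<Rightarrow> 'm"
  tgt2 :: "'t \<Rightarrow> 'm"
  id1 :: "'o \<Rightarrow> 'm"
  cmp1 :: "'m \<Rightarrow> 'm \<Rightarrow> 'm"
  id2 :: "'m \<Rightarrow> 't"
  vcmp :: "'t \<Rightarrow> 't \<Rightarrow> 't"
  hcmp :: "'t \<Rightarrow> 't \<Rightarrow> 't"

definition cat01 :: "('o, 'm, 't) cat2 \<Rightarrow> ('o, 'm) cat"
  where "cat01 X = \<lparr>Ob = C0 X, Ar = C1 X, Dom = src1 X, Cod = tgt1 X, Idn = id1 X, Cmp = cmp1 X\<rparr>"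

definition cat12 :: "('o, 'm, 't) cat2 \<Rightarrow> ('m, 't) cat"
  where "cat12 X = \<lparr>Ob = C1 X, Ar = C2 X, Dom = src2 X, Cod = tgt2 X, Idn = id2 X, Cmp = vcmp X\<rparr>"

definition cat02 :: "('o, 'm, 't) cat2 \<Rightarrow> ('o, 't) cat"
  where "cat02 X = \<lparr>Ob = C0 X, Ar = C2 X, Dom = (\<lambda>\<alpha>. src1 X (src2 X \<alpha>)),
    Cod = (\<lambda>\<alpha>. tgt1 X (tgt2 X \<alpha>)), Idn = (\<lambda>a. id2 X (id1 X a)), Cmp = hcmp X\<rparr>"

locale two_category =
  fixes X :: "('o, 'm, 't) cat2"
  assumes category01: "category (cat01 X)"
    and category12: "category (cat12 X)"
    and category02: "category (cat02 X)"
    and src_globular: "\<alpha> \<in> C2 X \<Longrightarrow> src1 X (src2 X \<alpha>) = src1 X (tgt2 X \<alpha>)"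
    and tgt_globular: "\<alpha> \<in> C2 X \<Longrightarrow> tgt1 X (src2 X \<alpha>) = tgt1 X (tgt2 X \<alpha>)"
    and src2_hcmp: "\<alpha> \<in> C2 X \<Longrightarrow> \<beta> \<in> C2 X \<Longrightarrow> tgt1 X (src2 X \<alpha>) = src1 X (src2 X \<beta>)
      \<Longrightarrow> src2 X (hcmp X \<beta> \<alpha>) = cmp1 X (src2 X \<beta>) (src2 X \<alpha>)"
    and tgt2_hcmp: "\<alpha> \<in> C2 X \<Longrightarrow> \<beta> \<in> C2 X \<Longrightarrow> tgt1 X (src2 X \<alpha>) = src1 X (src2 X \<beta>)
      \<Longrightarrow> tgt2 X (hcmp X \<beta> \<alpha>) = cmp1 X (tgt2 X \<beta>) (tgt2 X \<alpha>)"
    and id2_cmp1: "f \<in> C1 X \<Longrightarrow> g \<in> C1 X \<Longrightarrow> tgt1 X f = src1 X g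
      \<Longrightarrow> id2 X (cmp1 X g f) = hcmp X (id2 X g) (id2 X f)"
    and interchange:
      "\<alpha> \<in> C2 X \<Longrightarrow> \<alpha>' \<in> C2 X \<Longrightarrow> \<beta> \<in> C2 X \<Longrightarrow> \<beta>' \<in> C2 X
      \<Longrightarrow> tgt2 X \<alpha> = src2 X \<alpha>' \<Longrightarrow> tgt2 X \<beta> = src2 X \<beta>'
      \<Longrightarrow> tgt1 X (src2 X \<alpha>) = src1 X (src2 X \<beta>)
      \<Longrightarrow> hcmp X (vcmp X \<beta>' \<beta>) (vcmp X \<alpha>' \<alpha>) = vcmp X (hcmp X \<beta>' \<alpha>') (hcmp X \<beta> \<alpha>)"

definition iso2 :: "('o, 'm, 't) cat2 \<Rightarrow> 't \<Rightarrow> bool"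
  where "iso2 X \<alpha> \<longleftrightarrow> iso_ar (cat12 X) \<alpha>"

definition equiv1 :: "('o, 'm, 't) cat2 \<Rightarrow> 'm \<Rightarrow> bool"
  where "equiv1 X f \<longleftrightarrow> f \<in> C1 X \<and>
    (\<exists>g \<in> C1 X. src1 X g = tgt1 X f \<and> tgt1 X g = src1 X f \<and>
      (\<exists>\<alpha>. iso2 X \<alpha> \<and> src2 X \<alpha> = id1 X (src1 X f) \<and> tgt2 X \<alpha> = cmp1 X g f) \<and>
      (\<exists>\<beta>. iso2 X \<beta> \<and> src2 X \<beta> = cmp1 X f g \<and> tgt2 X \<beta> = id1 X (tgt1 X f)))"

definition wide_full :: "('o, 'm, 't) cat2 \<Rightarrow> ('m \<Rightarrow> bool) \<Rightarrow> ('o, 'm, 't) cat2"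
  where "wide_full X P = X\<lparr>C1 := {f \<in> C1 X. P f}, C2 := {\<alpha> \<in> C2 X. P (src2 X \<alpha>) \<and> P (tgt2 X \<alpha>)}\<rparr>"

record ('o, 'm, 't, 'p, 'n, 'u) fun2 =
  F0 :: "'o \<Rightarrow> 'p"
  F1 :: "'m \<Rightarrow> 'n"
  F2 :: "'t \<Rightarrow> 'u"

locale two_functor =
  fixes X :: "('o, 'm, 't) cat2" and Y :: "('p, 'n, 'u) cat2" and F :: "('o, 'm, 't, 'p, 'n, 'u) fun2"
  assumes source: "two_category X"
    and target: "two_category Y"
    and F0_in: "a \<in> C0 X \<Longrightarrow> F0 F a \<in> C0 Y"
    and F1_in: "f \<in> C1 X \<Longrightarrow> F1 F f \<in> C1 Y"
    and F2_in: "\<alpha> \<in> C2 X \<Longrightarrow> F2 F \<alpha> \<in> C2 Y"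
    and src1: "f \<in> C1 X \<Longrightarrow> src1 Y (F1 F f) = F0 F (src1 X f)"
    and tgt1: "f \<in> C1 X \<Longrightarrow> tgt1 Y (F1 F f) = F0 F (tgt1 X f)"
    and src2: "\<alpha> \<in> C2 X \<Longrightarrow> src2 Y (F2 F \<alpha>) = F1 F (src2 X \<alpha>)"
    and tgt2: "\<alpha> \<in> C2 X \<Longrightarrow> tgt2 Y (F2 F \<alpha>) = F1 F (tgt2 X \<alpha>)"
    and id1: "a \<in> C0 X \<Longrightarrow> F1 F (id1 X a) = id1 Y (F0 F a)"
    and cmp1: "f \<in> C1 X \<Longrightarrow> g \<in> C1 X \<Longrightarrow> tgt1 X f = src1 X g
      \<Longrightarrow> F1 F (cmp1 X g f) = cmp1 Y (F1 F g) (F1 F f)"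
    and id2: "f \<in> C1 X \<Longrightarrow> F2 F (id2 X f) = id2 Y (F1 F f)"
    and vcmp: "\<alpha> \<in> C2 X \<Longrightarrow> \<beta> \<in> C2 X \<Longrightarrow> tgt2 X \<alpha> = src2 X \<beta>
      \<Longrightarrow> F2 F (vcmp X \<beta> \<alpha>) = vcmp Y (F2 F \<beta>) (F2 F \<alpha>)"
    and hcmp: "\<alpha> \<in> C2 X \<Longrightarrow> \<beta> \<in> C2 X \<Longrightarrow> tgt1 X (src2 X \<alpha>) = src1 X (src2 X \<beta>)
      \<Longrightarrow> F2 F (hcmp X \<beta> \<alpha>) = hcmp Y (F2 F \<beta>) (F2 F \<alpha>)"

definition id_fun2 :: "('o, 'm, 't, 'o, 'm, 't) fun2"
  where "id_fun2 = \<lparr>F0 = (\<lambda>a. a), F1 = (\<lambda>f. f), F2 = (\<lambda>\<alpha>. \<alpha>)\<rparr>"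

definition cmp_fun2 ::
    "('p, 'n, 'u, 'q, 'k, 'v) fun2 \<Rightarrow> ('o, 'm, 't, 'p, 'n, 'u) fun2 \<Rightarrow> ('o, 'm, 't, 'q, 'k, 'v) fun2"
    (infixr \<open>\<odot>\<^sub>2\<close> 75)
  where "G \<odot>\<^sub>2 F = \<lparr>F0 = (\<lambda>a. F0 G (F0 F a)), F1 = (\<lambda>f. F1 G (F1 F f)), F2 = (\<lambda>\<alpha>. F2 G (F2 F \<alpha>))\<rparr>"

definition eq_fun2 ::
    "('o, 'm, 't) cat2 \<Rightarrow> ('o, 'm, 't, 'p, 'n, 'u) fun2 \<Rightarrow> ('o, 'm, 't, 'p, 'n, 'u) fun2 \<Rightarrow> bool"
  where "eq_fun2 X F G \<longleftrightarrow> (\<forall>a \<in> C0 X. F0 F a = F0 G a) \<and>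
    (\<forall>f \<in> C1 X. F1 F f = F1 G f) \<and> (\<forall>\<alpha> \<in> C2 X. F2 F \<alpha> = F2 G \<alpha>)"

definition hom_cat :: "('o, 'm, 't) cat2 \<Rightarrow> 'o \<Rightarrow> 'o \<Rightarrow> ('m, 't) cat"
  where "hom_cat X a b = (cat12 X)\<lparr>Ob := {f \<in> C1 X. src1 X f = a \<and> tgt1 X f = b},
    Ar := {\<alpha> \<in> C2 X. src1 X (src2 X \<alpha>) = a \<and> tgt1 X (src2 X \<alpha>) = b}\<rparr>"

definition hom_functor ::
    "('o, 'm, 't) cat2 \<Rightarrow> ('p, 'n, 'u) cat2 \<Rightarrow> ('o, 'm, 't, 'p, 'n, 'u) fun2 \<Rightarrow> 'o \<Rightarrow> 'o
      \<Rightarrow> ('m, 't, 'n, 'u) ftr"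
  where "hom_functor X Y F a b = \<lparr>Src = hom_cat X a b, Tgt = hom_cat Y (F0 F a) (F0 F b),
    Fo = restrict (F1 F) (Ob (hom_cat X a b)), Fa = restrict (F2 F) (Ar (hom_cat X a b))\<rparr>"

text \<open>
  Full faithfulness in the sense appropriate to biadjunctions: the functors between
  hom-categories are equivalences (and not necessarily isomorphisms) of categories.
\<close>

definition fully_faithful2 ::
    "('o, 'm, 't) cat2 \<Rightarrow> ('p, 'n, 'u) cat2 \<Rightarrow> ('o, 'm, 't, 'p, 'n, 'u) fun2 \<Rightarrow> bool"
  where "fully_faithful2 X Y F \<longleftrightarrow> two_functor X Y F \<and>
    (\<forall>a \<in> C0 X. \<forall>b \<in> C0 X. cat_equivalence (hom_functor X Y F a b))"

text \<open>
  A pseudo-natural transformation \<open>\<sigma> : F \<Rightarrow> G\<close> has 1-cells \<open>\<sigma>\<^sub>a : F a \<rightarrow> G a\<close> and invertible 2-cells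
  \<open>\<sigma>\<^sub>f : G f \<circ> \<sigma>\<^sub>a \<Rightarrow> \<sigma>\<^sub>b \<circ> F f\<close> for \<open>f : a \<rightarrow> b\<close>.
\<close>

record ('o, 'm, 'n, 'u) ptr =
  P0 :: "'o \<Rightarrow> 'n"
  P1 :: "'m \<Rightarrow> 'u"

locale pseudo_natural =
  fixes X :: "('o, 'm, 't) cat2" and Y :: "('p, 'n, 'u) cat2"
    and F G :: "('o, 'm, 't, 'p, 'n, 'u) fun2" and \<sigma> :: "('o, 'm, 'n, 'u) ptr"
  assumes source: "two_functor X Y F"
    and target: "two_functor X Y G"
    and P0_in: "a \<in> C0 X \<Longrightarrow> P0 \<sigma> a \<in> Hom (cat01 Y) (F0 F a) (F0 G a)"
    and P1_in: "f \<in> Hom (cat01 X) a b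
      \<Longrightarrow> P1 \<sigma> f \<in> Hom (cat12 Y) (cmp1 Y (F1 G f) (P0 \<sigma> a)) (cmp1 Y (P0 \<sigma> b) (F1 F f))"
    and P1_iso: "f \<in> C1 X \<Longrightarrow> iso2 Y (P1 \<sigma> f)"
    and P1_natural: "\<alpha> \<in> Hom (cat12 X) f g \<Longrightarrow> f \<in> Hom (cat01 X) a b
      \<Longrightarrow> vcmp Y (P1 \<sigma> g) (hcmp Y (F2 G \<alpha>) (id2 Y (P0 \<sigma> a)))
        = vcmp Y (hcmp Y (id2 Y (P0 \<sigma> b)) (F2 F \<alpha>)) (P1 \<sigma> f)"
    and P1_id1: "a \<in> C0 X \<Longrightarrow> P1 \<sigma> (id1 X a) = id2 Y (P0 \<sigma> a)"
    and P1_cmp1: "f \<in> Hom (cat01 X) a b \<Longrightarrow> g \<in> Hom (cat01 X) b c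
      \<Longrightarrow> P1 \<sigma> (cmp1 X g f)
        = vcmp Y (hcmp Y (P1 \<sigma> g) (id2 Y (F1 F f))) (hcmp Y (id2 Y (F1 G g)) (P1 \<sigma> f))"

definition two_natural ::
    "('o, 'm, 't) cat2 \<Rightarrow> ('p, 'n, 'u) cat2 \<Rightarrow> ('o, 'm, 't, 'p, 'n, 'u) fun2
      \<Rightarrow> ('o, 'm, 't, 'p, 'n, 'u) fun2 \<Rightarrow> ('o, 'm, 'n, 'u) ptr \<Rightarrow> bool"
  where "two_natural X Y F G \<sigma> \<longleftrightarrow> pseudo_natural X Y F G \<sigma> \<and>
    (\<forall>f \<in> C1 X. P1 \<sigma> f = id2 Y (cmp1 Y (P0 \<sigma> (tgt1 X f)) (F1 F f)))"

definition pid :: "('p, 'n, 'u) cat2 \<Rightarrow> ('o, 'm, 't, 'p, 'n, 'u) fun2 \<Rightarrow> ('o, 'm, 'n, 'u) ptr"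
  where "pid Y F = \<lparr>P0 = (\<lambda>a. id1 Y (F0 F a)), P1 = (\<lambda>f. id2 Y (F1 F f))\<rparr>"

definition pcmp ::
    "('o, 'm, 't) cat2 \<Rightarrow> ('p, 'n, 'u) cat2 \<Rightarrow> ('o, 'm, 'n, 'u) ptr \<Rightarrow> ('o, 'm, 'n, 'u) ptr
      \<Rightarrow> ('o, 'm, 'n, 'u) ptr"
  where "pcmp X Y \<tau> \<sigma> = \<lparr>P0 = (\<lambda>a. cmp1 Y (P0 \<tau> a) (P0 \<sigma> a)),
    P1 = (\<lambda>f. vcmp Y (hcmp Y (id2 Y (P0 \<tau> (tgt1 X f))) (P1 \<sigma> f))
                     (hcmp Y (P1 \<tau> f) (id2 Y (P0 \<sigma> (src1 X f)))))\<rparr>"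

definition pwl :: "('p, 'n, 'u, 'q, 'k, 'v) fun2 \<Rightarrow> ('o, 'm, 'n, 'u) ptr \<Rightarrow> ('o, 'm, 'k, 'v) ptr"
  where "pwl K \<sigma> = \<lparr>P0 = (\<lambda>a. F1 K (P0 \<sigma> a)), P1 = (\<lambda>f. F2 K (P1 \<sigma> f))\<rparr>"

definition pwr :: "('p, 'n, 'k, 'v) ptr \<Rightarrow> ('o, 'm, 't, 'p, 'n, 'u) fun2 \<Rightarrow> ('o, 'm, 'k, 'v) ptr"
  where "pwr \<sigma> K = \<lparr>P0 = (\<lambda>a. P0 \<sigma> (F0 K a)), P1 = (\<lambda>f. P1 \<sigma> (F1 K f))\<rparr>"

definition invertible_modification ::
    "('o, 'm, 't) cat2 \<Rightarrow> ('p, 'n, 'u) cat2 \<Rightarrow> ('o, 'm, 't, 'p, 'n, 'u) fun2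
      \<Rightarrow> ('o, 'm, 't, 'p, 'n, 'u) fun2 \<Rightarrow> ('o, 'm, 'n, 'u) ptr \<Rightarrow> ('o, 'm, 'n, 'u) ptr
      \<Rightarrow> ('o \<Rightarrow> 'u) \<Rightarrow> bool"
  where "invertible_modification X Y F G \<sigma> \<tau> \<Gamma> \<longleftrightarrow>
    pseudo_natural X Y F G \<sigma> \<and> pseudo_natural X Y F G \<tau> \<and>
    (\<forall>a \<in> C0 X. \<Gamma> a \<in> Hom (cat12 Y) (P0 \<sigma> a) (P0 \<tau> a) \<and> iso2 Y (\<Gamma> a)) \<and>
    (\<forall>a b f. f \<in> Hom (cat01 X) a b \<longrightarrow>
      vcmp Y (P1 \<tau> f) (hcmp Y (id2 Y (F1 G f)) (\<Gamma> a))
        = vcmp Y (hcmp Y (\<Gamma> b) (id2 Y (F1 F f))) (P1 \<sigma> f))"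

text \<open>
  The left adjoint is \<open>L : X \<rightarrow> Y\<close>; \<open>s\<close> and \<open>t\<close> are the invertible modifications that fill the
  two triangles.
\<close>

locale biadjunction =
  fixes X :: "('o, 'm, 't) cat2" and Y :: "('p, 'n, 'u) cat2"
    and L :: "('o, 'm, 't, 'p, 'n, 'u) fun2" and R :: "('p, 'n, 'u, 'o, 'm, 't) fun2"
    and \<eta> :: "('o, 'm, 'm, 't) ptr" and \<epsilon> :: "('p, 'n, 'n, 'u) ptr"
    and s :: "'o \<Rightarrow> 'u" and t :: "'p \<Rightarrow> 't"
  assumes left: "two_functor X Y L"
    and right: "two_functor Y X R"
    and unit: "pseudo_natural X X id_fun2 (R \<odot>\<^sub>2 L) \<eta>"
    and counit: "pseudo_natural Y Y (L \<odot>\<^sub>2 R) id_fun2 \<epsilon>"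
    and triangle_left: "invertible_modification X Y L L (pcmp X Y (pwr \<epsilon> L) (pwl L \<eta>)) (pid Y L) s"
    and triangle_right: "invertible_modification Y X R R (pcmp Y X (pwl R \<epsilon>) (pwr \<eta> R)) (pid X R) t"

locale bireflection = biadjunction +
  assumes counit_equiv: "b \<in> C0 Y \<Longrightarrow> equiv1 Y (P0 \<epsilon> b)"

locale two_adjunction =
  fixes X :: "('o, 'm, 't) cat2" and Y :: "('p, 'n, 'u) cat2"
    and L :: "('o, 'm, 't, 'p, 'n, 'u) fun2" and R :: "('p, 'n, 'u, 'o, 'm, 't) fun2"
    and \<eta> :: "('o, 'm, 'm, 't) ptr" and \<epsilon> :: "('p, 'n, 'n, 'u) ptr"
  assumes left: "two_functor X Y L"
    and right: "two_functor Y X R"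
    and unit: "two_natural X X id_fun2 (R \<odot>\<^sub>2 L) \<eta>"
    and counit: "two_natural Y Y (L \<odot>\<^sub>2 R) id_fun2 \<epsilon>"
    and triangle_left: "a \<in> C0 X \<Longrightarrow> cmp1 Y (P0 \<epsilon> (F0 L a)) (F1 L (P0 \<eta> a)) = id1 Y (F0 L a)"
    and triangle_right: "b \<in> C0 Y \<Longrightarrow> cmp1 X (F1 R (P0 \<epsilon> b)) (P0 \<eta> (F0 R b)) = id1 X (F0 R b)"


section \<open>The 2-category of comonads\<close>

text \<open>
  The 0-cells of the 2-categories below range over all categories with objects and arrows in a type
  \<open>'x\<close>.  The category carrying a comonad \<open>Q\<close> is \<open>Src (cmK Q)\<close>.
\<close>

record 'x comonad =
  cmK :: "('x, 'x, 'x, 'x) ftr"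
  cmE :: "('x, 'x, 'x, 'x) ntr"
  cmN :: "('x, 'x, 'x, 'x) ntr"

definition is_comonad :: "'x comonad \<Rightarrow> bool"
  where "is_comonad Q \<longleftrightarrow> (let K = cmK Q; \<epsilon> = cmE Q; \<nu> = cmN Q in
    is_functor K \<and> normalized (Src K) \<and> Tgt K = Src K \<and>
    \<epsilon> \<in> NT K (fid (Src K)) \<and> \<nu> \<in> NT K (K \<odot> K) \<and>
    (K \<lhd> \<epsilon>) \<bullet> \<nu> = nid K \<and> (\<epsilon> \<rhd> K) \<bullet> \<nu> = nid K \<and>
    (K \<lhd> \<nu>) \<bullet> \<nu> = (\<nu> \<rhd> K) \<bullet> \<nu>)"

record 'x cmd1 =
  mSrc :: "'x comonad"
  mTgt :: "'x comonad"
  mH :: "('x, 'x, 'x, 'x) ftr"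
  mT :: "('x, 'x, 'x, 'x) ntr"

definition is_cmd1 :: "'x cmd1 \<Rightarrow> bool"
  where "is_cmd1 m \<longleftrightarrow> (let K = cmK (mSrc m); K' = cmK (mTgt m); H = mH m; \<theta> = mT m in
    is_comonad (mSrc m) \<and> is_comonad (mTgt m) \<and>
    is_functor H \<and> Src H = Src K \<and> Tgt H = Src K' \<and> \<theta> \<in> NT (H \<odot> K) (K' \<odot> H) \<and>
    (cmE (mTgt m) \<rhd> H) \<bullet> \<theta> = H \<lhd> cmE (mSrc m) \<and>
    (cmN (mTgt m) \<rhd> H) \<bullet> \<theta> = (K' \<lhd> \<theta>) \<bullet> (\<theta> \<rhd> K) \<bullet> (H \<lhd> cmN (mSrc m)))"

definition cmd_cmp :: "'x cmd1 \<Rightarrow> 'x cmd1 \<Rightarrow> 'x cmd1"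
  where "cmd_cmp m2 m1 = \<lparr>mSrc = mSrc m1, mTgt = mTgt m2, mH = mH m2 \<odot> mH m1,
    mT = (mT m2 \<rhd> mH m1) \<bullet> (mH m2 \<lhd> mT m1)\<rparr>"

record 'x cmd2 =
  cSrc :: "'x cmd1"
  cTgt :: "'x cmd1"
  cPhi :: "('x, 'x, 'x, 'x) ntr"

definition is_cmd2 :: "'x cmd2 \<Rightarrow> bool"
  where "is_cmd2 c \<longleftrightarrow> (let m1 = cSrc c; m2 = cTgt c; \<phi> = cPhi c in
    is_cmd1 m1 \<and> is_cmd1 m2 \<and> mSrc m1 = mSrc m2 \<and> mTgt m1 = mTgt m2 \<and>
    \<phi> \<in> NT (mH m1) (mH m2) \<and>
    (cmK (mTgt m1) \<lhd> \<phi>) \<bullet> mT m1 = mT m2 \<bullet> (\<phi> \<rhd> cmK (mSrc m1)))"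

type_synonym 'x cmd_cat2 = "('x comonad, 'x cmd1, 'x cmd2) cat2"

definition Cmd :: "'x cmd_cat2"
  where "Cmd = \<lparr>
    C0 = {Q. is_comonad Q}, C1 = {m. is_cmd1 m}, C2 = {c. is_cmd2 c},
    src1 = mSrc, tgt1 = mTgt, src2 = cSrc, tgt2 = cTgt,
    id1 = (\<lambda>Q. \<lparr>mSrc = Q, mTgt = Q, mH = fid (Src (cmK Q)), mT = nid (cmK Q)\<rparr>),
    cmp1 = cmd_cmp,
    id2 = (\<lambda>m. \<lparr>cSrc = m, cTgt = m, cPhi = nid (mH m)\<rparr>),
    vcmp = (\<lambda>d c. \<lparr>cSrc = cSrc c, cTgt = cTgt d, cPhi = cPhi d \<bullet> cPhi c\<rparr>),
    hcmp = (\<lambda>d c. \<lparr>cSrc = cmd_cmp (cSrc d) (cSrc c), cTgt = cmd_cmp (cTgt d) (cTgt c),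
      cPhi = nhcmp (cPhi d) (cPhi c)\<rparr>)\<rparr>"

definition Cmd_ps :: "'x cmd_cat2"
  where "Cmd_ps = wide_full Cmd (\<lambda>m. nat_iso (mT m))"


section \<open>The 2-category of adjunctions\<close>

record 'x adjn =
  aL :: "('x, 'x, 'x, 'x) ftr"
  aR :: "('x, 'x, 'x, 'x) ftr"
  aEta :: "('x, 'x, 'x, 'x) ntr"
  aEps :: "('x, 'x, 'x, 'x) ntr"

definition is_adjn :: "'x adjn \<Rightarrow> bool"
  where "is_adjn A \<longleftrightarrow> (let L = aL A; R = aR A; \<eta> = aEta A; \<epsilon> = aEps A in
    is_functor L \<and> is_functor R \<and> normalized (Src L) \<and> normalized (Tgt L) \<and>
    Src R = Tgt L \<and> Tgt R = Src L \<and>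
    \<eta> \<in> NT (fid (Src L)) (R \<odot> L) \<and> \<epsilon> \<in> NT (L \<odot> R) (fid (Tgt L)) \<and>
    (\<epsilon> \<rhd> L) \<bullet> (L \<lhd> \<eta>) = nid L \<and> (R \<lhd> \<epsilon>) \<bullet> (\<eta> \<rhd> R) = nid R)"

record 'x adj1 =
  lSrc :: "'x adjn"
  lTgt :: "'x adjn"
  lF :: "('x, 'x, 'x, 'x) ftr"
  lG :: "('x, 'x, 'x, 'x) ftr"
  lZ :: "('x, 'x, 'x, 'x) ntr"

definition is_adj1 :: "'x adj1 \<Rightarrow> bool"
  where "is_adj1 f \<longleftrightarrow> (let L = aL (lSrc f); L' = aL (lTgt f); F = lF f; G = lG f in
    is_adjn (lSrc f) \<and> is_adjn (lTgt f) \<and>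
    is_functor F \<and> Src F = Tgt L \<and> Tgt F = Tgt L' \<and>
    is_functor G \<and> Src G = Src L \<and> Tgt G = Src L' \<and>
    lZ f \<in> NT (L' \<odot> G) (F \<odot> L) \<and> nat_iso (lZ f))"

definition mate :: "'x adj1 \<Rightarrow> ('x, 'x, 'x, 'x) ntr"
  where "mate f =
    (aR (lTgt f) \<lhd> lF f \<lhd> aEps (lSrc f)) \<bullet>
    (aR (lTgt f) \<lhd> (lZ f \<rhd> aR (lSrc f))) \<bullet>
    (aEta (lTgt f) \<rhd> (lG f \<odot> aR (lSrc f)))"

definition adj_cmp :: "'x adj1 \<Rightarrow> 'x adj1 \<Rightarrow> 'x adj1"
  where "adj_cmp f2 f1 = \<lparr>lSrc = lSrc f1, lTgt = lTgt f2, lF = lF f2 \<odot> lF f1, lG = lG f2 \<odot> lG f1,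
    lZ = (lF f2 \<lhd> lZ f1) \<bullet> (lZ f2 \<rhd> lG f1)\<rparr>"

record 'x adj2 =
  dSrc :: "'x adj1"
  dTgt :: "'x adj1"
  dPhi :: "('x, 'x, 'x, 'x) ntr"
  dPsi :: "('x, 'x, 'x, 'x) ntr"

definition is_adj2 :: "'x adj2 \<Rightarrow> bool"
  where "is_adj2 d \<longleftrightarrow> (let f1 = dSrc d; f2 = dTgt d in
    is_adj1 f1 \<and> is_adj1 f2 \<and> lSrc f1 = lSrc f2 \<and> lTgt f1 = lTgt f2 \<and>
    dPhi d \<in> NT (lF f1) (lF f2) \<and> dPsi d \<in> NT (lG f1) (lG f2) \<and>
    (dPhi d \<rhd> aL (lSrc f1)) \<bullet> lZ f1 = lZ f2 \<bullet> (aL (lTgt f1) \<lhd> dPsi d))"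

type_synonym 'x adj_cat2 = "('x adjn, 'x adj1, 'x adj2) cat2"

definition LAdj_iso :: "'x adj_cat2"
  where "LAdj_iso = \<lparr>
    C0 = {A. is_adjn A}, C1 = {f. is_adj1 f}, C2 = {d. is_adj2 d},
    src1 = lSrc, tgt1 = lTgt, src2 = dSrc, tgt2 = dTgt,
    id1 = (\<lambda>A. \<lparr>lSrc = A, lTgt = A, lF = fid (Tgt (aL A)), lG = fid (Src (aL A)), lZ = nid (aL A)\<rparr>),
    cmp1 = adj_cmp,
    id2 = (\<lambda>f. \<lparr>dSrc = f, dTgt = f, dPhi = nid (lF f), dPsi = nid (lG f)\<rparr>),
    vcmp = (\<lambda>e d. \<lparr>dSrc = dSrc d, dTgt = dTgt e, dPhi = dPhi e \<bullet> dPhi d, dPsi = dPsi e \<bullet> dPsi d\<rparr>),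
    hcmp = (\<lambda>e d. \<lparr>dSrc = adj_cmp (dSrc e) (dSrc d), dTgt = adj_cmp (dTgt e) (dTgt d),
      dPhi = nhcmp (dPhi e) (dPhi d), dPsi = nhcmp (dPsi e) (dPsi d)\<rparr>)\<rparr>"

definition LAdj_iso_ps :: "'x adj_cat2"
  where "LAdj_iso_ps = wide_full LAdj_iso (\<lambda>f. nat_iso (mate f))"

definition LAdj :: "'x adj_cat2"
  where "LAdj = wide_full LAdj_iso (\<lambda>f. lZ f = nid (aL (lTgt f) \<odot> lG f))"

definition incl :: "('x adjn, 'x adj1, 'x adj2, 'x adjn, 'x adj1, 'x adj2) fun2"
  where "incl = id_fun2"


section \<open>Eilenberg-Moore adjunctions\<close>

text \<open>
  To have one type that contains the objects and arrows of a category as well as those of the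
  categories of coalgebras over it, we close an arbitrary type \<open>'u\<close> (the \<open>Atom\<close>s) under the
  formation of coalgebras \<open>Coalg A a\<close> and coalgebra morphisms \<open>Comor X f Y\<close> (from \<open>X\<close> to \<open>Y\<close>, with
  underlying arrow \<open>f\<close>).  Every category with objects and arrows in \<open>'u\<close> is, up to renaming, a category in
  \<open>'u univ\<close>.
\<close>

datatype 'u univ =
    Atom 'u
  | Coalg (carr: "'u univ") (struct: "'u univ")
  | Comor (cdom: "'u univ") (under: "'u univ") (ccod: "'u univ")

definition coalg_ob :: "'u univ comonad \<Rightarrow> 'u univ set"
  where "coalg_ob Q = (let K = cmK Q; C = Src K in
    {Coalg A a | A a. A \<in> Ob C \<and> a \<in> Hom C A (Fo K A) \<and>
      Cmp C (Ncp (cmE Q) A) a = Idn C A \<and>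
      Cmp C (Ncp (cmN Q) A) a = Cmp C (Fa K a) a})"

definition coalg_ar :: "'u univ comonad \<Rightarrow> 'u univ set"
  where "coalg_ar Q = (let K = cmK Q; C = Src K in
    {Comor X f Y | X f Y. X \<in> coalg_ob Q \<and> Y \<in> coalg_ob Q \<and> f \<in> Hom C (carr X) (carr Y) \<and>
      Cmp C (struct Y) f = Cmp C (Fa K f) (struct X)})"

definition CoAlg :: "'u univ comonad \<Rightarrow> ('u univ, 'u univ) cat"
  where "CoAlg Q = (let C = Src (cmK Q) in
    \<lparr>Ob = coalg_ob Q, Ar = coalg_ar Q,
      Dom = restrict cdom (coalg_ar Q), Cod = restrict ccod (coalg_ar Q),
      Idn = (\<lambda>X \<in> coalg_ob Q. Comor X (Idn C (carr X)) X),
      Cmp = (\<lambda>g f. if f \<in> coalg_ar Q \<and> g \<in> coalg_ar Q \<and> ccod f = cdom g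
        then Comor (cdom f) (Cmp C (under g) (under f)) (ccod g) else undefined)\<rparr>)"

definition EM_U :: "'u univ comonad \<Rightarrow> ('u univ, 'u univ, 'u univ, 'u univ) ftr"
  where "EM_U Q = \<lparr>Src = CoAlg Q, Tgt = Src (cmK Q),
    Fo = restrict carr (coalg_ob Q), Fa = restrict under (coalg_ar Q)\<rparr>"

definition cofree :: "'u univ comonad \<Rightarrow> 'u univ \<Rightarrow> 'u univ"
  where "cofree Q A = Coalg (Fo (cmK Q) A) (Ncp (cmN Q) A)"

definition EM_R :: "'u univ comonad \<Rightarrow> ('u univ, 'u univ, 'u univ, 'u univ) ftr"
  where "EM_R Q = (let C = Src (cmK Q) in
    \<lparr>Src = C, Tgt = CoAlg Q, Fo = restrict (cofree Q) (Ob C),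
      Fa = (\<lambda>f \<in> Ar C. Comor (cofree Q (Dom C f)) (Fa (cmK Q) f) (cofree Q (Cod C f)))\<rparr>)"

text \<open>The unit at a coalgebra is its structure map; since \<open>EM_U Q \<odot> EM_R Q = cmK Q\<close> holds strictly,
  the counit is that of the comonad.\<close>

definition EM0 :: "'u univ comonad \<Rightarrow> 'u univ adjn"
  where "EM0 Q = \<lparr>aL = EM_U Q, aR = EM_R Q,
    aEta = \<lparr>Nsrc = fid (CoAlg Q), Ntgt = EM_R Q \<odot> EM_U Q,
      Ncp = (\<lambda>X \<in> coalg_ob Q. Comor X (struct X) (cofree Q (carr X)))\<rparr>,
    aEps = cmE Q\<rparr>"

definition coalg_map :: "'u univ cmd1 \<Rightarrow> 'u univ \<Rightarrow> 'u univ"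
  where "coalg_map m X = Coalg (Fo (mH m) (carr X))
    (Cmp (Tgt (mH m)) (Ncp (mT m) (carr X)) (Fa (mH m) (struct X)))"

definition CoAlg1 :: "'u univ cmd1 \<Rightarrow> ('u univ, 'u univ, 'u univ, 'u univ) ftr"
  where "CoAlg1 m = \<lparr>Src = CoAlg (mSrc m), Tgt = CoAlg (mTgt m),
    Fo = restrict (coalg_map m) (coalg_ob (mSrc m)),
    Fa = (\<lambda>f \<in> coalg_ar (mSrc m).
      Comor (coalg_map m (cdom f)) (Fa (mH m) (under f)) (coalg_map m (ccod f)))\<rparr>"

definition CoAlg2 :: "'u univ cmd2 \<Rightarrow> ('u univ, 'u univ, 'u univ, 'u univ) ntr"
  where "CoAlg2 c = \<lparr>Nsrc = CoAlg1 (cSrc c), Ntgt = CoAlg1 (cTgt c),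
    Ncp = (\<lambda>X \<in> coalg_ob (mSrc (cSrc c)).
      Comor (coalg_map (cSrc c) X) (Ncp (cPhi c) (carr X)) (coalg_map (cTgt c) X))\<rparr>"

definition EM1 :: "'u univ cmd1 \<Rightarrow> 'u univ adj1"
  where "EM1 m = \<lparr>lSrc = EM0 (mSrc m), lTgt = EM0 (mTgt m), lF = mH m, lG = CoAlg1 m,
    lZ = nid (EM_U (mTgt m) \<odot> CoAlg1 m)\<rparr>"

definition EM2 :: "'u univ cmd2 \<Rightarrow> 'u univ adj2"
  where "EM2 c = \<lparr>dSrc = EM1 (cSrc c), dTgt = EM1 (cTgt c), dPhi = cPhi c, dPsi = CoAlg2 c\<rparr>"

type_synonym 'x cmd_to_adj = "('x comonad, 'x cmd1, 'x cmd2, 'x adjn, 'x adj1, 'x adj2) fun2"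
type_synonym 'x adj_to_cmd = "('x adjn, 'x adj1, 'x adj2, 'x comonad, 'x cmd1, 'x cmd2) fun2"

definition EM :: "'u univ cmd_to_adj"
  where "EM = \<lparr>F0 = EM0, F1 = EM1, F2 = EM2\<rparr>"

definition EM_iso :: "'u univ cmd_to_adj"
  where "EM_iso = incl \<odot>\<^sub>2 EM"


section \<open>The comonad of an adjunction\<close>

definition Cm0 :: "'x adjn \<Rightarrow> 'x comonad"
  where "Cm0 A = \<lparr>cmK = aL A \<odot> aR A, cmE = aEps A, cmN = aL A \<lhd> (aEta A \<rhd> aR A)\<rparr>"

definition Cm1 :: "'x adj1 \<Rightarrow> 'x cmd1"
  where "Cm1 f = \<lparr>mSrc = Cm0 (lSrc f), mTgt = Cm0 (lTgt f), mH = lF f,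
    mT = (aL (lTgt f) \<lhd> mate f) \<bullet> (ninv (lZ f) \<rhd> aR (lSrc f))\<rparr>"

definition Cm2 :: "'x adj2 \<Rightarrow> 'x cmd2"
  where "Cm2 d = \<lparr>cSrc = Cm1 (dSrc d), cTgt = Cm1 (dTgt d), cPhi = dPhi d\<rparr>"

definition Cm_iso :: "'x adj_to_cmd"
  where "Cm_iso = \<lparr>F0 = Cm0, F1 = Cm1, F2 = Cm2\<rparr>"

definition Cm :: "'x adj_to_cmd"
  where "Cm = Cm_iso \<odot>\<^sub>2 incl"


section \<open>The 2-reflection of adjunctions into comonads\<close>

definition comparison :: "'u univ adjn \<Rightarrow> ('u univ, 'u univ, 'u univ, 'u univ) ftr"
  where "comparison A = (let L = aL A; D = Src L;
      k = (\<lambda>B. Coalg (Fo L B) (Fa L (Ncp (aEta A) B))) in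
    \<lparr>Src = D, Tgt = CoAlg (Cm0 A), Fo = restrict k (Ob D),
      Fa = (\<lambda>f \<in> Ar D. Comor (k (Dom D f)) (Fa L f) (k (Cod D f)))\<rparr>)"

definition EM_unit :: "('u univ adjn, 'u univ adj1, 'u univ adj1, 'u univ adj2) ptr"
  where "EM_unit = (let c = (\<lambda>A. \<lparr>lSrc = A, lTgt = EM0 (Cm0 A), lF = fid (Tgt (aL A)),
      lG = comparison A, lZ = nid (EM_U (Cm0 A) \<odot> comparison A)\<rparr>) in
    \<lparr>P0 = c, P1 = (\<lambda>f. id2 LAdj (cmp1 LAdj (c (lTgt f)) f))\<rparr>)"

definition id_counit :: "('x comonad, 'x cmd1, 'x cmd1, 'x cmd2) ptr"
  where "id_counit = pid Cmd id_fun2"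

end

theory Submission
  imports Defs
begin

text \<open>
  The component of the unit at a 1-cell \<open>(F, G, \<zeta>)\<close> is the 2-cell with first component the identity of \<open>F\<close>
  and with second component given by \<open>\<zeta>\<close> inverse, which lifts to coalgebras because the mate of \<open>\<zeta>\<close> is
  compatible with the units of the two adjunctions; it is an identity when \<open>\<zeta>\<close> is.
  As \<open>C\<close> sends the unit to identities and \<open>C EM = Id\<close>, both triangles commute strictly.  All of this takes place
  in the large 2-category and restricts along wide 2-full inclusions: to \<open>LAdj\<close>, which yields the
  2-reflection, and to the pseudo morphisms, since the mate of \<open>EM (H, \<theta>)\<close> has underlying
  transformation \<open>\<theta>\<close> and that of a comparison functor is an identity.
\<close>

section \<open>Calculus of functors and natural transformations\<close>

text \<open>The 2-cell of the unit at f = (F, G, \<zeta>) is forced. It compares the comparison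
  functor followed by EM (C f) with f followed by the comparison functor. Both composites have F as
  first component, but the structural isomorphism of the former is an identity and that of the
  latter is \<zeta>. A 2-cell over the identity of F must therefore have a second component lying
  over the inverse of \<zeta>. So these squares commute strictly only when \<zeta> is an identity,
  and on \<open>LAdj_iso\<close> the unit is merely pseudo-natural. The same 2-cells give full
  faithfulness. If f runs between Eilenberg-Moore adjunctions, the comparison 1-cells at its ends
  are identities and the 2-cell becomes an isomorphism from EM (C f) to f, natural in f. Since EM (C
  f) always has an identity as structural isomorphism, f itself need not lie in the image of EM: the
  functors between hom-categories are equivalences with C as a strict retraction, not
  isomorphisms.\<close>

lemma Hom_iff: "f \<in> Hom C A B \<longleftrightarrow> f \<in> Ar C \<and> Dom C f = A \<and> Cod C f = B"
  by (auto simp: Hom_def)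

lemmas [simp] = category.Dom_in category.Cod_in

lemma Idn_ar [simp]:
  assumes "category C" "A \<in> Ob C"
  shows "Idn C A \<in> Ar C" "Dom C (Idn C A) = A" "Cod C (Idn C A) = A"
  using category.Idn_in[OF assms] by (auto simp: Hom_def)

lemma Cmp_ar [simp]:
  assumes "category C" "f \<in> Ar C" "g \<in> Ar C" "Cod C f = Dom C g"
  shows "Cmp C g f \<in> Ar C" "Dom C (Cmp C g f) = Dom C f" "Cod C (Cmp C g f) = Cod C g"
  using category.Cmp_in[OF assms(1), of f "Dom C f" "Cod C f" g "Cod C g"] assms by (auto simp: Hom_def)

text \<open>The object is a variable tied down by an equation, not the term \<open>Cod C f\<close>,
  so that the rule still matches after the codomain has been rewritten. Many rules below have this
  form.\<close>

lemma Cmp_Idn [simp]: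
  assumes "category C" "f \<in> Ar C"
  shows "Cod C f = B \<Longrightarrow> Cmp C (Idn C B) f = f" "Dom C f = A \<Longrightarrow> Cmp C f (Idn C A) = f"
  using category.Idn_left[OF assms(1), of f "Dom C f" "Cod C f"]
    category.Idn_right[OF assms(1), of f "Dom C f" "Cod C f"] assms by (auto simp: Hom_def)

text \<open>Oriented so that all composites become right-nested, the normal form presupposed by
  every calculation below.\<close>

lemma Cmp_assoc [simp]:
  assumes "category C" "f \<in> Ar C" "g \<in> Ar C" "h \<in> Ar C" "Cod C f = Dom C g" "Cod C g = Dom C h"
  shows "Cmp C (Cmp C h g) f = Cmp C h (Cmp C g f)"
  using category.assoc[OF assms(1), of f "Dom C f" "Cod C f" g "Cod C g" h "Cod C h"] assms
  by (auto simp: Hom_def)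

text \<open>In a right-nested composite the two arrows of a commutative square need not form a
  subterm. This applies the square in front of a further arrow \<open>x\<close>.\<close>

lemma Cmp_eq_extend:
  assumes "Cmp C g f = Cmp C k h" "category C"
    "f \<in> Ar C" "g \<in> Ar C" "h \<in> Ar C" "k \<in> Ar C" "x \<in> Ar C"
    "Cod C f = Dom C g" "Cod C h = Dom C k" "Cod C x = Dom C f" "Dom C h = Dom C f"
  shows "Cmp C g (Cmp C f x) = Cmp C k (Cmp C h x)"
proof -
  have "Cmp C g (Cmp C f x) = Cmp C (Cmp C g f) x"
    using assms(2-) by simp
  also have "\<dots> = Cmp C k (Cmp C h x)"
    using assms(2-) by (simp add: assms(1))
  finally show ?thesis .
qed

text \<open>The variant for equations whose right-hand side is not a composite of two arrows, such
  as a triangle identity.\<close>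

lemma Cmp_eq_extend1:
  assumes "Cmp C g f = h" "category C"
    "f \<in> Ar C" "g \<in> Ar C" "x \<in> Ar C" "Cod C f = Dom C g" "Cod C x = Dom C f"
  shows "Cmp C g (Cmp C f x) = Cmp C h x"
  using assms by (metis Cmp_assoc)

section \<open>Functors and their composition\<close>

declare is_functor.Src_category [simp] is_functor.Tgt_category [simp]

lemma Fo_in [simp]: "is_functor F \<Longrightarrow> A \<in> Ob (Src F) \<Longrightarrow> Tgt F = D \<Longrightarrow> Fo F A \<in> Ob D"
  using is_functor.Fo_in by auto

lemma Fa_ar [simp]:
  assumes "is_functor F" "f \<in> Ar (Src F)" "Tgt F = D"
  shows "Fa F f \<in> Ar D" "Dom D (Fa F f) = Fo F (Dom (Src F) f)" "Cod D (Fa F f) = Fo F (Cod (Src F) f)"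
  using is_functor.Fa_in[OF assms(1), of f "Dom (Src F) f" "Cod (Src F) f"] assms by (auto simp: Hom_def)

lemma Fa_Idn [simp]: "is_functor F \<Longrightarrow> Src F = C \<Longrightarrow> A \<in> Ob C \<Longrightarrow> Fa F (Idn C A) = Idn (Tgt F) (Fo F A)"
  using is_functor.Fa_Idn by auto

lemma Fa_Cmp [simp]:
  assumes "is_functor F" "Src F = C" "f \<in> Ar C" "g \<in> Ar C" "Cod C f = Dom C g"
  shows "Fa F (Cmp C g f) = Cmp (Tgt F) (Fa F g) (Fa F f)"
  using is_functor.Fa_Cmp[OF assms(1), of f "Dom C f" "Cod C f" g "Cod C g"] assms by (auto simp: Hom_def)

lemma is_functorI:
  assumes "category (Src F)" "category (Tgt F)"
    "\<And>A. A \<in> Ob (Src F) \<Longrightarrow> Fo F A \<in> Ob (Tgt F)"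
    "\<And>f. f \<in> Ar (Src F) \<Longrightarrow> Fa F f \<in> Ar (Tgt F)"
    "\<And>f. f \<in> Ar (Src F) \<Longrightarrow> Dom (Tgt F) (Fa F f) = Fo F (Dom (Src F) f)"
    "\<And>f. f \<in> Ar (Src F) \<Longrightarrow> Cod (Tgt F) (Fa F f) = Fo F (Cod (Src F) f)"
    "\<And>A. A \<in> Ob (Src F) \<Longrightarrow> Fa F (Idn (Src F) A) = Idn (Tgt F) (Fo F A)"
    "\<And>f g. f \<in> Ar (Src F) \<Longrightarrow> g \<in> Ar (Src F) \<Longrightarrow> Cod (Src F) f = Dom (Src F) g
      \<Longrightarrow> Fa F (Cmp (Src F) g f) = Cmp (Tgt F) (Fa F g) (Fa F f)"
    "Fo F \<in> extensional (Ob (Src F))" "Fa F \<in> extensional (Ar (Src F))"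
  shows "is_functor F"
  by (rule is_functor.intro) (use assms in \<open>auto simp: Hom_def\<close>)

text \<open>Both functors are \<open>undefined\<close> off the same carriers, so agreement on
  objects and arrows already yields equality of records.\<close>

lemma ftr_eqI:
  assumes "is_functor F" "is_functor G" "Src F = Src G" "Tgt F = Tgt G"
    "\<And>A. A \<in> Ob (Src G) \<Longrightarrow> Fo F A = Fo G A" "\<And>f. f \<in> Ar (Src G) \<Longrightarrow> Fa F f = Fa G f"
  shows "F = G"
proof -
  have "Fo F = Fo G"
    by (rule extensionalityI[where A = "Ob (Src G)"])
      (use assms is_functor.Fo_ext[of F] is_functor.Fo_ext[of G] in auto)
  moreover have "Fa F = Fa G"
    by (rule extensionalityI[where A = "Ar (Src G)"])
      (use assms is_functor.Fa_ext[of F] is_functor.Fa_ext[of G] in auto)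
  ultimately show ?thesis
    using assms by (intro ftr.equality) auto
qed

lemma fid_sel [simp]:
  "Src (fid C) = C" "Tgt (fid C) = C" "A \<in> Ob C \<Longrightarrow> Fo (fid C) A = A" "f \<in> Ar C \<Longrightarrow> Fa (fid C) f = f"
  by (simp_all add: fid_def)

lemma fcmp_sel [simp]:
  "Src (G \<odot> F) = Src F" "Tgt (G \<odot> F) = Tgt G"
  "A \<in> Ob (Src F) \<Longrightarrow> Fo (G \<odot> F) A = Fo G (Fo F A)"
  "f \<in> Ar (Src F) \<Longrightarrow> Fa (G \<odot> F) f = Fa G (Fa F f)"
  by (simp_all add: fcmp_def)

lemma fid_functor [simp]: "category C \<Longrightarrow> is_functor (fid C)"
  by (rule is_functorI) (auto simp: fid_def)

lemma fcmp_functor [simp]: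
  assumes "is_functor F" "is_functor G" "Src G = Tgt F"
  shows "is_functor (G \<odot> F)"
  by (rule is_functorI) (use assms in \<open>simp_all, auto simp: fcmp_def\<close>)

lemma fid_left [simp]: "is_functor F \<Longrightarrow> Tgt F = D \<Longrightarrow> fid D \<odot> F = F"
  by (rule ftr_eqI) auto

lemma fid_right [simp]: "is_functor F \<Longrightarrow> Src F = C \<Longrightarrow> F \<odot> fid C = F"
  by (rule ftr_eqI) auto

lemma fcmp_assoc [simp]:
  assumes "is_functor F" "Tgt F = Src G"
  shows "(H \<odot> G) \<odot> F = H \<odot> (G \<odot> F)"
  using assms by (auto simp: fcmp_def restrict_def fun_eq_iff)

section \<open>Natural transformations, vertical composition and whiskering\<close>

lemma nat_trans_functors [simp]:
  assumes "nat_trans \<alpha>"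
  shows "is_functor (Nsrc \<alpha>)" "is_functor (Ntgt \<alpha>)"
    "Src (Ntgt \<alpha>) = Src (Nsrc \<alpha>)" "Tgt (Ntgt \<alpha>) = Tgt (Nsrc \<alpha>)"
  using assms by (auto simp: nat_trans_def)

lemma Ncp_ar [simp]:
  assumes "nat_trans \<alpha>" "A \<in> Ob (Src (Nsrc \<alpha>))" "Tgt (Nsrc \<alpha>) = D"
  shows "Ncp \<alpha> A \<in> Ar D" "Dom D (Ncp \<alpha> A) = Fo (Nsrc \<alpha>) A" "Cod D (Ncp \<alpha> A) = Fo (Ntgt \<alpha>) A"
  using nat_trans.Ncp_in[OF assms(1,2)] assms by (auto simp: Hom_def)

lemma naturality:
  assumes "nat_trans \<alpha>" "f \<in> Ar (Src (Nsrc \<alpha>))" "Cod (Src (Nsrc \<alpha>)) f = B" "Tgt (Nsrc \<alpha>) = D"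
  shows "Cmp D (Ncp \<alpha> B) (Fa (Nsrc \<alpha>) f) = Cmp D (Fa (Ntgt \<alpha>) f) (Ncp \<alpha> (Dom (Src (Nsrc \<alpha>)) f))"
  using nat_trans.naturality[OF assms(1), of f "Dom (Src (Nsrc \<alpha>)) f" B] assms by (auto simp: Hom_def)

lemma nat_transI:
  assumes "is_functor (Nsrc \<alpha>)" "is_functor (Ntgt \<alpha>)"
    "Src (Ntgt \<alpha>) = Src (Nsrc \<alpha>)" "Tgt (Ntgt \<alpha>) = Tgt (Nsrc \<alpha>)"
    "\<And>A. A \<in> Ob (Src (Nsrc \<alpha>)) \<Longrightarrow> Ncp \<alpha> A \<in> Ar (Tgt (Nsrc \<alpha>))"
    "\<And>A. A \<in> Ob (Src (Nsrc \<alpha>)) \<Longrightarrow> Dom (Tgt (Nsrc \<alpha>)) (Ncp \<alpha> A) = Fo (Nsrc \<alpha>) A"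
    "\<And>A. A \<in> Ob (Src (Nsrc \<alpha>)) \<Longrightarrow> Cod (Tgt (Nsrc \<alpha>)) (Ncp \<alpha> A) = Fo (Ntgt \<alpha>) A"
    "\<And>f. f \<in> Ar (Src (Nsrc \<alpha>)) \<Longrightarrow>
      Cmp (Tgt (Nsrc \<alpha>)) (Ncp \<alpha> (Cod (Src (Nsrc \<alpha>)) f)) (Fa (Nsrc \<alpha>) f)
        = Cmp (Tgt (Nsrc \<alpha>)) (Fa (Ntgt \<alpha>) f) (Ncp \<alpha> (Dom (Src (Nsrc \<alpha>)) f))"
    "Ncp \<alpha> \<in> extensional (Ob (Src (Nsrc \<alpha>)))"
  shows "nat_trans \<alpha>"
  by (rule nat_trans.intro) (use assms in \<open>auto simp: Hom_def\<close>)

lemma ntr_eqI: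
  assumes "nat_trans \<alpha>" "nat_trans \<beta>" "Nsrc \<alpha> = Nsrc \<beta>" "Ntgt \<alpha> = Ntgt \<beta>"
    "\<And>A. A \<in> Ob (Src (Nsrc \<beta>)) \<Longrightarrow> Ncp \<alpha> A = Ncp \<beta> A"
  shows "\<alpha> = \<beta>"
proof -
  have "Ncp \<alpha> = Ncp \<beta>"
    by (rule extensionalityI[where A = "Ob (Src (Nsrc \<beta>))"])
      (use assms nat_trans.Ncp_ext[of \<alpha>] nat_trans.Ncp_ext[of \<beta>] in auto)
  then show ?thesis
    using assms by (intro ntr.equality) auto
qed

lemma nid_sel [simp]:
  "Nsrc (nid F) = F" "Ntgt (nid F) = F" "A \<in> Ob (Src F) \<Longrightarrow> Ncp (nid F) A = Idn (Tgt F) (Fo F A)"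
  by (simp_all add: nid_def)

lemma nvcmp_sel [simp]:
  "Nsrc (\<beta> \<bullet> \<alpha>) = Nsrc \<alpha>" "Ntgt (\<beta> \<bullet> \<alpha>) = Ntgt \<beta>"
  "A \<in> Ob (Src (Nsrc \<alpha>)) \<Longrightarrow> Ncp (\<beta> \<bullet> \<alpha>) A = Cmp (Tgt (Nsrc \<alpha>)) (Ncp \<beta> A) (Ncp \<alpha> A)"
  by (simp_all add: nvcmp_def)

lemma nwl_sel [simp]:
  "Nsrc (G \<lhd> \<alpha>) = G \<odot> Nsrc \<alpha>" "Ntgt (G \<lhd> \<alpha>) = G \<odot> Ntgt \<alpha>"
  "A \<in> Ob (Src (Nsrc \<alpha>)) \<Longrightarrow> Ncp (G \<lhd> \<alpha>) A = Fa G (Ncp \<alpha> A)"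
  by (simp_all add: nwl_def)

lemma nwr_sel [simp]:
  "Nsrc (\<alpha> \<rhd> F) = Nsrc \<alpha> \<odot> F" "Ntgt (\<alpha> \<rhd> F) = Ntgt \<alpha> \<odot> F"
  "A \<in> Ob (Src F) \<Longrightarrow> Ncp (\<alpha> \<rhd> F) A = Ncp \<alpha> (Fo F A)"
  by (simp_all add: nwr_def)

lemma ninv_sel [simp]:
  "Nsrc (ninv \<alpha>) = Ntgt \<alpha>" "Ntgt (ninv \<alpha>) = Nsrc \<alpha>"
  "A \<in> Ob (Src (Nsrc \<alpha>)) \<Longrightarrow> Ncp (ninv \<alpha>) A = inv_ar (Tgt (Nsrc \<alpha>)) (Ncp \<alpha> A)"
  by (simp_all add: ninv_def)

lemma nid_nat [simp]: "is_functor F \<Longrightarrow> nat_trans (nid F)"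
  by (rule nat_transI) (simp_all, simp add: nid_def)

lemma nvcmp_nat [simp]:
  assumes "nat_trans \<alpha>" "nat_trans \<beta>" "Nsrc \<beta> = Ntgt \<alpha>"
  shows "nat_trans (\<beta> \<bullet> \<alpha>)"
proof -
  have [simp]: "Nsrc \<beta> = Ntgt \<alpha>" using assms(3) by simp
  have [simp]: "Src (Ntgt \<beta>) = Src (Nsrc \<alpha>)" "Tgt (Ntgt \<beta>) = Tgt (Nsrc \<alpha>)"
    using nat_trans_functors(3,4)[OF assms(2)] assms(1) by simp_all
  show ?thesis
  proof (rule nat_transI)
    fix f assume "f \<in> Ar (Src (Nsrc (\<beta> \<bullet> \<alpha>)))"
    then have f: "f \<in> Ar (Src (Nsrc \<alpha>))" by simp
    let ?D = "Tgt (Nsrc \<alpha>)" and ?C = "Src (Nsrc \<alpha>)"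
    have "Cmp ?D (Ncp \<beta> (Cod ?C f)) (Cmp ?D (Ncp \<alpha> (Cod ?C f)) (Fa (Nsrc \<alpha>) f))
      = Cmp ?D (Ncp \<beta> (Cod ?C f)) (Cmp ?D (Fa (Ntgt \<alpha>) f) (Ncp \<alpha> (Dom ?C f)))"
      using naturality[OF assms(1) f] by simp
    also have "\<dots> = Cmp ?D (Fa (Ntgt \<beta>) f) (Cmp ?D (Ncp \<beta> (Dom ?C f)) (Ncp \<alpha> (Dom ?C f)))"
      by (rule Cmp_eq_extend) (use assms f naturality[OF assms(2), of f, OF _ refl refl] in simp_all)
    finally show "Cmp (Tgt (Nsrc (\<beta> \<bullet> \<alpha>))) (Ncp (\<beta> \<bullet> \<alpha>) (Cod (Src (Nsrc (\<beta> \<bullet> \<alpha>))) f)) (Fa (Nsrc (\<beta> \<bullet> \<alpha>)) f)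
      = Cmp (Tgt (Nsrc (\<beta> \<bullet> \<alpha>))) (Fa (Ntgt (\<beta> \<bullet> \<alpha>)) f) (Ncp (\<beta> \<bullet> \<alpha>) (Dom (Src (Nsrc (\<beta> \<bullet> \<alpha>))) f))"
      using assms f by simp
  qed (use assms in \<open>simp_all, auto simp: nvcmp_def\<close>)
qed

lemma nwl_nat [simp]:
  assumes "nat_trans \<alpha>" "is_functor G" "Src G = Tgt (Nsrc \<alpha>)"
  shows "nat_trans (G \<lhd> \<alpha>)"
proof (rule nat_transI)
  fix f assume "f \<in> Ar (Src (Nsrc (G \<lhd> \<alpha>)))"
  then have f: "f \<in> Ar (Src (Nsrc \<alpha>))" by simp
  show "Cmp (Tgt (Nsrc (G \<lhd> \<alpha>))) (Ncp (G \<lhd> \<alpha>) (Cod (Src (Nsrc (G \<lhd> \<alpha>))) f)) (Fa (Nsrc (G \<lhd> \<alpha>)) f)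
    = Cmp (Tgt (Nsrc (G \<lhd> \<alpha>))) (Fa (Ntgt (G \<lhd> \<alpha>)) f) (Ncp (G \<lhd> \<alpha>) (Dom (Src (Nsrc (G \<lhd> \<alpha>))) f))"
    using arg_cong[OF naturality[OF assms(1) f refl refl], of "Fa G"] assms f by simp
qed (use assms in \<open>simp_all, auto simp: nwl_def\<close>)

lemma nwr_nat [simp]:
  assumes "nat_trans \<alpha>" "is_functor F" "Tgt F = Src (Nsrc \<alpha>)"
  shows "nat_trans (\<alpha> \<rhd> F)"
proof (rule nat_transI)
  fix f assume "f \<in> Ar (Src (Nsrc (\<alpha> \<rhd> F)))"
  then have f: "f \<in> Ar (Src F)" by simp
  show "Cmp (Tgt (Nsrc (\<alpha> \<rhd> F))) (Ncp (\<alpha> \<rhd> F) (Cod (Src (Nsrc (\<alpha> \<rhd> F))) f)) (Fa (Nsrc (\<alpha> \<rhd> F)) f)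
    = Cmp (Tgt (Nsrc (\<alpha> \<rhd> F))) (Fa (Ntgt (\<alpha> \<rhd> F)) f) (Ncp (\<alpha> \<rhd> F) (Dom (Src (Nsrc (\<alpha> \<rhd> F))) f))"
    using naturality[OF assms(1), of "Fa F f", OF _ refl refl] assms f by simp
qed (use assms in \<open>simp_all, auto simp: nwr_def\<close>)

section \<open>Invertible arrows and natural isomorphisms\<close>

lemma iso_arI:
  assumes "category C" "f \<in> Ar C" "g \<in> Ar C" "Dom C g = Cod C f" "Cod C g = Dom C f"
    "Cmp C g f = Idn C (Dom C f)" "Cmp C f g = Idn C (Cod C f)"
  shows "iso_ar C f" "inv_ar C f = g"
proof -
  show "iso_ar C f" using assms by (auto simp: iso_ar_def Hom_def)
  \<comment> \<open>Already a left inverse equals \<open>g\<close>. This uniqueness evaluates the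
    definite description in \<open>inv_ar\<close>.\<close>
  have unique: "h = g" if "h \<in> Ar C" "Dom C h = Cod C f" "Cod C h = Dom C f" "Cmp C h f = Idn C (Dom C f)" for h
  proof -
    have "h = Cmp C h (Cmp C f g)" using assms that by simp
    also have "\<dots> = Cmp C (Cmp C h f) g" using assms that(1-3) by simp
    also have "\<dots> = g" using assms that by simp
    finally show ?thesis .
  qed
  show "inv_ar C f = g"
    unfolding inv_ar_def using assms by (intro the_equality) (auto simp: Hom_def intro: unique)
qed

lemma inv_ar [simp]:
  assumes "category C" "iso_ar C f"
  shows "inv_ar C f \<in> Ar C" "Dom C (inv_ar C f) = Cod C f" "Cod C (inv_ar C f) = Dom C f"
    "Cmp C (inv_ar C f) f = Idn C (Dom C f)" "Cmp C f (inv_ar C f) = Idn C (Cod C f)"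
proof -
  obtain g where "f \<in> Ar C" "g \<in> Hom C (Cod C f) (Dom C f)"
    "Cmp C g f = Idn C (Dom C f)" "Cmp C f g = Idn C (Cod C f)"
    using assms(2) unfolding iso_ar_def by blast
  with iso_arI(2)[OF assms(1), of f g]
  show "inv_ar C f \<in> Ar C" "Dom C (inv_ar C f) = Cod C f" "Cod C (inv_ar C f) = Dom C f"
    "Cmp C (inv_ar C f) f = Idn C (Dom C f)" "Cmp C f (inv_ar C f) = Idn C (Cod C f)"
    by (auto simp: Hom_def)
qed

lemma iso_ar_ar: "iso_ar C f \<Longrightarrow> f \<in> Ar C"
  by (simp add: iso_ar_def)

lemma iso_Idn [simp]: "category C \<Longrightarrow> A \<in> Ob C \<Longrightarrow> iso_ar C (Idn C A)"
  and inv_Idn [simp]: "category C \<Longrightarrow> A \<in> Ob C \<Longrightarrow> inv_ar C (Idn C A) = Idn C A"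
  using iso_arI[of C "Idn C A" "Idn C A"] by simp_all

lemma inv_cancel [simp]:
  assumes "category C" "iso_ar C f" "x \<in> Ar C"
  shows "Cod C x = Dom C f \<Longrightarrow> Cmp C (inv_ar C f) (Cmp C f x) = x"
    "Cod C x = Cod C f \<Longrightarrow> Cmp C f (Cmp C (inv_ar C f) x) = x"
  using assms iso_ar_ar[OF assms(2)] by (simp_all flip: Cmp_assoc)

lemma iso_inv [simp]:
  assumes "category C" "iso_ar C f"
  shows "iso_ar C (inv_ar C f)" "inv_ar C (inv_ar C f) = f"
  using assms iso_ar_ar[OF assms(2)] iso_arI[of C "inv_ar C f" f] by simp_all

lemma iso_Cmp [simp]:
  assumes "category C" "iso_ar C f" "iso_ar C g" "Cod C f = Dom C g"
  shows "iso_ar C (Cmp C g f)" "inv_ar C (Cmp C g f) = Cmp C (inv_ar C f) (inv_ar C g)"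
proof -
  note [simp] = iso_ar_ar[OF assms(2)] iso_ar_ar[OF assms(3)] assms
  note * = iso_arI[of C "Cmp C g f" "Cmp C (inv_ar C f) (inv_ar C g)"]
  show "iso_ar C (Cmp C g f)" by (rule *) simp_all
  show "inv_ar C (Cmp C g f) = Cmp C (inv_ar C f) (inv_ar C g)" by (rule *) simp_all
qed

lemma iso_Fa [simp]:
  assumes "is_functor F" "iso_ar (Src F) f" "Tgt F = D"
  shows "iso_ar D (Fa F f)" "inv_ar D (Fa F f) = Fa F (inv_ar (Src F) f)"
proof -
  note [simp] = iso_ar_ar[OF assms(2)] assms(1,2) assms(3)[symmetric]
  have "Cmp D (Fa F (inv_ar (Src F) f)) (Fa F f) = Fa F (Cmp (Src F) (inv_ar (Src F) f) f)"
    "Cmp D (Fa F f) (Fa F (inv_ar (Src F) f)) = Fa F (Cmp (Src F) f (inv_ar (Src F) f))"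
    \<comment> \<open>Otherwise the composite under \<open>Fa F\<close> would collapse to an
      identity before functoriality can split it. The same precaution recurs below.\<close>
    by (simp_all del: inv_ar(4,5))
  then show "iso_ar D (Fa F f)" "inv_ar D (Fa F f) = Fa F (inv_ar (Src F) f)"
    using iso_arI[of D "Fa F f" "Fa F (inv_ar (Src F) f)"] by simp_all
qed

lemma nat_iso_nat [simp]: "nat_iso \<alpha> \<Longrightarrow> nat_trans \<alpha>"
  by (simp add: nat_iso_def)

lemma nat_iso_iso [simp]:
  "nat_iso \<alpha> \<Longrightarrow> A \<in> Ob (Src (Nsrc \<alpha>)) \<Longrightarrow> Tgt (Nsrc \<alpha>) = D \<Longrightarrow> iso_ar D (Ncp \<alpha> A)"
  by (auto simp: nat_iso_def)

lemma nat_isoI: "nat_trans \<alpha> \<Longrightarrow> (\<And>A. A \<in> Ob (Src (Nsrc \<alpha>)) \<Longrightarrow> iso_ar (Tgt (Nsrc \<alpha>)) (Ncp \<alpha> A)) \<Longrightarrow> nat_iso \<alpha>"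
  unfolding nat_iso_def by blast

lemma nid_iso [simp]: "is_functor F \<Longrightarrow> nat_iso (nid F)"
  by (rule nat_isoI) simp_all

lemma nvcmp_iso [simp]:
  assumes "nat_iso \<alpha>" "nat_iso \<beta>" "Nsrc \<beta> = Ntgt \<alpha>"
  shows "nat_iso (\<beta> \<bullet> \<alpha>)"
proof -
  have [simp]: "Src (Ntgt \<beta>) = Src (Nsrc \<alpha>)" "Tgt (Ntgt \<beta>) = Tgt (Nsrc \<alpha>)"
    using nat_trans_functors(3,4)[of \<beta>] assms by simp_all
  show ?thesis
    by (rule nat_isoI) (use assms in simp_all)
qed

lemma nwl_iso [simp]: "nat_iso \<alpha> \<Longrightarrow> is_functor G \<Longrightarrow> Src G = Tgt (Nsrc \<alpha>) \<Longrightarrow> nat_iso (G \<lhd> \<alpha>)"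
  by (rule nat_isoI) simp_all

lemma nwr_iso [simp]: "nat_iso \<alpha> \<Longrightarrow> is_functor F \<Longrightarrow> Tgt F = Src (Nsrc \<alpha>) \<Longrightarrow> nat_iso (\<alpha> \<rhd> F)"
  by (rule nat_isoI) simp_all

lemma ninv_iso [simp]:
  assumes "nat_iso \<alpha>"
  shows "nat_iso (ninv \<alpha>)"
proof (rule nat_isoI)
  note [simp] = assms
  let ?D = "Tgt (Nsrc \<alpha>)" and ?C = "Src (Nsrc \<alpha>)"
  show "nat_trans (ninv \<alpha>)"
  proof (rule nat_transI)
    fix f assume "f \<in> Ar (Src (Nsrc (ninv \<alpha>)))"
    then have f [simp]: "f \<in> Ar ?C" by simp
    \<comment> \<open>Composing with a component of \<alpha> and its inverse on the right exposes
      one side of the naturality square of \<alpha>, which is then used backwards.\<close>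
    have "Cmp ?D (inv_ar ?D (Ncp \<alpha> (Cod ?C f))) (Fa (Ntgt \<alpha>) f)
      = Cmp ?D (inv_ar ?D (Ncp \<alpha> (Cod ?C f)))
        (Cmp ?D (Cmp ?D (Fa (Ntgt \<alpha>) f) (Ncp \<alpha> (Dom ?C f))) (inv_ar ?D (Ncp \<alpha> (Dom ?C f))))"
      by simp
    also have "\<dots> = Cmp ?D (Fa (Nsrc \<alpha>) f) (inv_ar ?D (Ncp \<alpha> (Dom ?C f)))"
      by (subst naturality[OF _ _ refl, symmetric]) simp_all
    finally show "Cmp (Tgt (Nsrc (ninv \<alpha>))) (Ncp (ninv \<alpha>) (Cod (Src (Nsrc (ninv \<alpha>))) f)) (Fa (Nsrc (ninv \<alpha>)) f)
      = Cmp (Tgt (Nsrc (ninv \<alpha>))) (Fa (Ntgt (ninv \<alpha>)) f) (Ncp (ninv \<alpha>) (Dom (Src (Nsrc (ninv \<alpha>))) f))"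
      by simp
  qed (use assms in \<open>simp_all, auto simp: ninv_def\<close>)
qed (use assms in simp_all)

lemma NT_iff: "\<alpha> \<in> NT F G \<longleftrightarrow> nat_trans \<alpha> \<and> Nsrc \<alpha> = F \<and> Ntgt \<alpha> = G"
  by (simp add: NT_def)

lemma nvcmp_nid [simp]:
  assumes "nat_trans \<alpha>"
  shows "Ntgt \<alpha> = G \<Longrightarrow> nid G \<bullet> \<alpha> = \<alpha>" "Nsrc \<alpha> = F \<Longrightarrow> \<alpha> \<bullet> nid F = \<alpha>"
  using assms by (auto intro!: ntr_eqI)

lemma nvcmp_assoc [simp]:
  assumes "nat_trans \<alpha>" "nat_trans \<beta>" "nat_trans \<gamma>" "Nsrc \<beta> = Ntgt \<alpha>" "Nsrc \<gamma> = Ntgt \<beta>"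
  shows "(\<gamma> \<bullet> \<beta>) \<bullet> \<alpha> = \<gamma> \<bullet> (\<beta> \<bullet> \<alpha>)"
proof -
  have [simp]: "Nsrc \<beta> = Ntgt \<alpha>" "Nsrc \<gamma> = Ntgt \<beta>" using assms by simp_all
  have [simp]: "Src (Ntgt \<beta>) = Src (Nsrc \<alpha>)" "Tgt (Ntgt \<beta>) = Tgt (Nsrc \<alpha>)"
    using nat_trans_functors(3,4)[OF assms(2)] assms(1) by simp_all
  show ?thesis
    by (rule ntr_eqI) (use assms in simp_all)
qed

lemma nwl_nid [simp]: "is_functor F \<Longrightarrow> is_functor G \<Longrightarrow> Src G = Tgt F \<Longrightarrow> G \<lhd> nid F = nid (G \<odot> F)"
  by (rule ntr_eqI) auto

lemma nwr_nid [simp]: "is_functor F \<Longrightarrow> is_functor G \<Longrightarrow> Src G = Tgt F \<Longrightarrow> nid G \<rhd> F = nid (G \<odot> F)"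
  by (rule ntr_eqI) auto

lemma nwl_fid [simp]: "nat_trans \<alpha> \<Longrightarrow> Tgt (Nsrc \<alpha>) = D \<Longrightarrow> fid D \<lhd> \<alpha> = \<alpha>"
  by (rule ntr_eqI) auto

lemma nwr_fid [simp]: "nat_trans \<alpha> \<Longrightarrow> Src (Nsrc \<alpha>) = C \<Longrightarrow> \<alpha> \<rhd> fid C = \<alpha>"
  by (rule ntr_eqI) auto

lemma ninv_nid [simp]: "is_functor F \<Longrightarrow> ninv (nid F) = nid F"
  by (rule ntr_eqI) auto

section \<open>Horizontal composition\<close>

lemma nhcmp_sel [simp]:
  "nat_trans \<alpha> \<Longrightarrow> Nsrc (nhcmp \<beta> \<alpha>) = Nsrc \<beta> \<odot> Nsrc \<alpha>"
  "nat_trans \<alpha> \<Longrightarrow> Ntgt (nhcmp \<beta> \<alpha>) = Ntgt \<beta> \<odot> Ntgt \<alpha>"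
  "nat_trans \<alpha> \<Longrightarrow> A \<in> Ob (Src (Nsrc \<alpha>))
    \<Longrightarrow> Ncp (nhcmp \<beta> \<alpha>) A = Cmp (Tgt (Nsrc \<beta>)) (Ncp \<beta> (Fo (Ntgt \<alpha>) A)) (Fa (Nsrc \<beta>) (Ncp \<alpha> A))"
  by (simp_all add: nhcmp_def)

lemma nhcmp_nat [simp]:
  "nat_trans \<alpha> \<Longrightarrow> nat_trans \<beta> \<Longrightarrow> Tgt (Nsrc \<alpha>) = Src (Nsrc \<beta>) \<Longrightarrow> nat_trans (nhcmp \<beta> \<alpha>)"
  by (simp add: nhcmp_def)

lemma nhcmp_nid [simp]:
  assumes "nat_trans \<alpha>"
  shows "Tgt (Nsrc \<alpha>) = D \<Longrightarrow> nhcmp (nid (fid D)) \<alpha> = \<alpha>"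
    "Src (Nsrc \<alpha>) = C \<Longrightarrow> nhcmp \<alpha> (nid (fid C)) = \<alpha>"
  using assms by (auto intro!: ntr_eqI)

lemma nhcmp_nid_nid [simp]:
  "is_functor F \<Longrightarrow> is_functor G \<Longrightarrow> Src G = Tgt F \<Longrightarrow> nhcmp (nid G) (nid F) = nid (G \<odot> F)"
  by (simp add: nhcmp_def)

lemma nhcmp_assoc:
  assumes "nat_trans \<alpha>" "nat_trans \<beta>" "nat_trans \<gamma>"
    "Tgt (Nsrc \<alpha>) = Src (Nsrc \<beta>)" "Tgt (Nsrc \<beta>) = Src (Nsrc \<gamma>)"
  shows "nhcmp (nhcmp \<gamma> \<beta>) \<alpha> = nhcmp \<gamma> (nhcmp \<beta> \<alpha>)"
  by (rule ntr_eqI) (use assms in simp_all)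

text \<open>After cancelling common factors, this is the naturality of \<beta> at the components of
  \<alpha>'.\<close>

lemma nhcmp_interchange:
  assumes "nat_trans \<alpha>" "nat_trans \<alpha>'" "nat_trans \<beta>" "nat_trans \<beta>'"
    "Nsrc \<alpha>' = Ntgt \<alpha>" "Nsrc \<beta>' = Ntgt \<beta>" "Tgt (Nsrc \<alpha>) = Src (Nsrc \<beta>)"
  shows "nhcmp (\<beta>' \<bullet> \<beta>) (\<alpha>' \<bullet> \<alpha>) = nhcmp \<beta>' \<alpha>' \<bullet> nhcmp \<beta> \<alpha>"
proof -
  have [simp]: "Nsrc \<alpha>' = Ntgt \<alpha>" "Nsrc \<beta>' = Ntgt \<beta>" using assms by simp_all
  have [simp]: "Src (Ntgt \<alpha>') = Src (Nsrc \<alpha>)" "Tgt (Ntgt \<alpha>') = Tgt (Nsrc \<alpha>)"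
    "Src (Ntgt \<beta>') = Src (Nsrc \<beta>)" "Tgt (Ntgt \<beta>') = Tgt (Nsrc \<beta>)"
    using nat_trans_functors(3,4)[OF assms(2)] nat_trans_functors(3,4)[OF assms(4)] assms(1,3) by simp_all
  note [simp] = assms(1-4,7)
  show ?thesis
  proof (rule ntr_eqI)
    fix A assume "A \<in> Ob (Src (Nsrc (nhcmp \<beta>' \<alpha>' \<bullet> nhcmp \<beta> \<alpha>)))"
    then have A [simp]: "A \<in> Ob (Src (Nsrc \<alpha>))" by simp
    let ?E = "Tgt (Nsrc \<beta>)"
    have "Cmp ?E (Ncp \<beta> (Fo (Ntgt \<alpha>') A)) (Cmp ?E (Fa (Nsrc \<beta>) (Ncp \<alpha>' A)) (Fa (Nsrc \<beta>) (Ncp \<alpha> A)))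
      = Cmp ?E (Fa (Ntgt \<beta>) (Ncp \<alpha>' A)) (Cmp ?E (Ncp \<beta> (Fo (Ntgt \<alpha>) A)) (Fa (Nsrc \<beta>) (Ncp \<alpha> A)))"
      by (rule Cmp_eq_extend) (use naturality[OF assms(3), of "Ncp \<alpha>' A", OF _ refl refl] in simp_all)
    then show "Ncp (nhcmp (\<beta>' \<bullet> \<beta>) (\<alpha>' \<bullet> \<alpha>)) A = Ncp (nhcmp \<beta>' \<alpha>' \<bullet> nhcmp \<beta> \<alpha>) A"
      by simp
  qed simp_all
qed

section \<open>Two-dimensional generalities\<close>

lemma categoryI:
  assumes "\<And>f. f \<in> Ar C \<Longrightarrow> Dom C f \<in> Ob C" "\<And>f. f \<in> Ar C \<Longrightarrow> Cod C f \<in> Ob C"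
    "\<And>A. A \<in> Ob C \<Longrightarrow> Idn C A \<in> Ar C"
    "\<And>A. A \<in> Ob C \<Longrightarrow> Dom C (Idn C A) = A" "\<And>A. A \<in> Ob C \<Longrightarrow> Cod C (Idn C A) = A"
    "\<And>f g. f \<in> Ar C \<Longrightarrow> g \<in> Ar C \<Longrightarrow> Cod C f = Dom C g \<Longrightarrow> Cmp C g f \<in> Ar C"
    "\<And>f g. f \<in> Ar C \<Longrightarrow> g \<in> Ar C \<Longrightarrow> Cod C f = Dom C g \<Longrightarrow> Dom C (Cmp C g f) = Dom C f"
    "\<And>f g. f \<in> Ar C \<Longrightarrow> g \<in> Ar C \<Longrightarrow> Cod C f = Dom C g \<Longrightarrow> Cod C (Cmp C g f) = Cod C g"
    "\<And>f. f \<in> Ar C \<Longrightarrow> Cmp C (Idn C (Cod C f)) f = f"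
    "\<And>f. f \<in> Ar C \<Longrightarrow> Cmp C f (Idn C (Dom C f)) = f"
    "\<And>f g h. f \<in> Ar C \<Longrightarrow> g \<in> Ar C \<Longrightarrow> h \<in> Ar C \<Longrightarrow> Cod C f = Dom C g \<Longrightarrow> Cod C g = Dom C h
      \<Longrightarrow> Cmp C (Cmp C h g) f = Cmp C h (Cmp C g f)"
  shows "category C"
  by (rule category.intro) (use assms in \<open>auto simp: Hom_def\<close>)

lemma cat01_sel [simp]:
  "Ob (cat01 X) = C0 X" "Ar (cat01 X) = C1 X" "Dom (cat01 X) = src1 X" "Cod (cat01 X) = tgt1 X"
  "Idn (cat01 X) = id1 X" "Cmp (cat01 X) = cmp1 X"
  by (simp_all add: cat01_def)

lemma cat12_sel [simp]:
  "Ob (cat12 X) = C1 X" "Ar (cat12 X) = C2 X" "Dom (cat12 X) = src2 X" "Cod (cat12 X) = tgt2 X"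
  "Idn (cat12 X) = id2 X" "Cmp (cat12 X) = vcmp X"
  by (simp_all add: cat12_def)

lemma cat02_sel [simp]:
  "Ob (cat02 X) = C0 X" "Ar (cat02 X) = C2 X" "Dom (cat02 X) = (\<lambda>\<alpha>. src1 X (src2 X \<alpha>))"
  "Cod (cat02 X) = (\<lambda>\<alpha>. tgt1 X (tgt2 X \<alpha>))" "Idn (cat02 X) = (\<lambda>a. id2 X (id1 X a))" "Cmp (cat02 X) = hcmp X"
  by (simp_all add: cat02_def)

lemmas [simp] = two_category.category01 two_category.category12 two_category.category02

lemma cells1 [simp]:
  assumes "two_category X"
  shows "f \<in> C1 X \<Longrightarrow> src1 X f \<in> C0 X" "f \<in> C1 X \<Longrightarrow> tgt1 X f \<in> C0 X"
    "a \<in> C0 X \<Longrightarrow> id1 X a \<in> C1 X" "a \<in> C0 X \<Longrightarrow> src1 X (id1 X a) = a" "a \<in> C0 X \<Longrightarrow> tgt1 X (id1 X a) = a"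
    "f \<in> C1 X \<Longrightarrow> g \<in> C1 X \<Longrightarrow> tgt1 X f = src1 X g \<Longrightarrow> cmp1 X g f \<in> C1 X"
    "f \<in> C1 X \<Longrightarrow> g \<in> C1 X \<Longrightarrow> tgt1 X f = src1 X g \<Longrightarrow> src1 X (cmp1 X g f) = src1 X f"
    "f \<in> C1 X \<Longrightarrow> g \<in> C1 X \<Longrightarrow> tgt1 X f = src1 X g \<Longrightarrow> tgt1 X (cmp1 X g f) = tgt1 X g"
    "f \<in> C1 X \<Longrightarrow> tgt1 X f = a \<Longrightarrow> cmp1 X (id1 X a) f = f"
    "f \<in> C1 X \<Longrightarrow> src1 X f = a \<Longrightarrow> cmp1 X f (id1 X a) = f"
    "f \<in> C1 X \<Longrightarrow> g \<in> C1 X \<Longrightarrow> h \<in> C1 X \<Longrightarrow> tgt1 X f = src1 X g \<Longrightarrow> tgt1 X g = src1 X h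
      \<Longrightarrow> cmp1 X (cmp1 X h g) f = cmp1 X h (cmp1 X g f)"
  using two_category.category01[OF assms] category.Dom_in[of "cat01 X"] category.Cod_in[of "cat01 X"]
    Idn_ar[of "cat01 X"] Cmp_ar[of "cat01 X" f g] Cmp_Idn[of "cat01 X" f] Cmp_assoc[of "cat01 X" f g h]
  by simp_all

lemma cells2 [simp]:
  assumes "two_category X"
  shows "\<alpha> \<in> C2 X \<Longrightarrow> src2 X \<alpha> \<in> C1 X" "\<alpha> \<in> C2 X \<Longrightarrow> tgt2 X \<alpha> \<in> C1 X"
    "f \<in> C1 X \<Longrightarrow> id2 X f \<in> C2 X" "f \<in> C1 X \<Longrightarrow> src2 X (id2 X f) = f" "f \<in> C1 X \<Longrightarrow> tgt2 X (id2 X f) = f"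
    "\<alpha> \<in> C2 X \<Longrightarrow> \<beta> \<in> C2 X \<Longrightarrow> tgt2 X \<alpha> = src2 X \<beta> \<Longrightarrow> vcmp X \<beta> \<alpha> \<in> C2 X"
    "\<alpha> \<in> C2 X \<Longrightarrow> \<beta> \<in> C2 X \<Longrightarrow> tgt2 X \<alpha> = src2 X \<beta> \<Longrightarrow> src2 X (vcmp X \<beta> \<alpha>) = src2 X \<alpha>"
    "\<alpha> \<in> C2 X \<Longrightarrow> \<beta> \<in> C2 X \<Longrightarrow> tgt2 X \<alpha> = src2 X \<beta> \<Longrightarrow> tgt2 X (vcmp X \<beta> \<alpha>) = tgt2 X \<beta>"
    "\<alpha> \<in> C2 X \<Longrightarrow> tgt2 X \<alpha> = f \<Longrightarrow> vcmp X (id2 X f) \<alpha> = \<alpha>"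
    "\<alpha> \<in> C2 X \<Longrightarrow> src2 X \<alpha> = f \<Longrightarrow> vcmp X \<alpha> (id2 X f) = \<alpha>"
    "\<alpha> \<in> C2 X \<Longrightarrow> \<beta> \<in> C2 X \<Longrightarrow> \<gamma> \<in> C2 X \<Longrightarrow> tgt2 X \<alpha> = src2 X \<beta> \<Longrightarrow> tgt2 X \<beta> = src2 X \<gamma>
      \<Longrightarrow> vcmp X (vcmp X \<gamma> \<beta>) \<alpha> = vcmp X \<gamma> (vcmp X \<beta> \<alpha>)"
  using two_category.category12[OF assms] category.Dom_in[of "cat12 X"] category.Cod_in[of "cat12 X"]
    Idn_ar[of "cat12 X"] Cmp_ar[of "cat12 X" \<alpha> \<beta>] Cmp_Idn[of "cat12 X" \<alpha>] Cmp_assoc[of "cat12 X" \<alpha> \<beta> \<gamma>]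
  by simp_all

text \<open>Globularity as a rewrite rule: the 0-cells bounding a 2-cell are always read off its
  source.\<close>

lemma tgt1_tgt2 [simp]:
  assumes "two_category X" "\<alpha> \<in> C2 X"
  shows "src1 X (tgt2 X \<alpha>) = src1 X (src2 X \<alpha>)" "tgt1 X (tgt2 X \<alpha>) = tgt1 X (src2 X \<alpha>)"
  using two_category.src_globular[OF assms] two_category.tgt_globular[OF assms] by simp_all

lemma hcells2 [simp]:
  assumes "two_category X"
  shows "\<alpha> \<in> C2 X \<Longrightarrow> \<beta> \<in> C2 X \<Longrightarrow> tgt1 X (src2 X \<alpha>) = src1 X (src2 X \<beta>) \<Longrightarrow> hcmp X \<beta> \<alpha> \<in> C2 X"
    "\<alpha> \<in> C2 X \<Longrightarrow> \<beta> \<in> C2 X \<Longrightarrow> tgt1 X (src2 X \<alpha>) = src1 X (src2 X \<beta>)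
      \<Longrightarrow> src2 X (hcmp X \<beta> \<alpha>) = cmp1 X (src2 X \<beta>) (src2 X \<alpha>)"
    "\<alpha> \<in> C2 X \<Longrightarrow> \<beta> \<in> C2 X \<Longrightarrow> tgt1 X (src2 X \<alpha>) = src1 X (src2 X \<beta>)
      \<Longrightarrow> tgt2 X (hcmp X \<beta> \<alpha>) = cmp1 X (tgt2 X \<beta>) (tgt2 X \<alpha>)"
    "\<alpha> \<in> C2 X \<Longrightarrow> tgt1 X (src2 X \<alpha>) = a \<Longrightarrow> hcmp X (id2 X (id1 X a)) \<alpha> = \<alpha>"
    "\<alpha> \<in> C2 X \<Longrightarrow> src1 X (src2 X \<alpha>) = a \<Longrightarrow> hcmp X \<alpha> (id2 X (id1 X a)) = \<alpha>"
    "f \<in> C1 X \<Longrightarrow> g \<in> C1 X \<Longrightarrow> tgt1 X f = src1 X g \<Longrightarrow> hcmp X (id2 X g) (id2 X f) = id2 X (cmp1 X g f)"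
  using two_category.category02[OF assms] assms
    Cmp_ar[of "cat02 X" \<alpha> \<beta>] Cmp_Idn[of "cat02 X" \<alpha>] two_category.src2_hcmp[OF assms, of \<alpha> \<beta>]
    two_category.tgt2_hcmp[OF assms, of \<alpha> \<beta>] two_category.id2_cmp1[OF assms, of f g]
  by simp_all

section \<open>Wide 2-full sub-2-categories\<close>

lemma wide_full_sel [simp]:
  "C0 (wide_full X P) = C0 X" "C1 (wide_full X P) = {f \<in> C1 X. P f}"
  "C2 (wide_full X P) = {\<alpha> \<in> C2 X. P (src2 X \<alpha>) \<and> P (tgt2 X \<alpha>)}"
  "src1 (wide_full X P) = src1 X" "tgt1 (wide_full X P) = tgt1 X"
  "src2 (wide_full X P) = src2 X" "tgt2 (wide_full X P) = tgt2 X"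
  "id1 (wide_full X P) = id1 X" "cmp1 (wide_full X P) = cmp1 X" "id2 (wide_full X P) = id2 X"
  "vcmp (wide_full X P) = vcmp X" "hcmp (wide_full X P) = hcmp X"
  by (simp_all add: wide_full_def)

text \<open>Closure is required for 1-cells only. By 2-fullness a composite 2-cell is retained as
  soon as its boundary is, and this boundary is built from retained 1-cells.\<close>

definition closed1 :: "('o, 'm, 't) cat2 \<Rightarrow> ('m \<Rightarrow> bool) \<Rightarrow> bool"
  where "closed1 X P \<longleftrightarrow> (\<forall>a \<in> C0 X. P (id1 X a)) \<and>
    (\<forall>f \<in> C1 X. \<forall>g \<in> C1 X. tgt1 X f = src1 X g \<longrightarrow> P f \<longrightarrow> P g \<longrightarrow> P (cmp1 X g f))"

lemma two_category_wide_full: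
  assumes X: "two_category X" and P: "closed1 X P"
  shows "two_category (wide_full X P)"
proof (rule two_category.intro)
  note [simp] = X
  have hcmp_assoc: "hcmp X (hcmp X \<gamma> \<beta>) \<alpha> = hcmp X \<gamma> (hcmp X \<beta> \<alpha>)"
    if "\<alpha> \<in> C2 X" "\<beta> \<in> C2 X" "\<gamma> \<in> C2 X" "tgt1 X (src2 X \<alpha>) = src1 X (src2 X \<beta>)"
      "tgt1 X (src2 X \<beta>) = src1 X (src2 X \<gamma>)" for \<alpha> \<beta> \<gamma>
    using that Cmp_assoc[of "cat02 X" \<alpha> \<beta> \<gamma>] by simp
  show "category (cat01 (wide_full X P))" "category (cat12 (wide_full X P))" "category (cat02 (wide_full X P))"
    by (rule categoryI; use P in \<open>auto simp: closed1_def hcmp_assoc\<close>)+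
qed (use X two_category.interchange[OF X] in \<open>auto simp: two_category.interchange\<close>)

lemma two_functor_wide_full:
  assumes F: "two_functor X Y F" and P: "closed1 X P" and Q: "closed1 Y Q"
    and PQ: "\<And>f. f \<in> C1 X \<Longrightarrow> P f \<Longrightarrow> Q (F1 F f)"
  shows "two_functor (wide_full X P) (wide_full Y Q) F"
proof -
  interpret F: two_functor X Y F by fact
  show ?thesis
    by (rule two_functor.intro)
      (use F.source F.target P Q PQ in \<open>auto simp: two_category_wide_full F.F0_in F.F1_in F.F2_in F.src1 F.tgt1
        F.src2 F.tgt2 F.id1 F.cmp1 F.id2 F.vcmp F.hcmp\<close>)
qed

text \<open>The inverse has the same two 1-cells as its boundary, so 2-fullness retains it.\<close>

lemma iso2_wide_full:
  "iso2 X \<alpha> \<Longrightarrow> P (src2 X \<alpha>) \<Longrightarrow> P (tgt2 X \<alpha>) \<Longrightarrow> iso2 (wide_full X P) \<alpha>"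
  by (auto simp: iso2_def iso_ar_def Hom_def)

lemma iso2_id2 [simp]: "two_category X \<Longrightarrow> f \<in> C1 X \<Longrightarrow> iso2 X (id2 X f)"
  using iso_Idn[of "cat12 X" f] by (simp add: iso2_def)

text \<open>All equations are inherited, and the 2-cell components survive by 2-fullness. Only the
  1-cells \<open>P0 \<sigma> a\<close> and the images of 1-cells under both 2-functors have to be
  checked.\<close>

lemma pseudo_natural_wide_full:
  assumes \<sigma>: "pseudo_natural X Y F G \<sigma>" and P: "closed1 X P" and Q: "closed1 Y Q"
    and F: "\<And>f. f \<in> C1 X \<Longrightarrow> P f \<Longrightarrow> Q (F1 F f)" and G: "\<And>f. f \<in> C1 X \<Longrightarrow> P f \<Longrightarrow> Q (F1 G f)"
    and P0: "\<And>a. a \<in> C0 X \<Longrightarrow> Q (P0 \<sigma> a)"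
  shows "pseudo_natural (wide_full X P) (wide_full Y Q) F G \<sigma>"
proof -
  interpret \<sigma>: pseudo_natural X Y F G \<sigma> by fact
  interpret F: two_functor X Y F by (rule \<sigma>.source)
  interpret G: two_functor X Y G by (rule \<sigma>.target)
  note [simp] = F.source F.target F.src1 F.tgt1 G.src1 G.tgt1 F.F1_in G.F1_in
  have src2: "src2 Y (P1 \<sigma> f) = cmp1 Y (F1 G f) (P0 \<sigma> (src1 X f))"
    and tgt2: "tgt2 Y (P1 \<sigma> f) = cmp1 Y (P0 \<sigma> (tgt1 X f)) (F1 F f)"
    and P1: "P1 \<sigma> f \<in> C2 Y" if "f \<in> C1 X" for f
    using \<sigma>.P1_in[of f "src1 X f" "tgt1 X f"] that by (auto simp: Hom_def)
  have P0': "P0 \<sigma> a \<in> C1 Y" "src1 Y (P0 \<sigma> a) = F0 F a" "tgt1 Y (P0 \<sigma> a) = F0 G a" if "a \<in> C0 X" for a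
    using \<sigma>.P0_in[OF that] by (auto simp: Hom_def)
  have Q_src: "Q (cmp1 Y (F1 G f) (P0 \<sigma> (src1 X f)))" and Q_tgt: "Q (cmp1 Y (P0 \<sigma> (tgt1 X f)) (F1 F f))"
    if "f \<in> C1 X" "P f" for f
    using Q that by (auto simp: closed1_def F G P0 P0')
  show ?thesis
  proof (rule pseudo_natural.intro)
    show "two_functor (wide_full X P) (wide_full Y Q) F" "two_functor (wide_full X P) (wide_full Y Q) G"
      using two_functor_wide_full \<sigma>.source \<sigma>.target P Q F G by metis+
  next
    fix f assume "f \<in> C1 (wide_full X P)"
    then have f: "f \<in> C1 X" "P f" by auto
    show "iso2 (wide_full Y Q) (P1 \<sigma> f)"
      by (rule iso2_wide_full[OF \<sigma>.P1_iso[OF f(1)]]) (use f Q_src Q_tgt src2 tgt2 in auto)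
  next
    fix \<alpha> f g a b
    assume "\<alpha> \<in> Hom (cat12 (wide_full X P)) f g" "f \<in> Hom (cat01 (wide_full X P)) a b"
    then show "vcmp (wide_full Y Q) (P1 \<sigma> g) (hcmp (wide_full Y Q) (F2 G \<alpha>) (id2 (wide_full Y Q) (P0 \<sigma> a))) =
       vcmp (wide_full Y Q) (hcmp (wide_full Y Q) (id2 (wide_full Y Q) (P0 \<sigma> b)) (F2 F \<alpha>)) (P1 \<sigma> f)"
      using \<sigma>.P1_natural[of \<alpha> f g a b] by (auto simp: Hom_def)
  next
    fix f g a b c
    assume "f \<in> Hom (cat01 (wide_full X P)) a b" "g \<in> Hom (cat01 (wide_full X P)) b c"
    then show "P1 \<sigma> (cmp1 (wide_full X P) g f) =
       vcmp (wide_full Y Q) (hcmp (wide_full Y Q) (P1 \<sigma> g) (id2 (wide_full Y Q) (F1 F f)))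
        (hcmp (wide_full Y Q) (id2 (wide_full Y Q) (F1 G g)) (P1 \<sigma> f))"
      using \<sigma>.P1_cmp1[of f a b g c] by (auto simp: Hom_def)
  qed (use \<sigma>.P1_id1 P0 P0' P1 src2 tgt2 Q_src Q_tgt in \<open>auto simp: Hom_def\<close>)
qed

text \<open>Components are plain total functions without extensionality. This permits the exchange
  of \<open>bi_unit\<close> for \<open>EM_unit\<close>, which are shown to agree on the cells of
  \<open>LAdj\<close> only.\<close>

lemma pseudo_natural_cong:
  assumes \<sigma>: "pseudo_natural X Y F G \<sigma>"
    and P0: "\<And>a. a \<in> C0 X \<Longrightarrow> P0 \<tau> a = P0 \<sigma> a" and P1: "\<And>f. f \<in> C1 X \<Longrightarrow> P1 \<tau> f = P1 \<sigma> f"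
  shows "pseudo_natural X Y F G \<tau>"
proof -
  interpret \<sigma>: pseudo_natural X Y F G \<sigma> by fact
  interpret F: two_functor X Y F by (rule \<sigma>.source)
  note [simp] = F.source
  show ?thesis
  proof (rule pseudo_natural.intro)
    fix \<alpha> f g a b
    assume A: "\<alpha> \<in> Hom (cat12 X) f g" "f \<in> Hom (cat01 X) a b"
    then have *: "\<alpha> \<in> C2 X" "f = src2 X \<alpha>" "g = tgt2 X \<alpha>" "a = src1 X f" "b = tgt1 X f"
      by (auto simp: Hom_def)
    then have "f \<in> C1 X" "g \<in> C1 X" "a \<in> C0 X" "b \<in> C0 X" by simp_all
    then show "vcmp Y (P1 \<tau> g) (hcmp Y (F2 G \<alpha>) (id2 Y (P0 \<tau> a)))
        = vcmp Y (hcmp Y (id2 Y (P0 \<tau> b)) (F2 F \<alpha>)) (P1 \<tau> f)"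
      using \<sigma>.P1_natural[OF A] by (simp add: P0 P1)
  next
    fix f a b
    assume "f \<in> Hom (cat01 X) a b"
    then show "P1 \<tau> f \<in> Hom (cat12 Y) (cmp1 Y (F1 G f) (P0 \<tau> a)) (cmp1 Y (P0 \<tau> b) (F1 F f))"
      using \<sigma>.P1_in[of f a b] by (auto simp: Hom_iff P0 P1)
  next
    fix f g a b c
    assume "f \<in> Hom (cat01 X) a b" "g \<in> Hom (cat01 X) b c"
    then show "P1 \<tau> (cmp1 X g f) = vcmp Y (hcmp Y (P1 \<tau> g) (id2 Y (F1 F f))) (hcmp Y (id2 Y (F1 G g)) (P1 \<tau> f))"
      using \<sigma>.P1_cmp1[of f a b g c] by (auto simp: Hom_iff P0 P1)
  qed (use \<sigma>.source \<sigma>.target \<sigma>.P0_in \<sigma>.P1_iso \<sigma>.P1_id1 in \<open>simp_all add: P0 P1\<close>)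
qed

text \<open>Agreement on cells is enough for identity components to be well typed. It is applied to
  C EM and the identity 2-functor, whose records may differ off the carriers.\<close>

lemma pseudo_natural_pid:
  assumes F: "two_functor X Y F" and G: "two_functor X Y G" and eq: "eq_fun2 X F G"
  shows "pseudo_natural X Y F G (pid Y G)"
proof -
  interpret G: two_functor X Y G by (rule G)
  note [simp] = G.source G.target G.F0_in G.F1_in G.F2_in G.src1 G.tgt1 G.src2 G.tgt2 G.id1 G.cmp1
  have [simp]: "a \<in> C0 X \<Longrightarrow> F0 F a = F0 G a" "f \<in> C1 X \<Longrightarrow> F1 F f = F1 G f" "\<alpha> \<in> C2 X \<Longrightarrow> F2 F \<alpha> = F2 G \<alpha>"
    for a f \<alpha> using eq by (auto simp: eq_fun2_def)
  show ?thesis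
    by (rule pseudo_natural.intro) (use F G in \<open>auto simp: pid_def Hom_iff\<close>)
qed

lemma two_functor_id: "two_category X \<Longrightarrow> two_functor X X id_fun2"
  by (rule two_functor.intro) (simp_all add: id_fun2_def)

lemma id_fun2_sel [simp]: "F0 id_fun2 a = a" "F1 id_fun2 f = f" "F2 id_fun2 \<alpha> = \<alpha>"
  by (simp_all add: id_fun2_def)

lemma cmp_fun2_sel [simp]:
  "F0 (G \<odot>\<^sub>2 F) a = F0 G (F0 F a)" "F1 (G \<odot>\<^sub>2 F) f = F1 G (F1 F f)" "F2 (G \<odot>\<^sub>2 F) \<alpha> = F2 G (F2 F \<alpha>)"
  by (simp_all add: cmp_fun2_def)

lemma two_functor_cmp:
  assumes F: "two_functor X Y F" and G: "two_functor Y Z G"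
  shows "two_functor X Z (G \<odot>\<^sub>2 F)"
proof -
  interpret F: two_functor X Y F by (rule F)
  interpret G: two_functor Y Z G by (rule G)
  show ?thesis
    by (rule two_functor.intro) (use F.source G.target in \<open>simp_all add: F.F0_in F.F1_in F.F2_in G.F0_in G.F1_in G.F2_in
      F.src1 F.tgt1 F.src2 F.tgt2 F.id1 F.cmp1 F.id2 F.vcmp F.hcmp
      G.src1 G.tgt1 G.src2 G.tgt2 G.id1 G.cmp1 G.id2 G.vcmp G.hcmp\<close>)
qed

text \<open>Fills a triangle whose composite is already an identity, as happens for both triangles
  here.\<close>

lemma identity_modification:
  assumes F: "two_functor X Y F"
    and P0: "\<And>a. a \<in> C0 X \<Longrightarrow> P0 \<sigma> a = id1 Y (F0 F a)" and P1: "\<And>f. f \<in> C1 X \<Longrightarrow> P1 \<sigma> f = id2 Y (F1 F f)"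
  shows "invertible_modification X Y F F \<sigma> (pid Y F) (\<lambda>a. id2 Y (id1 Y (F0 F a)))"
proof -
  interpret F: two_functor X Y F by (rule F)
  note [simp] = F.source F.target F.F0_in F.F1_in F.src1 F.tgt1
  have pid: "pseudo_natural X Y F F (pid Y F)"
    by (rule pseudo_natural_pid) (use F in \<open>simp_all add: eq_fun2_def\<close>)
  moreover have "pseudo_natural X Y F F \<sigma>"
    by (rule pseudo_natural_cong[OF pid]) (simp_all add: pid_def P0 P1)
  ultimately show ?thesis
    by (auto simp: invertible_modification_def pid_def P0 P1 Hom_iff)
qed

lemma hom_cat_category:
  assumes "two_category Z" shows "category (hom_cat Z a b)"
  by (rule categoryI) (use assms in \<open>auto simp: hom_cat_def\<close>)

text \<open>The biadjunction, the strict 2-adjunction and full faithfulness all follow from these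
  assumptions: the unit becomes an identity under \<open>L\<close> and on the image of
  \<open>R\<close>, and \<open>L\<close> is a strict retraction of \<open>R\<close>. The counit is
  no parameter, since it can only be \<open>pid Y id_fun2\<close>. The assumptions pass to wide
  2-full sub-2-categories, so they need to be verified by hand once and then serve three pairs of
  2-categories.\<close>

locale strict_reflection =
  fixes X :: "('o, 'm, 't) cat2" and Y :: "('p, 'n, 'u) cat2"
    and L :: "('o, 'm, 't, 'p, 'n, 'u) fun2" and R :: "('p, 'n, 'u, 'o, 'm, 't) fun2"
    and \<eta> :: "('o, 'm, 'm, 't) ptr"
  assumes L: "two_functor X Y L" and R: "two_functor Y X R"
    and unit: "pseudo_natural X X id_fun2 (R \<odot>\<^sub>2 L) \<eta>"
    and LR: "eq_fun2 Y (L \<odot>\<^sub>2 R) id_fun2"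
    and L_unit0: "a \<in> C0 X \<Longrightarrow> F1 L (P0 \<eta> a) = id1 Y (F0 L a)"
    and L_unit1: "f \<in> C1 X \<Longrightarrow> F2 L (P1 \<eta> f) = id2 Y (F1 L f)"
    and unit_R0: "b \<in> C0 Y \<Longrightarrow> P0 \<eta> (F0 R b) = id1 X (F0 R b)"
    and unit_R1: "g \<in> C1 Y \<Longrightarrow> P1 \<eta> (F1 R g) = id2 X (F1 R g)"
begin

sublocale L: two_functor X Y L by (rule L)
sublocale R: two_functor Y X R by (rule R)
sublocale unit: pseudo_natural X X id_fun2 "R \<odot>\<^sub>2 L" \<eta> by (rule unit)

lemma functor_simps [simp]:
  "two_category X" "two_category Y"
  "a \<in> C0 X \<Longrightarrow> F0 L a \<in> C0 Y" "f \<in> C1 X \<Longrightarrow> F1 L f \<in> C1 Y" "\<alpha> \<in> C2 X \<Longrightarrow> F2 L \<alpha> \<in> C2 Y"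
  "f \<in> C1 X \<Longrightarrow> src1 Y (F1 L f) = F0 L (src1 X f)" "f \<in> C1 X \<Longrightarrow> tgt1 Y (F1 L f) = F0 L (tgt1 X f)"
  "\<alpha> \<in> C2 X \<Longrightarrow> src2 Y (F2 L \<alpha>) = F1 L (src2 X \<alpha>)" "\<alpha> \<in> C2 X \<Longrightarrow> tgt2 Y (F2 L \<alpha>) = F1 L (tgt2 X \<alpha>)"
  "b \<in> C0 Y \<Longrightarrow> F0 R b \<in> C0 X" "g \<in> C1 Y \<Longrightarrow> F1 R g \<in> C1 X" "\<beta> \<in> C2 Y \<Longrightarrow> F2 R \<beta> \<in> C2 X"
  "g \<in> C1 Y \<Longrightarrow> src1 X (F1 R g) = F0 R (src1 Y g)" "g \<in> C1 Y \<Longrightarrow> tgt1 X (F1 R g) = F0 R (tgt1 Y g)"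
  "\<beta> \<in> C2 Y \<Longrightarrow> src2 X (F2 R \<beta>) = F1 R (src2 Y \<beta>)" "\<beta> \<in> C2 Y \<Longrightarrow> tgt2 X (F2 R \<beta>) = F1 R (tgt2 Y \<beta>)"
  "b \<in> C0 Y \<Longrightarrow> F0 L (F0 R b) = b" "g \<in> C1 Y \<Longrightarrow> F1 L (F1 R g) = g" "\<beta> \<in> C2 Y \<Longrightarrow> F2 L (F2 R \<beta>) = \<beta>"
  using LR by (simp_all add: L.source L.target L.F0_in L.F1_in L.F2_in L.src1 L.tgt1 L.src2 L.tgt2
    R.F0_in R.F1_in R.F2_in R.src1 R.tgt1 R.src2 R.tgt2 eq_fun2_def)

lemma pcmp_left:
  "a \<in> C0 X \<Longrightarrow> P0 (pcmp X Y (pwr (pid Y id_fun2) L) (pwl L \<eta>)) a = id1 Y (F0 L a)"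
  "f \<in> C1 X \<Longrightarrow> P1 (pcmp X Y (pwr (pid Y id_fun2) L) (pwl L \<eta>)) f = id2 Y (F1 L f)"
  by (simp_all add: pcmp_def pwl_def pwr_def pid_def L_unit0 L_unit1)

lemma pcmp_right:
  "b \<in> C0 Y \<Longrightarrow> P0 (pcmp Y X (pwl R (pid Y id_fun2)) (pwr \<eta> R)) b = id1 X (F0 R b)"
  "g \<in> C1 Y \<Longrightarrow> P1 (pcmp Y X (pwl R (pid Y id_fun2)) (pwr \<eta> R)) g = id2 X (F1 R g)"
  by (simp_all add: pcmp_def pwl_def pwr_def pid_def unit_R0 unit_R1 R.id1 R.id2)

lemma counit: "pseudo_natural Y Y (L \<odot>\<^sub>2 R) id_fun2 (pid Y id_fun2)"
  by (rule pseudo_natural_pid) (use LR two_functor_cmp[OF R L] in \<open>simp_all add: two_functor_id\<close>)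

lemma bireflection:
  "bireflection X Y L R \<eta> (pid Y id_fun2) (\<lambda>a. id2 Y (id1 Y (F0 L a))) (\<lambda>b. id2 X (id1 X (F0 R b)))"
proof (intro bireflection.intro biadjunction.intro bireflection_axioms.intro)
  \<comment> \<open>The counit component is an identity 1-cell, hence its own quasi-inverse.\<close>
  show "equiv1 Y (P0 (pid Y id_fun2) b)" if "b \<in> C0 Y" for b
    unfolding equiv1_def using that
    by (auto intro!: bexI[of _ "id1 Y b"] exI[of _ "id2 Y (id1 Y b)"] simp: pid_def)
qed (auto intro: L R unit counit identity_modification simp: pcmp_left pcmp_right)

text \<open>The triangles commute strictly in any case. The extra assumption only turns the unit
  from pseudo-natural into 2-natural.\<close>

lemma two_adjunction:
  assumes "\<And>f. f \<in> C1 X \<Longrightarrow> P1 \<eta> f = id2 X (cmp1 X (P0 \<eta> (tgt1 X f)) f)"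
  shows "two_adjunction X Y L R \<eta> (pid Y id_fun2)"
proof (rule two_adjunction.intro)
  show "two_natural Y Y (L \<odot>\<^sub>2 R) id_fun2 (pid Y id_fun2)"
    using counit by (simp add: two_natural_def pid_def)
qed (use L R unit assms in \<open>simp_all add: two_natural_def pid_def L_unit0 unit_R0 R.id1\<close>)

text \<open>A quasi-inverse of \<open>R\<close> on the hom-category from \<open>a\<close> to
  \<open>b\<close> is \<open>L\<close> on the one from R a to R b. One composite is the identity by
  \<open>LR\<close>. For the other, \<open>P1 \<eta> f\<close> goes from R (L f) after the unit at R
  a to the unit at R b after f, and by \<open>unit_R0\<close> both unit 1-cells are identities. So
  it is an invertible 2-cell from R (L f) to f, and \<open>P1_natural\<close> makes it natural in
  f.\<close>

lemma fully_faithful: "fully_faithful2 Y X R"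
  unfolding fully_faithful2_def
proof (intro conjI ballI R)
  fix a b assume a: "a \<in> C0 Y" and b: "b \<in> C0 Y"
  note [simp] = a b
  define F where "F = hom_functor Y X R a b"
  define G where "G = hom_functor X Y L (F0 R a) (F0 R b)"
  have sel [simp]: "Src F = hom_cat Y a b" "Tgt F = hom_cat X (F0 R a) (F0 R b)"
    "Src G = hom_cat X (F0 R a) (F0 R b)" "Tgt G = hom_cat Y a b"
    by (simp_all add: F_def G_def hom_functor_def)
  have Fo [simp]: "g \<in> C1 Y \<Longrightarrow> src1 Y g = a \<Longrightarrow> tgt1 Y g = b \<Longrightarrow> Fo F g = F1 R g"
    "\<beta> \<in> C2 Y \<Longrightarrow> src1 Y (src2 Y \<beta>) = a \<Longrightarrow> tgt1 Y (src2 Y \<beta>) = b \<Longrightarrow> Fa F \<beta> = F2 R \<beta>"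
    "f \<in> C1 X \<Longrightarrow> src1 X f = F0 R a \<Longrightarrow> tgt1 X f = F0 R b \<Longrightarrow> Fo G f = F1 L f"
    "\<alpha> \<in> C2 X \<Longrightarrow> src1 X (src2 X \<alpha>) = F0 R a \<Longrightarrow> tgt1 X (src2 X \<alpha>) = F0 R b \<Longrightarrow> Fa G \<alpha> = F2 L \<alpha>"
    for g \<beta> f \<alpha> by (simp_all add: F_def G_def hom_functor_def hom_cat_def)
  have hom_sel [simp]: "Ob (hom_cat Z c d) = {f \<in> C1 Z. src1 Z f = c \<and> tgt1 Z f = d}"
    "Ar (hom_cat Z c d) = {\<alpha> \<in> C2 Z. src1 Z (src2 Z \<alpha>) = c \<and> tgt1 Z (src2 Z \<alpha>) = d}"
    "Dom (hom_cat Z c d) = src2 Z" "Cod (hom_cat Z c d) = tgt2 Z" "Idn (hom_cat Z c d) = id2 Z"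
    "Cmp (hom_cat Z c d) = vcmp Z" for Z :: "('i, 'j, 'k) cat2" and c d
    by (simp_all add: hom_cat_def)
  have F [simp]: "is_functor F"
    by (rule is_functorI) (auto simp: hom_cat_category R.id2 R.vcmp,
      auto simp: F_def hom_functor_def)
  have G [simp]: "is_functor G"
    by (rule is_functorI) (auto simp: hom_cat_category L.id2 L.vcmp,
      auto simp: G_def hom_functor_def)
  have GF: "G \<odot> F = fid (Src F)"
    by (rule ftr_eqI) (auto simp: hom_cat_category)
  have P1: "P1 \<eta> f \<in> C2 X" "src2 X (P1 \<eta> f) = F1 R (F1 L f)" "tgt2 X (P1 \<eta> f) = f"
    if "f \<in> C1 X" "src1 X f = F0 R a" "tgt1 X f = F0 R b" for f
    using unit.P1_in[of f "F0 R a" "F0 R b"] that by (auto simp: Hom_def unit_R0)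
  define \<epsilon> where "\<epsilon> = \<lparr>Nsrc = F \<odot> G, Ntgt = fid (Tgt F), Ncp = restrict (P1 \<eta>) (Ob (Tgt F))\<rparr>"
  have nat: "nat_trans \<epsilon>"
  proof (rule nat_transI)
    fix \<alpha> assume "\<alpha> \<in> Ar (Src (Nsrc \<epsilon>))"
    then have \<alpha>: "\<alpha> \<in> C2 X" "src1 X (src2 X \<alpha>) = F0 R a" "tgt1 X (src2 X \<alpha>) = F0 R b"
      by (simp_all add: \<epsilon>_def)
    then have "vcmp X (P1 \<eta> (tgt2 X \<alpha>)) (F2 R (F2 L \<alpha>)) = vcmp X \<alpha> (P1 \<eta> (src2 X \<alpha>))"
      using unit.P1_natural[of \<alpha> "src2 X \<alpha>" "tgt2 X \<alpha>" "F0 R a" "F0 R b"] by (simp add: Hom_def unit_R0)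
    then show "Cmp (Tgt (Nsrc \<epsilon>)) (Ncp \<epsilon> (Cod (Src (Nsrc \<epsilon>)) \<alpha>)) (Fa (Nsrc \<epsilon>) \<alpha>)
      = Cmp (Tgt (Nsrc \<epsilon>)) (Fa (Ntgt \<epsilon>) \<alpha>) (Ncp \<epsilon> (Dom (Src (Nsrc \<epsilon>)) \<alpha>))"
      using \<alpha> by (simp add: \<epsilon>_def)
  qed (auto simp: \<epsilon>_def P1 hom_cat_category)
  moreover have "nat_iso \<epsilon>"
  proof (rule nat_isoI[OF nat])
    fix f assume "f \<in> Ob (Src (Nsrc \<epsilon>))"
    then have f: "f \<in> C1 X" "src1 X f = F0 R a" "tgt1 X f = F0 R b" by (simp_all add: \<epsilon>_def)
    then have "iso_ar (hom_cat X (F0 R a) (F0 R b)) (P1 \<eta> f)"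
      using unit.P1_iso[of f] by (auto simp: iso2_def iso_ar_def Hom_def P1)
    then show "iso_ar (Tgt (Nsrc \<epsilon>)) (Ncp \<epsilon> f)"
      using f by (simp add: \<epsilon>_def)
  qed
  ultimately have \<epsilon>: "nat_iso \<epsilon> \<and> \<epsilon> \<in> NT (F \<odot> G) (fid (Tgt F))"
    by (simp add: NT_iff) (simp add: \<epsilon>_def)
  have \<eta>: "nat_iso (nid (fid (Src F))) \<and> nid (fid (Src F)) \<in> NT (fid (Src F)) (G \<odot> F)"
    by (simp add: NT_iff GF hom_cat_category)
  have "cat_equivalence F"
    unfolding cat_equivalence_def
    by (intro conjI F exI[of _ G] exI[of _ "nid (fid (Src F))"] exI[of _ \<epsilon>]) (use \<epsilon> \<eta> in auto)
  then show "cat_equivalence (hom_functor Y X R a b)" by (simp only: F_def)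
qed

lemma wide_full:
  assumes P: "closed1 X P" and Q: "closed1 Y Q"
    and L': "\<And>f. f \<in> C1 X \<Longrightarrow> P f \<Longrightarrow> Q (F1 L f)" and R': "\<And>g. g \<in> C1 Y \<Longrightarrow> Q g \<Longrightarrow> P (F1 R g)"
    and P0: "\<And>a. a \<in> C0 X \<Longrightarrow> P (P0 \<eta> a)"
  shows "strict_reflection (wide_full X P) (wide_full Y Q) L R \<eta>"
proof (rule strict_reflection.intro)
  show "pseudo_natural (wide_full X P) (wide_full X P) id_fun2 (R \<odot>\<^sub>2 L) \<eta>"
    by (rule pseudo_natural_wide_full[OF unit P P]) (simp_all add: L' R' P0)
qed (use two_functor_wide_full L R P Q L' R' LR in
    \<open>simp_all add: L_unit0 L_unit1 unit_R0 unit_R1 two_functor_wide_full eq_fun2_def\<close>)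

lemma cong:
  assumes P0: "\<And>a. a \<in> C0 X \<Longrightarrow> P0 \<tau> a = P0 \<eta> a" and P1: "\<And>f. f \<in> C1 X \<Longrightarrow> P1 \<tau> f = P1 \<eta> f"
  shows "strict_reflection X Y L R \<tau>"
  by (rule strict_reflection.intro)
    (use L R LR pseudo_natural_cong[OF unit P0 P1] in \<open>simp_all add: P0 P1 L_unit0 L_unit1 unit_R0 unit_R1\<close>)

end

section \<open>The 2-category of comonads\<close>

lemma Cmd_sel [simp]:
  "C0 Cmd = {Q. is_comonad Q}" "C1 Cmd = {m. is_cmd1 m}" "C2 Cmd = {c. is_cmd2 c}"
  "src1 Cmd = mSrc" "tgt1 Cmd = mTgt" "src2 Cmd = cSrc" "tgt2 Cmd = cTgt"
  "id1 Cmd Q = \<lparr>mSrc = Q, mTgt = Q, mH = fid (Src (cmK Q)), mT = nid (cmK Q)\<rparr>"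
  "cmp1 Cmd = cmd_cmp"
  "id2 Cmd m = \<lparr>cSrc = m, cTgt = m, cPhi = nid (mH m)\<rparr>"
  "vcmp Cmd d c = \<lparr>cSrc = cSrc c, cTgt = cTgt d, cPhi = cPhi d \<bullet> cPhi c\<rparr>"
  "hcmp Cmd d c = \<lparr>cSrc = cmd_cmp (cSrc d) (cSrc c), cTgt = cmd_cmp (cTgt d) (cTgt c),
      cPhi = nhcmp (cPhi d) (cPhi c)\<rparr>"
  by (simp_all add: Cmd_def)

lemma comonadD [simp]:
  assumes "is_comonad Q"
  shows "is_functor (cmK Q)" "Tgt (cmK Q) = Src (cmK Q)"
    "nat_trans (cmE Q)" "Nsrc (cmE Q) = cmK Q" "Ntgt (cmE Q) = fid (Src (cmK Q))"
    "nat_trans (cmN Q)" "Nsrc (cmN Q) = cmK Q" "Ntgt (cmN Q) = cmK Q \<odot> cmK Q"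
  using assms by (simp_all add: is_comonad_def Let_def NT_iff)

lemma comonad_laws:
  assumes Q: "is_comonad Q" and A: "A \<in> Ob (Src (cmK Q))"
  shows "Cmp (Src (cmK Q)) (Fa (cmK Q) (Ncp (cmE Q) A)) (Ncp (cmN Q) A) = Idn (Src (cmK Q)) (Fo (cmK Q) A)"
    "Cmp (Src (cmK Q)) (Ncp (cmE Q) (Fo (cmK Q) A)) (Ncp (cmN Q) A) = Idn (Src (cmK Q)) (Fo (cmK Q) A)"
    "Cmp (Src (cmK Q)) (Fa (cmK Q) (Ncp (cmN Q) A)) (Ncp (cmN Q) A)
      = Cmp (Src (cmK Q)) (Ncp (cmN Q) (Fo (cmK Q) A)) (Ncp (cmN Q) A)"
proof -
  have "(cmK Q \<lhd> cmE Q) \<bullet> cmN Q = nid (cmK Q)" "(cmE Q \<rhd> cmK Q) \<bullet> cmN Q = nid (cmK Q)"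
    "(cmK Q \<lhd> cmN Q) \<bullet> cmN Q = (cmN Q \<rhd> cmK Q) \<bullet> cmN Q"
    using Q by (simp_all only: is_comonad_def Let_def)
  note this[THEN arg_cong[where f = "\<lambda>\<alpha>. Ncp \<alpha> A"]]
  then show "Cmp (Src (cmK Q)) (Fa (cmK Q) (Ncp (cmE Q) A)) (Ncp (cmN Q) A) = Idn (Src (cmK Q)) (Fo (cmK Q) A)"
    "Cmp (Src (cmK Q)) (Ncp (cmE Q) (Fo (cmK Q) A)) (Ncp (cmN Q) A) = Idn (Src (cmK Q)) (Fo (cmK Q) A)"
    "Cmp (Src (cmK Q)) (Fa (cmK Q) (Ncp (cmN Q) A)) (Ncp (cmN Q) A)
      = Cmp (Src (cmK Q)) (Ncp (cmN Q) (Fo (cmK Q) A)) (Ncp (cmN Q) A)"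
    using Q A by simp_all
qed

lemma comonad_naturality:
  assumes Q: "is_comonad Q" and f: "f \<in> Ar (Src (cmK Q))" "Cod (Src (cmK Q)) f = B"
  shows "Cmp (Src (cmK Q)) (Ncp (cmE Q) B) (Fa (cmK Q) f) = Cmp (Src (cmK Q)) f (Ncp (cmE Q) (Dom (Src (cmK Q)) f))"
    "Cmp (Src (cmK Q)) (Ncp (cmN Q) B) (Fa (cmK Q) f)
      = Cmp (Src (cmK Q)) (Fa (cmK Q) (Fa (cmK Q) f)) (Ncp (cmN Q) (Dom (Src (cmK Q)) f))"
  using naturality[of "cmE Q" f, OF _ _ refl refl] naturality[of "cmN Q" f, OF _ _ refl refl] assms by auto

lemma comonadI:
  assumes [simp]: "is_functor (cmK Q)" "normalized (Src (cmK Q))" "Tgt (cmK Q) = Src (cmK Q)"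
    "nat_trans (cmE Q)" "Nsrc (cmE Q) = cmK Q" "Ntgt (cmE Q) = fid (Src (cmK Q))"
    "nat_trans (cmN Q)" "Nsrc (cmN Q) = cmK Q" "Ntgt (cmN Q) = cmK Q \<odot> cmK Q"
    and "\<And>A. A \<in> Ob (Src (cmK Q)) \<Longrightarrow>
      Cmp (Src (cmK Q)) (Fa (cmK Q) (Ncp (cmE Q) A)) (Ncp (cmN Q) A) = Idn (Src (cmK Q)) (Fo (cmK Q) A)"
    "\<And>A. A \<in> Ob (Src (cmK Q)) \<Longrightarrow>
      Cmp (Src (cmK Q)) (Ncp (cmE Q) (Fo (cmK Q) A)) (Ncp (cmN Q) A) = Idn (Src (cmK Q)) (Fo (cmK Q) A)"
    "\<And>A. A \<in> Ob (Src (cmK Q)) \<Longrightarrow>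
      Cmp (Src (cmK Q)) (Fa (cmK Q) (Ncp (cmN Q) A)) (Ncp (cmN Q) A)
        = Cmp (Src (cmK Q)) (Ncp (cmN Q) (Fo (cmK Q) A)) (Ncp (cmN Q) A)"
  shows "is_comonad Q"
  unfolding is_comonad_def Let_def NT_iff
  by (intro conjI) (use assms(10-12) in \<open>auto intro!: ntr_eqI\<close>)

lemma cmd1D [simp]:
  assumes "is_cmd1 m"
  shows "is_comonad (mSrc m)" "is_comonad (mTgt m)"
    "is_functor (mH m)" "Src (mH m) = Src (cmK (mSrc m))" "Tgt (mH m) = Src (cmK (mTgt m))"
    "nat_trans (mT m)" "Nsrc (mT m) = mH m \<odot> cmK (mSrc m)" "Ntgt (mT m) = cmK (mTgt m) \<odot> mH m"
  using assms by (simp_all add: is_cmd1_def Let_def NT_iff)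

lemma cmd1_laws:
  assumes m: "is_cmd1 m" and A: "A \<in> Ob (Src (cmK (mSrc m)))"
  shows "Cmp (Src (cmK (mTgt m))) (Ncp (cmE (mTgt m)) (Fo (mH m) A)) (Ncp (mT m) A) = Fa (mH m) (Ncp (cmE (mSrc m)) A)"
    "Cmp (Src (cmK (mTgt m))) (Ncp (cmN (mTgt m)) (Fo (mH m) A)) (Ncp (mT m) A)
      = Cmp (Src (cmK (mTgt m))) (Fa (cmK (mTgt m)) (Ncp (mT m) A))
        (Cmp (Src (cmK (mTgt m))) (Ncp (mT m) (Fo (cmK (mSrc m)) A)) (Fa (mH m) (Ncp (cmN (mSrc m)) A)))"
proof -
  have "(cmE (mTgt m) \<rhd> mH m) \<bullet> mT m = mH m \<lhd> cmE (mSrc m)"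
    "(cmN (mTgt m) \<rhd> mH m) \<bullet> mT m
      = (cmK (mTgt m) \<lhd> mT m) \<bullet> (mT m \<rhd> cmK (mSrc m)) \<bullet> (mH m \<lhd> cmN (mSrc m))"
    using m by (simp_all only: is_cmd1_def Let_def)
  note this[THEN arg_cong[where f = "\<lambda>\<alpha>. Ncp \<alpha> A"]]
  then show "Cmp (Src (cmK (mTgt m))) (Ncp (cmE (mTgt m)) (Fo (mH m) A)) (Ncp (mT m) A) = Fa (mH m) (Ncp (cmE (mSrc m)) A)"
    "Cmp (Src (cmK (mTgt m))) (Ncp (cmN (mTgt m)) (Fo (mH m) A)) (Ncp (mT m) A)
      = Cmp (Src (cmK (mTgt m))) (Fa (cmK (mTgt m)) (Ncp (mT m) A))
        (Cmp (Src (cmK (mTgt m))) (Ncp (mT m) (Fo (cmK (mSrc m)) A)) (Fa (mH m) (Ncp (cmN (mSrc m)) A)))"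
    using m A by simp_all
qed

lemma cmd1_naturality:
  assumes m: "is_cmd1 m" and f: "f \<in> Ar (Src (cmK (mSrc m)))" "Cod (Src (cmK (mSrc m))) f = B"
  shows "Cmp (Src (cmK (mTgt m))) (Ncp (mT m) B) (Fa (mH m) (Fa (cmK (mSrc m)) f))
    = Cmp (Src (cmK (mTgt m))) (Fa (cmK (mTgt m)) (Fa (mH m) f)) (Ncp (mT m) (Dom (Src (cmK (mSrc m))) f))"
  using naturality[of "mT m" f, OF _ _ refl refl] assms by auto

lemma cmd1I:
  assumes [simp]: "is_comonad (mSrc m)" "is_comonad (mTgt m)"
    "is_functor (mH m)" "Src (mH m) = Src (cmK (mSrc m))" "Tgt (mH m) = Src (cmK (mTgt m))"
    "nat_trans (mT m)" "Nsrc (mT m) = mH m \<odot> cmK (mSrc m)" "Ntgt (mT m) = cmK (mTgt m) \<odot> mH m"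
    and "\<And>A. A \<in> Ob (Src (cmK (mSrc m))) \<Longrightarrow>
      Cmp (Src (cmK (mTgt m))) (Ncp (cmE (mTgt m)) (Fo (mH m) A)) (Ncp (mT m) A) = Fa (mH m) (Ncp (cmE (mSrc m)) A)"
    "\<And>A. A \<in> Ob (Src (cmK (mSrc m))) \<Longrightarrow>
      Cmp (Src (cmK (mTgt m))) (Ncp (cmN (mTgt m)) (Fo (mH m) A)) (Ncp (mT m) A)
      = Cmp (Src (cmK (mTgt m))) (Fa (cmK (mTgt m)) (Ncp (mT m) A))
        (Cmp (Src (cmK (mTgt m))) (Ncp (mT m) (Fo (cmK (mSrc m)) A)) (Fa (mH m) (Ncp (cmN (mSrc m)) A)))"
  shows "is_cmd1 m"
  unfolding is_cmd1_def Let_def NT_iff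
  by (intro conjI) (use assms(9,10) in \<open>auto intro!: ntr_eqI\<close>)

lemma cmd2D [simp]:
  assumes "is_cmd2 c"
  shows "is_cmd1 (cSrc c)" "is_cmd1 (cTgt c)" "mSrc (cTgt c) = mSrc (cSrc c)" "mTgt (cTgt c) = mTgt (cSrc c)"
    "nat_trans (cPhi c)" "Nsrc (cPhi c) = mH (cSrc c)" "Ntgt (cPhi c) = mH (cTgt c)"
  using assms by (simp_all add: is_cmd2_def Let_def NT_iff)

lemma cmd2_law:
  assumes c: "is_cmd2 c" and A: "A \<in> Ob (Src (cmK (mSrc (cSrc c))))"
  shows "Cmp (Src (cmK (mTgt (cSrc c)))) (Fa (cmK (mTgt (cSrc c))) (Ncp (cPhi c) A)) (Ncp (mT (cSrc c)) A)
    = Cmp (Src (cmK (mTgt (cSrc c)))) (Ncp (mT (cTgt c)) A) (Ncp (cPhi c) (Fo (cmK (mSrc (cSrc c))) A))"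
proof -
  have "(cmK (mTgt (cSrc c)) \<lhd> cPhi c) \<bullet> mT (cSrc c) = mT (cTgt c) \<bullet> (cPhi c \<rhd> cmK (mSrc (cSrc c)))"
    using c unfolding is_cmd2_def Let_def by blast
  note this[THEN arg_cong[where f = "\<lambda>\<alpha>. Ncp \<alpha> A"]]
  then show ?thesis using c A by simp
qed

lemma cmd2_naturality:
  assumes c: "is_cmd2 c" and f: "f \<in> Ar (Src (cmK (mSrc (cSrc c))))" "Cod (Src (cmK (mSrc (cSrc c)))) f = B"
  shows "Cmp (Src (cmK (mTgt (cSrc c)))) (Ncp (cPhi c) B) (Fa (mH (cSrc c)) f)
    = Cmp (Src (cmK (mTgt (cSrc c)))) (Fa (mH (cTgt c)) f) (Ncp (cPhi c) (Dom (Src (cmK (mSrc (cSrc c)))) f))"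
  using naturality[of "cPhi c" f, OF _ _ refl refl] assms by auto

lemma cmd2I:
  assumes [simp]: "is_cmd1 (cSrc c)" "is_cmd1 (cTgt c)" "mSrc (cTgt c) = mSrc (cSrc c)" "mTgt (cTgt c) = mTgt (cSrc c)"
    "nat_trans (cPhi c)" "Nsrc (cPhi c) = mH (cSrc c)" "Ntgt (cPhi c) = mH (cTgt c)"
    and "\<And>A. A \<in> Ob (Src (cmK (mSrc (cSrc c)))) \<Longrightarrow>
      Cmp (Src (cmK (mTgt (cSrc c)))) (Fa (cmK (mTgt (cSrc c))) (Ncp (cPhi c) A)) (Ncp (mT (cSrc c)) A)
      = Cmp (Src (cmK (mTgt (cSrc c)))) (Ncp (mT (cTgt c)) A) (Ncp (cPhi c) (Fo (cmK (mSrc (cSrc c))) A))"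
  shows "is_cmd2 c"
  unfolding is_cmd2_def Let_def NT_iff
  by (intro conjI) (use assms(8) in \<open>auto intro!: ntr_eqI\<close>)

section \<open>Composition of comonad morphisms and of their 2-cells\<close>

lemma cmd_cmp_sel [simp]:
  "mSrc (cmd_cmp n m) = mSrc m" "mTgt (cmd_cmp n m) = mTgt n" "mH (cmd_cmp n m) = mH n \<odot> mH m"
  "mT (cmd_cmp n m) = (mT n \<rhd> mH m) \<bullet> (mH n \<lhd> mT m)"
  by (simp_all add: cmd_cmp_def)

text \<open>Write H, \<theta> for \<open>m\<close> and H', \<theta>' for \<open>n\<close>. Each law
  pastes the law of \<open>n\<close> at H A with the H'-image of the law of \<open>m\<close> at A.
  For the comultiplication the two pieces meet by naturality of \<theta>' at the component of
  \<theta> at A.\<close>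

lemma cmd_cmp_cmd1 [simp]:
  assumes m: "is_cmd1 m" and n: "is_cmd1 n" and mn: "mSrc n = mTgt m"
  shows "is_cmd1 (cmd_cmp n m)"
proof (rule cmd1I)
  note [simp] = m n mn
  fix A assume "A \<in> Ob (Src (cmK (mSrc (cmd_cmp n m))))"
  then have A [simp]: "A \<in> Ob (Src (cmK (mSrc m)))" by simp
  let ?C = "Src (cmK (mTgt n))" and ?Q = "mTgt n" and ?\<theta> = "Ncp (mT m)" and ?\<theta>' = "Ncp (mT n)"
    and ?H = "mH m" and ?H' = "mH n"
  have "Cmp ?C (Ncp (cmE ?Q) (Fo ?H' (Fo ?H A))) (Cmp ?C (?\<theta>' (Fo ?H A)) (Fa ?H' (?\<theta> A)))
    = Cmp ?C (Fa ?H' (Ncp (cmE (mTgt m)) (Fo ?H A))) (Fa ?H' (?\<theta> A))"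
    by (rule Cmp_eq_extend1) (use cmd1_laws(1)[OF n, of "Fo ?H A"] in simp_all)
  also have "\<dots> = Fa ?H' (Fa ?H (Ncp (cmE (mSrc m)) A))"
    using arg_cong[OF cmd1_laws(1)[OF m A], of "Fa ?H'"] by simp
  finally show "Cmp (Src (cmK (mTgt (cmd_cmp n m)))) (Ncp (cmE (mTgt (cmd_cmp n m))) (Fo (mH (cmd_cmp n m)) A))
      (Ncp (mT (cmd_cmp n m)) A) = Fa (mH (cmd_cmp n m)) (Ncp (cmE (mSrc (cmd_cmp n m))) A)"
    by simp
  let ?r = "Cmp ?C (Fa ?H' (?\<theta> (Fo (cmK (mSrc m)) A))) (Fa ?H' (Fa ?H (Ncp (cmN (mSrc m)) A)))"
  have "Cmp ?C (Ncp (cmN ?Q) (Fo ?H' (Fo ?H A))) (Cmp ?C (?\<theta>' (Fo ?H A)) (Fa ?H' (?\<theta> A)))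
    = Cmp ?C (Fa (cmK ?Q) (?\<theta>' (Fo ?H A))) (Cmp ?C (?\<theta>' (Fo (cmK (mTgt m)) (Fo ?H A)))
        (Cmp ?C (Fa ?H' (Ncp (cmN (mTgt m)) (Fo ?H A))) (Fa ?H' (?\<theta> A))))"
    by (subst Cmp_eq_extend1[OF cmd1_laws(2)[OF n, of "Fo ?H A"]]) simp_all
  also have "Cmp ?C (Fa ?H' (Ncp (cmN (mTgt m)) (Fo ?H A))) (Fa ?H' (?\<theta> A))
    = Cmp ?C (Fa ?H' (Fa (cmK (mTgt m)) (?\<theta> A))) ?r"
    using arg_cong[OF cmd1_laws(2)[OF m A], of "Fa ?H'"] by simp
  also have "Cmp ?C (?\<theta>' (Fo (cmK (mTgt m)) (Fo ?H A))) (Cmp ?C (Fa ?H' (Fa (cmK (mTgt m)) (?\<theta> A))) ?r)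
    = Cmp ?C (Fa (cmK ?Q) (Fa ?H' (?\<theta> A))) (Cmp ?C (?\<theta>' (Fo ?H (Fo (cmK (mSrc m)) A))) ?r)"
    by (rule Cmp_eq_extend) (use cmd1_naturality[OF n, of "?\<theta> A"] in simp_all)
  finally show "Cmp (Src (cmK (mTgt (cmd_cmp n m)))) (Ncp (cmN (mTgt (cmd_cmp n m))) (Fo (mH (cmd_cmp n m)) A))
      (Ncp (mT (cmd_cmp n m)) A)
    = Cmp (Src (cmK (mTgt (cmd_cmp n m)))) (Fa (cmK (mTgt (cmd_cmp n m))) (Ncp (mT (cmd_cmp n m)) A))
       (Cmp (Src (cmK (mTgt (cmd_cmp n m)))) (Ncp (mT (cmd_cmp n m)) (Fo (cmK (mSrc (cmd_cmp n m))) A))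
         (Fa (mH (cmd_cmp n m)) (Ncp (cmN (mSrc (cmd_cmp n m))) A)))"
    by simp
qed (use assms in simp_all)

lemma cmd_id_cmd1 [simp]:
  "is_comonad Q \<Longrightarrow> is_cmd1 \<lparr>mSrc = Q, mTgt = Q, mH = fid (Src (cmK Q)), mT = nid (cmK Q)\<rparr>"
  by (rule cmd1I) simp_all

lemma cmd_cmp_assoc:
  assumes "is_cmd1 m" "is_cmd1 n" "is_cmd1 p" "mSrc n = mTgt m" "mSrc p = mTgt n"
  shows "cmd_cmp (cmd_cmp p n) m = cmd_cmp p (cmd_cmp n m)"
  using assms by (intro cmd1.equality ntr_eqI) simp_all

lemma cmd_cmp_id [simp]:
  assumes "is_cmd1 m"
  shows "Q = mTgt m \<Longrightarrow> cmd_cmp \<lparr>mSrc = Q, mTgt = Q, mH = fid (Src (cmK Q)), mT = nid (cmK Q)\<rparr> m = m"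
    "Q = mSrc m \<Longrightarrow> cmd_cmp m \<lparr>mSrc = Q, mTgt = Q, mH = fid (Src (cmK Q)), mT = nid (cmK Q)\<rparr> = m"
  using assms by (auto intro!: cmd1.equality)

lemma cmd_id_cmd2 [simp]: "is_cmd1 m \<Longrightarrow> mH m = H \<Longrightarrow> is_cmd2 \<lparr>cSrc = m, cTgt = m, cPhi = nid H\<rparr>"
  by (rule cmd2I) auto

lemma cmd_vcmp_cmd2 [simp]:
  assumes c: "is_cmd2 c" and d: "is_cmd2 d" and cd: "cSrc d = cTgt c"
  shows "is_cmd2 \<lparr>cSrc = cSrc c, cTgt = cTgt d, cPhi = cPhi d \<bullet> cPhi c\<rparr>"
proof (rule cmd2I)
  note [simp] = c d cd
  have [simp]: "mSrc (cTgt d) = mSrc (cSrc c)" "mTgt (cTgt d) = mTgt (cSrc c)"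
    using cmd2D(3,4)[OF d] c by simp_all
  fix A assume "A \<in> Ob (Src (cmK (mSrc (cSrc \<lparr>cSrc = cSrc c, cTgt = cTgt d, cPhi = cPhi d \<bullet> cPhi c\<rparr>))))"
  then have A [simp]: "A \<in> Ob (Src (cmK (mSrc (cSrc c))))" by simp
  let ?K = "cmK (mTgt (cSrc c))" and ?C = "Src (cmK (mTgt (cSrc c)))"
  have "Cmp ?C (Fa ?K (Ncp (cPhi d) A)) (Cmp ?C (Fa ?K (Ncp (cPhi c) A)) (Ncp (mT (cSrc c)) A))
    = Cmp ?C (Fa ?K (Ncp (cPhi d) A)) (Cmp ?C (Ncp (mT (cTgt c)) A) (Ncp (cPhi c) (Fo (cmK (mSrc (cSrc c))) A)))"
    using cmd2_law[OF c A] by simp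
  also have "\<dots> = Cmp ?C (Ncp (mT (cTgt d)) A)
      (Cmp ?C (Ncp (cPhi d) (Fo (cmK (mSrc (cSrc c))) A)) (Ncp (cPhi c) (Fo (cmK (mSrc (cSrc c))) A)))"
    by (rule Cmp_eq_extend) (use cmd2_law[OF d, of A] in simp_all)
  finally show "Cmp (Src (cmK (mTgt (cSrc \<lparr>cSrc = cSrc c, cTgt = cTgt d, cPhi = cPhi d \<bullet> cPhi c\<rparr>))))
      (Fa (cmK (mTgt (cSrc \<lparr>cSrc = cSrc c, cTgt = cTgt d, cPhi = cPhi d \<bullet> cPhi c\<rparr>)))
        (Ncp (cPhi \<lparr>cSrc = cSrc c, cTgt = cTgt d, cPhi = cPhi d \<bullet> cPhi c\<rparr>) A))
      (Ncp (mT (cSrc \<lparr>cSrc = cSrc c, cTgt = cTgt d, cPhi = cPhi d \<bullet> cPhi c\<rparr>)) A) =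
     Cmp (Src (cmK (mTgt (cSrc \<lparr>cSrc = cSrc c, cTgt = cTgt d, cPhi = cPhi d \<bullet> cPhi c\<rparr>))))
      (Ncp (mT (cTgt \<lparr>cSrc = cSrc c, cTgt = cTgt d, cPhi = cPhi d \<bullet> cPhi c\<rparr>)) A)
      (Ncp (cPhi \<lparr>cSrc = cSrc c, cTgt = cTgt d, cPhi = cPhi d \<bullet> cPhi c\<rparr>)
        (Fo (cmK (mSrc (cSrc \<lparr>cSrc = cSrc c, cTgt = cTgt d, cPhi = cPhi d \<bullet> cPhi c\<rparr>))) A))"
    by simp
qed (use c d cd cmd2D(3,4)[OF d] in simp_all)

text \<open>Four squares are pasted: naturality of the structure map of \<open>cSrc d\<close> at
  \<phi>, the law of \<open>d\<close>, the image of the law of \<open>c\<close>, and naturality of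
  \<psi> at the structure map of \<open>cTgt c\<close>.\<close>

lemma cmd_hcmp_cmd2 [simp]:
  assumes c: "is_cmd2 c" and d: "is_cmd2 d" and cd: "mSrc (cSrc d) = mTgt (cSrc c)"
  shows "is_cmd2 \<lparr>cSrc = cmd_cmp (cSrc d) (cSrc c), cTgt = cmd_cmp (cTgt d) (cTgt c),
    cPhi = nhcmp (cPhi d) (cPhi c)\<rparr>" (is "is_cmd2 ?e")
proof (rule cmd2I)
  note [simp] = c d cd
  fix A assume "A \<in> Ob (Src (cmK (mSrc (cSrc ?e))))"
  then have A [simp]: "A \<in> Ob (Src (cmK (mSrc (cSrc c))))" by simp
  let ?C = "Src (cmK (mTgt (cSrc d)))" and ?K'' = "cmK (mTgt (cSrc d))" and ?K = "cmK (mSrc (cSrc c))"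
    and ?K' = "cmK (mTgt (cSrc c))"
    and ?H = "mH (cSrc c)" and ?G = "mH (cTgt c)" and ?H' = "mH (cSrc d)" and ?G' = "mH (cTgt d)"
    and ?\<phi> = "Ncp (cPhi c)" and ?\<psi> = "Ncp (cPhi d)"
    and ?\<theta>H = "Ncp (mT (cSrc c))" and ?\<theta>G = "Ncp (mT (cTgt c))"
    and ?\<theta>H' = "Ncp (mT (cSrc d))" and ?\<theta>G' = "Ncp (mT (cTgt d))"
  have nat: "Cmp ?C (Fa ?K'' (Fa ?H' (?\<phi> A))) (?\<theta>H' (Fo ?H A)) = Cmp ?C (?\<theta>H' (Fo ?G A)) (Fa ?H' (Fa ?K' (?\<phi> A)))"
    using cmd1_naturality[of "cSrc d" "?\<phi> A"] by simp
  have law: "Cmp ?C (Fa ?K'' (?\<psi> (Fo ?G A))) (?\<theta>H' (Fo ?G A)) = Cmp ?C (?\<theta>G' (Fo ?G A)) (?\<psi> (Fo ?K' (Fo ?G A)))"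
    using cmd2_law[OF d, of "Fo ?G A"] by simp
  have "Cmp ?C (Fa ?K'' (?\<psi> (Fo ?G A))) (Cmp ?C (Fa ?K'' (Fa ?H' (?\<phi> A)))
      (Cmp ?C (?\<theta>H' (Fo ?H A)) (Fa ?H' (?\<theta>H A))))
    = Cmp ?C (Fa ?K'' (?\<psi> (Fo ?G A))) (Cmp ?C (?\<theta>H' (Fo ?G A)) (Cmp ?C (Fa ?H' (Fa ?K' (?\<phi> A))) (Fa ?H' (?\<theta>H A))))"
    by (subst Cmp_eq_extend[OF nat]) simp_all
  also have "\<dots> = Cmp ?C (?\<theta>G' (Fo ?G A)) (Cmp ?C (?\<psi> (Fo ?K' (Fo ?G A)))
      (Cmp ?C (Fa ?H' (Fa ?K' (?\<phi> A))) (Fa ?H' (?\<theta>H A))))"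
    by (rule Cmp_eq_extend[OF law]) simp_all
  also have "Cmp ?C (Fa ?H' (Fa ?K' (?\<phi> A))) (Fa ?H' (?\<theta>H A))
    = Cmp ?C (Fa ?H' (?\<theta>G A)) (Fa ?H' (?\<phi> (Fo ?K A)))"
    using arg_cong[OF cmd2_law[OF c A], of "Fa ?H'"] by simp
  also have "Cmp ?C (?\<psi> (Fo ?K' (Fo ?G A))) (Cmp ?C (Fa ?H' (?\<theta>G A)) (Fa ?H' (?\<phi> (Fo ?K A))))
    = Cmp ?C (Fa ?G' (?\<theta>G A)) (Cmp ?C (?\<psi> (Fo ?G (Fo ?K A))) (Fa ?H' (?\<phi> (Fo ?K A))))"
    by (rule Cmp_eq_extend) (use cmd2_naturality[OF d, of "?\<theta>G A"] in simp_all)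
  finally show "Cmp (Src (cmK (mTgt (cSrc ?e)))) (Fa (cmK (mTgt (cSrc ?e))) (Ncp (cPhi ?e) A)) (Ncp (mT (cSrc ?e)) A)
      = Cmp (Src (cmK (mTgt (cSrc ?e)))) (Ncp (mT (cTgt ?e)) A) (Ncp (cPhi ?e) (Fo (cmK (mSrc (cSrc ?e))) A))"
    by simp
qed (use assms in simp_all)

lemma two_category_Cmd [simp]: "two_category Cmd"
proof (rule two_category.intro)
  show "category (cat01 Cmd)"
    by (rule categoryI) (simp_all add: cmd_cmp_assoc)
  show "category (cat12 Cmd)"
  proof (rule categoryI)
    fix c d e assume "c \<in> Ar (cat12 Cmd)" "d \<in> Ar (cat12 Cmd)" "e \<in> Ar (cat12 Cmd)"
      "Cod (cat12 Cmd) c = Dom (cat12 Cmd) d" "Cod (cat12 Cmd) d = Dom (cat12 Cmd) e"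
    then have *: "is_cmd2 c" "is_cmd2 d" "is_cmd2 e" "cSrc d = cTgt c" "cSrc e = cTgt d"
      by simp_all
    show "Cmp (cat12 Cmd) (Cmp (cat12 Cmd) e d) c = Cmp (cat12 Cmd) e (Cmp (cat12 Cmd) d c)"
      using * by simp
  qed simp_all
  show "category (cat02 Cmd)"
    by (rule categoryI) (simp_all add: cmd_cmp_assoc nhcmp_assoc)
next
  fix \<alpha> \<alpha>' \<beta> \<beta>' :: "'a cmd2"
  assume *: "\<alpha> \<in> C2 Cmd" "\<alpha>' \<in> C2 Cmd" "\<beta> \<in> C2 Cmd" "\<beta>' \<in> C2 Cmd"
    "tgt2 Cmd \<alpha> = src2 Cmd \<alpha>'" "tgt2 Cmd \<beta> = src2 Cmd \<beta>'" "tgt1 Cmd (src2 Cmd \<alpha>) = src1 Cmd (src2 Cmd \<beta>)"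
  then show "hcmp Cmd (vcmp Cmd \<beta>' \<beta>) (vcmp Cmd \<alpha>' \<alpha>) = vcmp Cmd (hcmp Cmd \<beta>' \<alpha>') (hcmp Cmd \<beta> \<alpha>)"
    by (simp add: nhcmp_interchange)
qed simp_all

lemma closed1_Cmd_ps: "closed1 Cmd (\<lambda>m. nat_iso (mT m))"
  by (simp add: closed1_def)

section \<open>The 2-category of adjunctions\<close>

lemma LAdj_iso_sel [simp]:
  "C0 LAdj_iso = {A. is_adjn A}" "C1 LAdj_iso = {f. is_adj1 f}" "C2 LAdj_iso = {d. is_adj2 d}"
  "src1 LAdj_iso = lSrc" "tgt1 LAdj_iso = lTgt" "src2 LAdj_iso = dSrc" "tgt2 LAdj_iso = dTgt"
  "id1 LAdj_iso A = \<lparr>lSrc = A, lTgt = A, lF = fid (Tgt (aL A)), lG = fid (Src (aL A)), lZ = nid (aL A)\<rparr>"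
  "cmp1 LAdj_iso = adj_cmp"
  "id2 LAdj_iso f = \<lparr>dSrc = f, dTgt = f, dPhi = nid (lF f), dPsi = nid (lG f)\<rparr>"
  "vcmp LAdj_iso e d = \<lparr>dSrc = dSrc d, dTgt = dTgt e, dPhi = dPhi e \<bullet> dPhi d, dPsi = dPsi e \<bullet> dPsi d\<rparr>"
  "hcmp LAdj_iso e d = \<lparr>dSrc = adj_cmp (dSrc e) (dSrc d), dTgt = adj_cmp (dTgt e) (dTgt d),
      dPhi = nhcmp (dPhi e) (dPhi d), dPsi = nhcmp (dPsi e) (dPsi d)\<rparr>"
  by (simp_all add: LAdj_iso_def)

lemma adjnD [simp]:
  assumes "is_adjn A"
  shows "is_functor (aL A)" "is_functor (aR A)" "Src (aR A) = Tgt (aL A)" "Tgt (aR A) = Src (aL A)"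
    "normalized (Src (aL A))" "normalized (Tgt (aL A))"
    "nat_trans (aEta A)" "Nsrc (aEta A) = fid (Src (aL A))" "Ntgt (aEta A) = aR A \<odot> aL A"
    "nat_trans (aEps A)" "Nsrc (aEps A) = aL A \<odot> aR A" "Ntgt (aEps A) = fid (Tgt (aL A))"
  using assms by (simp_all add: is_adjn_def Let_def NT_iff)

lemma adjn_triangles:
  assumes A: "is_adjn A"
  shows "B \<in> Ob (Src (aL A)) \<Longrightarrow>
      Cmp (Tgt (aL A)) (Ncp (aEps A) (Fo (aL A) B)) (Fa (aL A) (Ncp (aEta A) B)) = Idn (Tgt (aL A)) (Fo (aL A) B)"
    "Y \<in> Ob (Tgt (aL A)) \<Longrightarrow>
      Cmp (Src (aL A)) (Fa (aR A) (Ncp (aEps A) Y)) (Ncp (aEta A) (Fo (aR A) Y)) = Idn (Src (aL A)) (Fo (aR A) Y)"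
proof -
  have "(aEps A \<rhd> aL A) \<bullet> (aL A \<lhd> aEta A) = nid (aL A)" "(aR A \<lhd> aEps A) \<bullet> (aEta A \<rhd> aR A) = nid (aR A)"
    using A by (simp_all only: is_adjn_def Let_def)
  note this(1)[THEN arg_cong[where f = "\<lambda>\<alpha>. Ncp \<alpha> B"]] this(2)[THEN arg_cong[where f = "\<lambda>\<alpha>. Ncp \<alpha> Y"]]
  then show "B \<in> Ob (Src (aL A)) \<Longrightarrow>
      Cmp (Tgt (aL A)) (Ncp (aEps A) (Fo (aL A) B)) (Fa (aL A) (Ncp (aEta A) B)) = Idn (Tgt (aL A)) (Fo (aL A) B)"
    "Y \<in> Ob (Tgt (aL A)) \<Longrightarrow>
      Cmp (Src (aL A)) (Fa (aR A) (Ncp (aEps A) Y)) (Ncp (aEta A) (Fo (aR A) Y)) = Idn (Src (aL A)) (Fo (aR A) Y)"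
    using A by simp_all
qed

lemma adjn_naturality:
  assumes A: "is_adjn A"
  shows "x \<in> Ar (Src (aL A)) \<Longrightarrow> Cod (Src (aL A)) x = B \<Longrightarrow>
      Cmp (Src (aL A)) (Ncp (aEta A) B) x
        = Cmp (Src (aL A)) (Fa (aR A) (Fa (aL A) x)) (Ncp (aEta A) (Dom (Src (aL A)) x))"
    "y \<in> Ar (Tgt (aL A)) \<Longrightarrow> Cod (Tgt (aL A)) y = Y \<Longrightarrow>
      Cmp (Tgt (aL A)) (Ncp (aEps A) Y) (Fa (aL A) (Fa (aR A) y))
        = Cmp (Tgt (aL A)) y (Ncp (aEps A) (Dom (Tgt (aL A)) y))"
  using naturality[of "aEta A" x, OF _ _ refl refl] naturality[of "aEps A" y, OF _ _ refl refl] A by auto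

lemma adjnI:
  assumes [simp]: "is_functor (aL A)" "is_functor (aR A)" "Src (aR A) = Tgt (aL A)" "Tgt (aR A) = Src (aL A)"
    "normalized (Src (aL A))" "normalized (Tgt (aL A))"
    "nat_trans (aEta A)" "Nsrc (aEta A) = fid (Src (aL A))" "Ntgt (aEta A) = aR A \<odot> aL A"
    "nat_trans (aEps A)" "Nsrc (aEps A) = aL A \<odot> aR A" "Ntgt (aEps A) = fid (Tgt (aL A))"
    and "\<And>B. B \<in> Ob (Src (aL A)) \<Longrightarrow>
      Cmp (Tgt (aL A)) (Ncp (aEps A) (Fo (aL A) B)) (Fa (aL A) (Ncp (aEta A) B)) = Idn (Tgt (aL A)) (Fo (aL A) B)"
    "\<And>Y. Y \<in> Ob (Tgt (aL A)) \<Longrightarrow>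
      Cmp (Src (aL A)) (Fa (aR A) (Ncp (aEps A) Y)) (Ncp (aEta A) (Fo (aR A) Y)) = Idn (Src (aL A)) (Fo (aR A) Y)"
  shows "is_adjn A"
  unfolding is_adjn_def Let_def NT_iff
  by (intro conjI) (use assms(13,14) in \<open>auto intro!: ntr_eqI\<close>)

lemma adj1D [simp]:
  assumes "is_adj1 f"
  shows "is_adjn (lSrc f)" "is_adjn (lTgt f)"
    "is_functor (lF f)" "Src (lF f) = Tgt (aL (lSrc f))" "Tgt (lF f) = Tgt (aL (lTgt f))"
    "is_functor (lG f)" "Src (lG f) = Src (aL (lSrc f))" "Tgt (lG f) = Src (aL (lTgt f))"
    "nat_iso (lZ f)" "nat_trans (lZ f)" "Nsrc (lZ f) = aL (lTgt f) \<odot> lG f" "Ntgt (lZ f) = lF f \<odot> aL (lSrc f)"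
  using assms by (simp_all add: is_adj1_def Let_def NT_iff)

lemma adj1I:
  assumes "is_adjn (lSrc f)" "is_adjn (lTgt f)"
    "is_functor (lF f)" "Src (lF f) = Tgt (aL (lSrc f))" "Tgt (lF f) = Tgt (aL (lTgt f))"
    "is_functor (lG f)" "Src (lG f) = Src (aL (lSrc f))" "Tgt (lG f) = Src (aL (lTgt f))"
    "nat_iso (lZ f)" "Nsrc (lZ f) = aL (lTgt f) \<odot> lG f" "Ntgt (lZ f) = lF f \<odot> aL (lSrc f)"
  shows "is_adj1 f"
  unfolding is_adj1_def Let_def NT_iff using assms by simp

lemma adj1_naturality:
  assumes f: "is_adj1 f" and x: "x \<in> Ar (Src (aL (lSrc f)))" "Cod (Src (aL (lSrc f))) x = B"
  shows "Cmp (Tgt (aL (lTgt f))) (Ncp (lZ f) B) (Fa (aL (lTgt f)) (Fa (lG f) x))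
      = Cmp (Tgt (aL (lTgt f))) (Fa (lF f) (Fa (aL (lSrc f)) x)) (Ncp (lZ f) (Dom (Src (aL (lSrc f))) x))"
    "Cmp (Tgt (aL (lTgt f))) (inv_ar (Tgt (aL (lTgt f))) (Ncp (lZ f) B)) (Fa (lF f) (Fa (aL (lSrc f)) x))
      = Cmp (Tgt (aL (lTgt f))) (Fa (aL (lTgt f)) (Fa (lG f) x))
          (inv_ar (Tgt (aL (lTgt f))) (Ncp (lZ f) (Dom (Src (aL (lSrc f))) x)))"
  using naturality[of "lZ f" x, OF _ _ refl refl] naturality[of "ninv (lZ f)" x, OF _ _ refl refl] f x by auto

lemma adj2D [simp]:
  assumes "is_adj2 d"
  shows "is_adj1 (dSrc d)" "is_adj1 (dTgt d)" "lSrc (dTgt d) = lSrc (dSrc d)" "lTgt (dTgt d) = lTgt (dSrc d)"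
    "nat_trans (dPhi d)" "Nsrc (dPhi d) = lF (dSrc d)" "Ntgt (dPhi d) = lF (dTgt d)"
    "nat_trans (dPsi d)" "Nsrc (dPsi d) = lG (dSrc d)" "Ntgt (dPsi d) = lG (dTgt d)"
  using assms by (simp_all add: is_adj2_def Let_def NT_iff)

lemma adj2_law:
  assumes d: "is_adj2 d" and B: "B \<in> Ob (Src (aL (lSrc (dSrc d))))"
  shows "Cmp (Tgt (aL (lTgt (dSrc d)))) (Ncp (dPhi d) (Fo (aL (lSrc (dSrc d))) B)) (Ncp (lZ (dSrc d)) B)
    = Cmp (Tgt (aL (lTgt (dSrc d)))) (Ncp (lZ (dTgt d)) B) (Fa (aL (lTgt (dSrc d))) (Ncp (dPsi d) B))"
proof -
  have "(dPhi d \<rhd> aL (lSrc (dSrc d))) \<bullet> lZ (dSrc d) = lZ (dTgt d) \<bullet> (aL (lTgt (dSrc d)) \<lhd> dPsi d)"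
    using d unfolding is_adj2_def Let_def by blast
  note this[THEN arg_cong[where f = "\<lambda>\<alpha>. Ncp \<alpha> B"]]
  then show ?thesis using d B by simp
qed

text \<open>The comonad morphism attached to a 1-cell contains the inverse of \<zeta>, so the
  compatibility condition is also needed conjugated by the inverses on both sides.\<close>

lemma adj2_law_inv:
  assumes d: "is_adj2 d" and B: "B \<in> Ob (Src (aL (lSrc (dSrc d))))"
  shows "Cmp (Tgt (aL (lTgt (dSrc d)))) (inv_ar (Tgt (aL (lTgt (dSrc d)))) (Ncp (lZ (dTgt d)) B))
      (Ncp (dPhi d) (Fo (aL (lSrc (dSrc d))) B))
    = Cmp (Tgt (aL (lTgt (dSrc d)))) (Fa (aL (lTgt (dSrc d))) (Ncp (dPsi d) B))
      (inv_ar (Tgt (aL (lTgt (dSrc d)))) (Ncp (lZ (dSrc d)) B))" (is "Cmp ?C ?z2 ?\<phi> = Cmp ?C ?\<psi> ?z1")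
proof -
  note [simp] = d B
  have "Cmp ?C ?z2 ?\<phi> = Cmp ?C ?z2 (Cmp ?C (Cmp ?C ?\<phi> (Ncp (lZ (dSrc d)) B)) ?z1)"
    by simp
  also have "\<dots> = Cmp ?C ?\<psi> ?z1"
    by (subst adj2_law[OF d B]) simp
  finally show ?thesis .
qed

lemma adj2_naturality:
  assumes d: "is_adj2 d"
  shows "y \<in> Ar (Tgt (aL (lSrc (dSrc d)))) \<Longrightarrow> Cod (Tgt (aL (lSrc (dSrc d)))) y = Y \<Longrightarrow>
    Cmp (Tgt (aL (lTgt (dSrc d)))) (Ncp (dPhi d) Y) (Fa (lF (dSrc d)) y)
      = Cmp (Tgt (aL (lTgt (dSrc d)))) (Fa (lF (dTgt d)) y) (Ncp (dPhi d) (Dom (Tgt (aL (lSrc (dSrc d)))) y))"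
  "x \<in> Ar (Src (aL (lSrc (dSrc d)))) \<Longrightarrow> Cod (Src (aL (lSrc (dSrc d)))) x = X \<Longrightarrow>
    Cmp (Src (aL (lTgt (dSrc d)))) (Ncp (dPsi d) X) (Fa (lG (dSrc d)) x)
      = Cmp (Src (aL (lTgt (dSrc d)))) (Fa (lG (dTgt d)) x) (Ncp (dPsi d) (Dom (Src (aL (lSrc (dSrc d)))) x))"
  using naturality[of "dPhi d" y, OF _ _ refl refl] naturality[of "dPsi d" x, OF _ _ refl refl] assms by auto

lemma adj2I:
  assumes [simp]: "is_adj1 (dSrc d)" "is_adj1 (dTgt d)" "lSrc (dTgt d) = lSrc (dSrc d)" "lTgt (dTgt d) = lTgt (dSrc d)"
    "nat_trans (dPhi d)" "Nsrc (dPhi d) = lF (dSrc d)" "Ntgt (dPhi d) = lF (dTgt d)"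
    "nat_trans (dPsi d)" "Nsrc (dPsi d) = lG (dSrc d)" "Ntgt (dPsi d) = lG (dTgt d)"
    and "\<And>B. B \<in> Ob (Src (aL (lSrc (dSrc d)))) \<Longrightarrow>
      Cmp (Tgt (aL (lTgt (dSrc d)))) (Ncp (dPhi d) (Fo (aL (lSrc (dSrc d))) B)) (Ncp (lZ (dSrc d)) B)
      = Cmp (Tgt (aL (lTgt (dSrc d)))) (Ncp (lZ (dTgt d)) B) (Fa (aL (lTgt (dSrc d))) (Ncp (dPsi d) B))"
  shows "is_adj2 d"
  unfolding is_adj2_def Let_def NT_iff
  by (intro conjI) (use assms(11) in \<open>auto intro!: ntr_eqI\<close>)

section \<open>Composition of left loose morphisms and of their 2-cells\<close>

lemma adj_cmp_sel [simp]:
  "lSrc (adj_cmp g f) = lSrc f" "lTgt (adj_cmp g f) = lTgt g" "lF (adj_cmp g f) = lF g \<odot> lF f"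
  "lG (adj_cmp g f) = lG g \<odot> lG f" "lZ (adj_cmp g f) = (lF g \<lhd> lZ f) \<bullet> (lZ g \<rhd> lG f)"
  by (simp_all add: adj_cmp_def)

lemma adj_cmp_adj1 [simp]:
  assumes "is_adj1 f" "is_adj1 g" "lSrc g = lTgt f"
  shows "is_adj1 (adj_cmp g f)"
  by (rule adj1I) (use assms in simp_all)

lemma adj_id_adj1 [simp]:
  "is_adjn A \<Longrightarrow> is_adj1 \<lparr>lSrc = A, lTgt = A, lF = fid (Tgt (aL A)), lG = fid (Src (aL A)), lZ = nid (aL A)\<rparr>"
  by (rule adj1I) simp_all

lemma adj_cmp_assoc:
  assumes "is_adj1 f" "is_adj1 g" "is_adj1 h" "lSrc g = lTgt f" "lSrc h = lTgt g"
  shows "adj_cmp (adj_cmp h g) f = adj_cmp h (adj_cmp g f)"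
  using assms by (intro adj1.equality ntr_eqI) simp_all

lemma adj_cmp_id [simp]:
  assumes "is_adj1 f"
  shows "A = lTgt f \<Longrightarrow>
      adj_cmp \<lparr>lSrc = A, lTgt = A, lF = fid (Tgt (aL A)), lG = fid (Src (aL A)), lZ = nid (aL A)\<rparr> f = f"
    "A = lSrc f \<Longrightarrow>
      adj_cmp f \<lparr>lSrc = A, lTgt = A, lF = fid (Tgt (aL A)), lG = fid (Src (aL A)), lZ = nid (aL A)\<rparr> = f"
  using assms by (auto intro!: adj1.equality)

lemma adj_id_adj2 [simp]:
  "is_adj1 f \<Longrightarrow> lF f = F \<Longrightarrow> lG f = G \<Longrightarrow> is_adj2 \<lparr>dSrc = f, dTgt = f, dPhi = nid F, dPsi = nid G\<rparr>"
  by (rule adj2I) auto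

lemma adj_vcmp_adj2 [simp]:
  assumes d: "is_adj2 d" and e: "is_adj2 e" and de: "dSrc e = dTgt d"
  shows "is_adj2 \<lparr>dSrc = dSrc d, dTgt = dTgt e, dPhi = dPhi e \<bullet> dPhi d, dPsi = dPsi e \<bullet> dPsi d\<rparr>" (is "is_adj2 ?e")
proof (rule adj2I)
  note [simp] = d e de
  have [simp]: "lSrc (dTgt e) = lSrc (dSrc d)" "lTgt (dTgt e) = lTgt (dSrc d)"
    using adj2D(3,4)[OF e] d by simp_all
  fix B assume "B \<in> Ob (Src (aL (lSrc (dSrc ?e))))"
  then have B [simp]: "B \<in> Ob (Src (aL (lSrc (dSrc d))))" by simp
  let ?C = "Tgt (aL (lTgt (dSrc d)))" and ?L' = "aL (lTgt (dSrc d))" and ?L = "aL (lSrc (dSrc d))"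
  have law: "Cmp ?C (Ncp (dPhi e) (Fo ?L B)) (Ncp (lZ (dTgt d)) B) = Cmp ?C (Ncp (lZ (dTgt e)) B) (Fa ?L' (Ncp (dPsi e) B))"
    using adj2_law[OF e, of B] by simp
  have "Cmp ?C (Ncp (dPhi e) (Fo ?L B)) (Cmp ?C (Ncp (dPhi d) (Fo ?L B)) (Ncp (lZ (dSrc d)) B))
    = Cmp ?C (Ncp (lZ (dTgt e)) B) (Cmp ?C (Fa ?L' (Ncp (dPsi e) B)) (Fa ?L' (Ncp (dPsi d) B)))"
    by (subst adj2_law[OF d B], rule Cmp_eq_extend[OF law]) simp_all
  then show "Cmp (Tgt (aL (lTgt (dSrc ?e)))) (Ncp (dPhi ?e) (Fo (aL (lSrc (dSrc ?e))) B)) (Ncp (lZ (dSrc ?e)) B)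
    = Cmp (Tgt (aL (lTgt (dSrc ?e)))) (Ncp (lZ (dTgt ?e)) B) (Fa (aL (lTgt (dSrc ?e))) (Ncp (dPsi ?e) B))"
    by simp
qed (use d e de adj2D(3,4)[OF e] in simp_all)

text \<open>The pasting consists of the two laws, naturality of \<zeta>' at \<psi>, and naturality
  of \<phi>' at the isomorphism of the target of \<open>d\<close>.\<close>

lemma adj_hcmp_adj2 [simp]:
  assumes d: "is_adj2 d" and e: "is_adj2 e" and de: "lSrc (dSrc e) = lTgt (dSrc d)"
  shows "is_adj2 \<lparr>dSrc = adj_cmp (dSrc e) (dSrc d), dTgt = adj_cmp (dTgt e) (dTgt d),
      dPhi = nhcmp (dPhi e) (dPhi d), dPsi = nhcmp (dPsi e) (dPsi d)\<rparr>" (is "is_adj2 ?e")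
proof (rule adj2I)
  note [simp] = d e de
  fix B assume "B \<in> Ob (Src (aL (lSrc (dSrc ?e))))"
  then have B [simp]: "B \<in> Ob (Src (aL (lSrc (dSrc d))))" by simp
  let ?C = "Tgt (aL (lTgt (dSrc e)))" and ?L'' = "aL (lTgt (dSrc e))" and ?L = "aL (lSrc (dSrc d))"
    and ?L' = "aL (lTgt (dSrc d))"
    and ?F' = "lF (dSrc e)" and ?F2' = "lF (dTgt e)" and ?F = "lF (dSrc d)" and ?F2 = "lF (dTgt d)"
    and ?G = "lG (dSrc d)" and ?G2 = "lG (dTgt d)" and ?G' = "lG (dSrc e)"
    and ?\<phi> = "Ncp (dPhi d)" and ?\<phi>' = "Ncp (dPhi e)" and ?\<psi> = "Ncp (dPsi d)" and ?\<psi>' = "Ncp (dPsi e)"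
    and ?\<zeta> = "Ncp (lZ (dSrc d))" and ?\<zeta>2 = "Ncp (lZ (dTgt d))" and ?\<zeta>' = "Ncp (lZ (dSrc e))" and ?\<zeta>2' = "Ncp (lZ (dTgt e))"
  have law: "Cmp ?C (?\<phi>' (Fo ?L' (Fo ?G2 B))) (?\<zeta>' (Fo ?G2 B))
    = Cmp ?C (?\<zeta>2' (Fo ?G2 B)) (Fa ?L'' (?\<psi>' (Fo ?G2 B)))"
    using adj2_law[OF e, of "Fo ?G2 B"] by simp
  have nat_phi: "Cmp ?C (?\<phi>' (Fo ?F2 (Fo ?L B))) (Fa ?F' (?\<zeta>2 B)) = Cmp ?C (Fa ?F2' (?\<zeta>2 B)) (?\<phi>' (Fo ?L' (Fo ?G2 B)))"
    using adj2_naturality(1)[OF e, of "?\<zeta>2 B"] by simp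
  have nat_zeta: "Cmp ?C (Fa ?F' (Fa ?L' (?\<psi> B))) (?\<zeta>' (Fo ?G B)) = Cmp ?C (?\<zeta>' (Fo ?G2 B)) (Fa ?L'' (Fa ?G' (?\<psi> B)))"
    using adj1_naturality(1)[of "dSrc e" "?\<psi> B"] by simp
  have "Cmp ?C (?\<phi>' (Fo ?F2 (Fo ?L B))) (Cmp ?C (Fa ?F' (?\<phi> (Fo ?L B))) (Cmp ?C (Fa ?F' (?\<zeta> B)) (?\<zeta>' (Fo ?G B))))
    = Cmp ?C (?\<phi>' (Fo ?F2 (Fo ?L B))) (Cmp ?C (Fa ?F' (?\<zeta>2 B)) (Cmp ?C (Fa ?F' (Fa ?L' (?\<psi> B))) (?\<zeta>' (Fo ?G B))))"
    using arg_cong[OF adj2_law[OF d B], of "Fa ?F'"] by (subst Cmp_eq_extend) simp_all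
  also have "\<dots> = Cmp ?C (Fa ?F2' (?\<zeta>2 B)) (Cmp ?C (?\<phi>' (Fo ?L' (Fo ?G2 B)))
      (Cmp ?C (?\<zeta>' (Fo ?G2 B)) (Fa ?L'' (Fa ?G' (?\<psi> B)))))"
    by (subst nat_zeta, rule Cmp_eq_extend[OF nat_phi]) simp_all
  also have "\<dots> = Cmp ?C (Fa ?F2' (?\<zeta>2 B)) (Cmp ?C (?\<zeta>2' (Fo ?G2 B))
      (Cmp ?C (Fa ?L'' (?\<psi>' (Fo ?G2 B))) (Fa ?L'' (Fa ?G' (?\<psi> B)))))"
    by (subst Cmp_eq_extend[OF law]) simp_all
  finally show "Cmp (Tgt (aL (lTgt (dSrc ?e)))) (Ncp (dPhi ?e) (Fo (aL (lSrc (dSrc ?e))) B)) (Ncp (lZ (dSrc ?e)) B)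
    = Cmp (Tgt (aL (lTgt (dSrc ?e)))) (Ncp (lZ (dTgt ?e)) B) (Fa (aL (lTgt (dSrc ?e))) (Ncp (dPsi ?e) B))"
    by simp
qed (use assms in simp_all)

lemma two_category_LAdj_iso [simp]: "two_category LAdj_iso"
proof (rule two_category.intro)
  show "category (cat01 LAdj_iso)"
    by (rule categoryI) (simp_all add: adj_cmp_assoc)
  show "category (cat12 LAdj_iso)"
  proof (rule categoryI)
    fix c d e assume "c \<in> Ar (cat12 LAdj_iso)" "d \<in> Ar (cat12 LAdj_iso)" "e \<in> Ar (cat12 LAdj_iso)"
      "Cod (cat12 LAdj_iso) c = Dom (cat12 LAdj_iso) d" "Cod (cat12 LAdj_iso) d = Dom (cat12 LAdj_iso) e"
    then have *: "is_adj2 c" "is_adj2 d" "is_adj2 e" "dSrc d = dTgt c" "dSrc e = dTgt d"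
      by simp_all
    show "Cmp (cat12 LAdj_iso) (Cmp (cat12 LAdj_iso) e d) c = Cmp (cat12 LAdj_iso) e (Cmp (cat12 LAdj_iso) d c)"
      using * by simp
  qed simp_all
  show "category (cat02 LAdj_iso)"
    by (rule categoryI) (simp_all add: adj_cmp_assoc nhcmp_assoc)
next
  fix \<alpha> \<alpha>' \<beta> \<beta>' :: "'a adj2"
  assume "\<alpha> \<in> C2 LAdj_iso" "\<alpha>' \<in> C2 LAdj_iso" "\<beta> \<in> C2 LAdj_iso" "\<beta>' \<in> C2 LAdj_iso"
    "tgt2 LAdj_iso \<alpha> = src2 LAdj_iso \<alpha>'" "tgt2 LAdj_iso \<beta> = src2 LAdj_iso \<beta>'"
    "tgt1 LAdj_iso (src2 LAdj_iso \<alpha>) = src1 LAdj_iso (src2 LAdj_iso \<beta>)"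
  then show "hcmp LAdj_iso (vcmp LAdj_iso \<beta>' \<beta>) (vcmp LAdj_iso \<alpha>' \<alpha>)
    = vcmp LAdj_iso (hcmp LAdj_iso \<beta>' \<alpha>') (hcmp LAdj_iso \<beta> \<alpha>)"
    by (simp add: nhcmp_interchange)
qed simp_all

section \<open>Mates\<close>

lemma mate_sel [simp]:
  assumes "is_adj1 f"
  shows "nat_trans (mate f)" "Nsrc (mate f) = lG f \<odot> aR (lSrc f)" "Ntgt (mate f) = aR (lTgt f) \<odot> lF f"
    "Y \<in> Ob (Tgt (aL (lSrc f))) \<Longrightarrow> Ncp (mate f) Y =
      Cmp (Src (aL (lTgt f))) (Fa (aR (lTgt f)) (Fa (lF f) (Ncp (aEps (lSrc f)) Y)))
        (Cmp (Src (aL (lTgt f))) (Fa (aR (lTgt f)) (Ncp (lZ f) (Fo (aR (lSrc f)) Y)))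
          (Ncp (aEta (lTgt f)) (Fo (lG f) (Fo (aR (lSrc f)) Y))))"
  using assms by (simp_all add: mate_def)

text \<open>This says that the mate is the transpose of F \<epsilon> after \<zeta> R under the
  target adjunction. Two naturality squares carry \<epsilon>' to the right, where a triangle
  identity cancels it against \<eta>'.\<close>

lemma mate_transpose:
  assumes f: "is_adj1 f" and Y: "Y \<in> Ob (Tgt (aL (lSrc f)))"
  shows "Cmp (Tgt (aL (lTgt f))) (Ncp (aEps (lTgt f)) (Fo (lF f) Y)) (Fa (aL (lTgt f)) (Ncp (mate f) Y))
    = Cmp (Tgt (aL (lTgt f))) (Fa (lF f) (Ncp (aEps (lSrc f)) Y)) (Ncp (lZ f) (Fo (aR (lSrc f)) Y))"
proof -
  note [simp] = f Y
  let ?C = "Tgt (aL (lTgt f))" and ?L' = "aL (lTgt f)" and ?R' = "aR (lTgt f)" and ?R = "aR (lSrc f)" and ?L = "aL (lSrc f)"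
    and ?\<epsilon>' = "Ncp (aEps (lTgt f))" and ?\<epsilon> = "Ncp (aEps (lSrc f))" and ?\<eta>' = "Ncp (aEta (lTgt f))" and ?\<zeta> = "Ncp (lZ f)"
    and ?F = "lF f" and ?G = "lG f"
  have nat1: "Cmp ?C (?\<epsilon>' (Fo ?F Y)) (Fa ?L' (Fa ?R' (Fa ?F (?\<epsilon> Y))))
    = Cmp ?C (Fa ?F (?\<epsilon> Y)) (?\<epsilon>' (Fo ?F (Fo ?L (Fo ?R Y))))"
    using adjn_naturality(2)[of "lTgt f" "Fa ?F (?\<epsilon> Y)"] by simp
  have nat2: "Cmp ?C (?\<epsilon>' (Fo ?F (Fo ?L (Fo ?R Y)))) (Fa ?L' (Fa ?R' (?\<zeta> (Fo ?R Y))))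
    = Cmp ?C (?\<zeta> (Fo ?R Y)) (?\<epsilon>' (Fo ?L' (Fo ?G (Fo ?R Y))))"
    using adjn_naturality(2)[of "lTgt f" "?\<zeta> (Fo ?R Y)"] by simp
  have "Cmp ?C (?\<epsilon>' (Fo ?F Y)) (Cmp ?C (Fa ?L' (Fa ?R' (Fa ?F (?\<epsilon> Y))))
      (Cmp ?C (Fa ?L' (Fa ?R' (?\<zeta> (Fo ?R Y)))) (Fa ?L' (?\<eta>' (Fo ?G (Fo ?R Y))))))
    = Cmp ?C (Fa ?F (?\<epsilon> Y)) (Cmp ?C (?\<epsilon>' (Fo ?F (Fo ?L (Fo ?R Y))))
      (Cmp ?C (Fa ?L' (Fa ?R' (?\<zeta> (Fo ?R Y)))) (Fa ?L' (?\<eta>' (Fo ?G (Fo ?R Y))))))"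
    by (rule Cmp_eq_extend[OF nat1]) simp_all
  also have "\<dots> = Cmp ?C (Fa ?F (?\<epsilon> Y)) (Cmp ?C (?\<zeta> (Fo ?R Y))
      (Cmp ?C (?\<epsilon>' (Fo ?L' (Fo ?G (Fo ?R Y)))) (Fa ?L' (?\<eta>' (Fo ?G (Fo ?R Y))))))"
    by (subst Cmp_eq_extend[OF nat2]) simp_all
  also have "\<dots> = Cmp ?C (Fa ?F (?\<epsilon> Y)) (?\<zeta> (Fo ?R Y))"
    by (subst adjn_triangles(1)) simp_all
  finally show ?thesis
    by simp
qed

text \<open>Naturality of \<eta>' and of \<zeta> at the component of \<eta> carries \<eta> to the
  left, where a triangle identity of the source adjunction cancels it against \<epsilon>.\<close>

lemma mate_unit:
  assumes f: "is_adj1 f" and B: "B \<in> Ob (Src (aL (lSrc f)))"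
  shows "Cmp (Src (aL (lTgt f))) (Ncp (mate f) (Fo (aL (lSrc f)) B)) (Fa (lG f) (Ncp (aEta (lSrc f)) B))
    = Cmp (Src (aL (lTgt f))) (Fa (aR (lTgt f)) (Ncp (lZ f) B)) (Ncp (aEta (lTgt f)) (Fo (lG f) B))"
proof -
  note [simp] = f B
  let ?D = "Src (aL (lTgt f))" and ?L' = "aL (lTgt f)" and ?R' = "aR (lTgt f)" and ?R = "aR (lSrc f)" and ?L = "aL (lSrc f)"
    and ?\<epsilon> = "Ncp (aEps (lSrc f))" and ?\<eta>' = "Ncp (aEta (lTgt f))" and ?\<eta> = "Ncp (aEta (lSrc f))" and ?\<zeta> = "Ncp (lZ f)"
    and ?F = "lF f" and ?G = "lG f"
  have nat1: "Cmp ?D (?\<eta>' (Fo ?G (Fo ?R (Fo ?L B)))) (Fa ?G (?\<eta> B)) = Cmp ?D (Fa ?R' (Fa ?L' (Fa ?G (?\<eta> B)))) (?\<eta>' (Fo ?G B))"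
    using adjn_naturality(1)[of "lTgt f" "Fa ?G (?\<eta> B)"] by simp
  have nat2: "Cmp ?D (Fa ?R' (?\<zeta> (Fo ?R (Fo ?L B)))) (Fa ?R' (Fa ?L' (Fa ?G (?\<eta> B))))
    = Cmp ?D (Fa ?R' (Fa ?F (Fa ?L (?\<eta> B)))) (Fa ?R' (?\<zeta> B))"
    using arg_cong[OF adj1_naturality(1)[OF f, of "?\<eta> B", OF _ refl], of "Fa ?R'"] by simp
  have triangle: "Cmp ?D (Fa ?R' (Fa ?F (?\<epsilon> (Fo ?L B)))) (Fa ?R' (Fa ?F (Fa ?L (?\<eta> B)))) = Idn ?D (Fo ?R' (Fo ?F (Fo ?L B)))"
    using arg_cong[OF adjn_triangles(1)[of "lSrc f" B], of "\<lambda>x. Fa ?R' (Fa ?F x)"] by simp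
  have "Cmp ?D (Fa ?R' (Fa ?F (?\<epsilon> (Fo ?L B)))) (Cmp ?D (Fa ?R' (?\<zeta> (Fo ?R (Fo ?L B))))
      (Cmp ?D (?\<eta>' (Fo ?G (Fo ?R (Fo ?L B)))) (Fa ?G (?\<eta> B))))
    = Cmp ?D (Fa ?R' (Fa ?F (?\<epsilon> (Fo ?L B)))) (Cmp ?D (Fa ?R' (Fa ?F (Fa ?L (?\<eta> B)))) (Cmp ?D (Fa ?R' (?\<zeta> B)) (?\<eta>' (Fo ?G B))))"
    unfolding nat1 by (subst Cmp_eq_extend[OF nat2]) simp_all
  also have "\<dots> = Cmp ?D (Fa ?R' (?\<zeta> B)) (?\<eta>' (Fo ?G B))"
    by (subst Cmp_eq_extend1[OF triangle]) simp_all
  finally show ?thesis by simp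
qed

lemma mate_ar [simp]:
  assumes "is_adj1 f" "Y \<in> Ob (Tgt (aL (lSrc f)))"
  shows "Ncp (mate f) Y \<in> Ar (Src (aL (lTgt f)))"
    "Dom (Src (aL (lTgt f))) (Ncp (mate f) Y) = Fo (lG f) (Fo (aR (lSrc f)) Y)"
    "Cod (Src (aL (lTgt f))) (Ncp (mate f) Y) = Fo (aR (lTgt f)) (Fo (lF f) Y)"
  using assms by simp_all

text \<open>From here on mates stay folded, so that the two preceding laws can be applied to them;
  the explicit formula is called up only where it is wanted.\<close>

declare mate_sel(4) [simp del]

text \<open>Compatibility of mates with pasting. Naturality of \<eta>'' and \<zeta>' at the mate of
  \<open>f\<close> brings L' of this mate next to \<epsilon>', and \<open>mate_transpose\<close>
  then replaces both by \<epsilon> and \<zeta>. It yields functoriality of C as well as closure of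
  the pseudo morphisms under composition.\<close>

lemma mate_cmp:
  assumes f: "is_adj1 f" and g: "is_adj1 g" and fg: "lSrc g = lTgt f"
  shows "mate (adj_cmp g f) = (mate g \<rhd> lF f) \<bullet> (lG g \<lhd> mate f)"
proof (rule ntr_eqI)
  note [simp] = f g fg
  fix Y assume "Y \<in> Ob (Src (Nsrc ((mate g \<rhd> lF f) \<bullet> (lG g \<lhd> mate f))))"
  then have Y [simp]: "Y \<in> Ob (Tgt (aL (lSrc f)))" by simp
  let ?D = "Src (aL (lTgt g))" and ?L' = "aL (lTgt f)" and ?R' = "aR (lTgt f)" and ?R = "aR (lSrc f)"
    and ?L = "aL (lSrc f)" and ?R'' = "aR (lTgt g)" and ?L'' = "aL (lTgt g)" and ?F = "lF f" and ?G = "lG f"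
    and ?F' = "lF g" and ?G' = "lG g"
    and ?\<epsilon> = "Ncp (aEps (lSrc f))" and ?\<epsilon>' = "Ncp (aEps (lTgt f))" and ?\<eta>'' = "Ncp (aEta (lTgt g))"
    and ?\<zeta> = "Ncp (lZ f)" and ?\<zeta>' = "Ncp (lZ g)" and ?m = "Ncp (mate f) Y"
  have nat1: "Cmp ?D (?\<eta>'' (Fo ?G' (Fo ?R' (Fo ?F Y)))) (Fa ?G' ?m)
    = Cmp ?D (Fa ?R'' (Fa ?L'' (Fa ?G' ?m))) (?\<eta>'' (Fo ?G' (Fo ?G (Fo ?R Y))))"
    using adjn_naturality(1)[of "lTgt g" "Fa ?G' ?m"] by simp
  have nat2: "Cmp ?D (Fa ?R'' (?\<zeta>' (Fo ?R' (Fo ?F Y)))) (Fa ?R'' (Fa ?L'' (Fa ?G' ?m)))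
    = Cmp ?D (Fa ?R'' (Fa ?F' (Fa ?L' ?m))) (Fa ?R'' (?\<zeta>' (Fo ?G (Fo ?R Y))))"
    using arg_cong[OF adj1_naturality(1)[OF g, of ?m, OF _ refl], of "Fa ?R''"] by simp
  have transpose: "Cmp ?D (Fa ?R'' (Fa ?F' (?\<epsilon>' (Fo ?F Y)))) (Fa ?R'' (Fa ?F' (Fa ?L' ?m)))
    = Cmp ?D (Fa ?R'' (Fa ?F' (Fa ?F (?\<epsilon> Y)))) (Fa ?R'' (Fa ?F' (?\<zeta> (Fo ?R Y))))"
    using arg_cong[OF mate_transpose[OF f Y], of "\<lambda>x. Fa ?R'' (Fa ?F' x)"] by simp
  have "Cmp ?D (Ncp (mate g) (Fo ?F Y)) (Fa ?G' ?m)
    = Cmp ?D (Fa ?R'' (Fa ?F' (?\<epsilon>' (Fo ?F Y)))) (Cmp ?D (Fa ?R'' (?\<zeta>' (Fo ?R' (Fo ?F Y))))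
      (Cmp ?D (?\<eta>'' (Fo ?G' (Fo ?R' (Fo ?F Y)))) (Fa ?G' ?m)))"
    by (simp add: mate_sel(4))
  also have "\<dots> = Cmp ?D (Fa ?R'' (Fa ?F' (?\<epsilon>' (Fo ?F Y)))) (Cmp ?D (Fa ?R'' (Fa ?F' (Fa ?L' ?m)))
      (Cmp ?D (Fa ?R'' (?\<zeta>' (Fo ?G (Fo ?R Y)))) (?\<eta>'' (Fo ?G' (Fo ?G (Fo ?R Y))))))"
    unfolding nat1 by (subst Cmp_eq_extend[OF nat2]) simp_all
  also have "\<dots> = Cmp ?D (Fa ?R'' (Fa ?F' (Fa ?F (?\<epsilon> Y)))) (Cmp ?D (Fa ?R'' (Fa ?F' (?\<zeta> (Fo ?R Y))))
      (Cmp ?D (Fa ?R'' (?\<zeta>' (Fo ?G (Fo ?R Y)))) (?\<eta>'' (Fo ?G' (Fo ?G (Fo ?R Y))))))"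
    by (rule Cmp_eq_extend[OF transpose]) simp_all
  finally show "Ncp (mate (adj_cmp g f)) Y = Ncp ((mate g \<rhd> lF f) \<bullet> (lG g \<lhd> mate f)) Y"
    by (simp add: mate_sel(4))
qed (use assms in simp_all)

lemma mate_id:
  assumes A: "is_adjn A"
  shows "mate \<lparr>lSrc = A, lTgt = A, lF = fid (Tgt (aL A)), lG = fid (Src (aL A)), lZ = nid (aL A)\<rparr> = nid (aR A)"
  using A adjn_triangles(2)[OF A] by (intro ntr_eqI) (simp_all add: mate_sel(4))

text \<open>The compatibility of (\<phi>, \<psi>) with \<zeta> passes to mates by naturality of
  \<phi> at \<epsilon> and of \<eta>' at \<psi>.\<close>

lemma mate_adj2:
  assumes d: "is_adj2 d" and Y: "Y \<in> Ob (Tgt (aL (lSrc (dSrc d))))"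
  shows "Cmp (Src (aL (lTgt (dSrc d)))) (Fa (aR (lTgt (dSrc d))) (Ncp (dPhi d) Y)) (Ncp (mate (dSrc d)) Y)
    = Cmp (Src (aL (lTgt (dSrc d)))) (Ncp (mate (dTgt d)) Y) (Ncp (dPsi d) (Fo (aR (lSrc (dSrc d))) Y))"
proof -
  note [simp] = d Y
  let ?D = "Src (aL (lTgt (dSrc d)))" and ?L' = "aL (lTgt (dSrc d))" and ?R' = "aR (lTgt (dSrc d))"
    and ?R = "aR (lSrc (dSrc d))" and ?L = "aL (lSrc (dSrc d))"
    and ?F = "lF (dSrc d)" and ?F2 = "lF (dTgt d)" and ?G = "lG (dSrc d)" and ?G2 = "lG (dTgt d)"
    and ?\<epsilon> = "Ncp (aEps (lSrc (dSrc d)))" and ?\<eta>' = "Ncp (aEta (lTgt (dSrc d)))"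
    and ?\<zeta> = "Ncp (lZ (dSrc d))" and ?\<zeta>2 = "Ncp (lZ (dTgt d))" and ?\<phi> = "Ncp (dPhi d)" and ?\<psi> = "Ncp (dPsi d)"
  have nat1: "Cmp ?D (Fa ?R' (?\<phi> Y)) (Fa ?R' (Fa ?F (?\<epsilon> Y))) = Cmp ?D (Fa ?R' (Fa ?F2 (?\<epsilon> Y))) (Fa ?R' (?\<phi> (Fo ?L (Fo ?R Y))))"
    using arg_cong[OF adj2_naturality(1)[OF d, of "?\<epsilon> Y", OF _ refl], of "Fa ?R'"] by simp
  have law: "Cmp ?D (Fa ?R' (?\<phi> (Fo ?L (Fo ?R Y)))) (Fa ?R' (?\<zeta> (Fo ?R Y)))
    = Cmp ?D (Fa ?R' (?\<zeta>2 (Fo ?R Y))) (Fa ?R' (Fa ?L' (?\<psi> (Fo ?R Y))))"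
    using arg_cong[OF adj2_law[OF d, of "Fo ?R Y"], of "Fa ?R'"] by simp
  have nat2: "Cmp ?D (Fa ?R' (Fa ?L' (?\<psi> (Fo ?R Y)))) (?\<eta>' (Fo ?G (Fo ?R Y))) = Cmp ?D (?\<eta>' (Fo ?G2 (Fo ?R Y))) (?\<psi> (Fo ?R Y))"
    using adjn_naturality(1)[of "lTgt (dSrc d)" "?\<psi> (Fo ?R Y)"] by simp
  have "Cmp ?D (Fa ?R' (?\<phi> Y)) (Ncp (mate (dSrc d)) Y) = Cmp ?D (Fa ?R' (Fa ?F2 (?\<epsilon> Y))) (Cmp ?D (Fa ?R' (?\<phi> (Fo ?L (Fo ?R Y))))
      (Cmp ?D (Fa ?R' (?\<zeta> (Fo ?R Y))) (?\<eta>' (Fo ?G (Fo ?R Y)))))"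
    unfolding mate_sel(4)[OF adj2D(1)[OF d] Y] by (rule Cmp_eq_extend[OF nat1]) simp_all
  also have "\<dots> = Cmp ?D (Fa ?R' (Fa ?F2 (?\<epsilon> Y))) (Cmp ?D (Fa ?R' (?\<zeta>2 (Fo ?R Y)))
      (Cmp ?D (?\<eta>' (Fo ?G2 (Fo ?R Y))) (?\<psi> (Fo ?R Y))))"
    by (subst Cmp_eq_extend[OF law]) (simp_all add: nat2)
  finally show ?thesis by (simp add: mate_sel(4))
qed

section \<open>The comonad of an adjunction\<close>

lemma Cm0_sel [simp]: "cmK (Cm0 A) = aL A \<odot> aR A" "cmE (Cm0 A) = aEps A" "cmN (Cm0 A) = aL A \<lhd> (aEta A \<rhd> aR A)"
  by (simp_all add: Cm0_def)

lemma Cm1_sel [simp]: "mSrc (Cm1 f) = Cm0 (lSrc f)" "mTgt (Cm1 f) = Cm0 (lTgt f)" "mH (Cm1 f) = lF f"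
  "mT (Cm1 f) = (aL (lTgt f) \<lhd> mate f) \<bullet> (ninv (lZ f) \<rhd> aR (lSrc f))"
  by (simp_all add: Cm1_def)

lemma Cm2_sel [simp]: "cSrc (Cm2 d) = Cm1 (dSrc d)" "cTgt (Cm2 d) = Cm1 (dTgt d)" "cPhi (Cm2 d) = dPhi d"
  by (simp_all add: Cm2_def)

text \<open>The counit laws are the two triangle identities. Coassociativity is the L-image of the
  naturality of \<eta> at its own component at R Y.\<close>

lemma Cm0_comonad [simp]:
  assumes A: "is_adjn A"
  shows "is_comonad (Cm0 A)"
proof (rule comonadI)
  note [simp] = A
  fix Y assume "Y \<in> Ob (Src (cmK (Cm0 A)))"
  then have Y [simp]: "Y \<in> Ob (Tgt (aL A))" by simp
  show "Cmp (Src (cmK (Cm0 A))) (Fa (cmK (Cm0 A)) (Ncp (cmE (Cm0 A)) Y)) (Ncp (cmN (Cm0 A)) Y)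
      = Idn (Src (cmK (Cm0 A))) (Fo (cmK (Cm0 A)) Y)"
    using arg_cong[OF adjn_triangles(2)[OF A Y], of "Fa (aL A)"] by simp
  show "Cmp (Src (cmK (Cm0 A))) (Ncp (cmE (Cm0 A)) (Fo (cmK (Cm0 A)) Y)) (Ncp (cmN (Cm0 A)) Y)
      = Idn (Src (cmK (Cm0 A))) (Fo (cmK (Cm0 A)) Y)"
    using adjn_triangles(1)[OF A, of "Fo (aR A) Y"] by simp
  show "Cmp (Src (cmK (Cm0 A))) (Fa (cmK (Cm0 A)) (Ncp (cmN (Cm0 A)) Y)) (Ncp (cmN (Cm0 A)) Y)
      = Cmp (Src (cmK (Cm0 A))) (Ncp (cmN (Cm0 A)) (Fo (cmK (Cm0 A)) Y)) (Ncp (cmN (Cm0 A)) Y)"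
    using arg_cong[OF adjn_naturality(1)[OF A, of "Ncp (aEta A) (Fo (aR A) Y)", OF _ refl], of "Fa (aL A)"] by simp
qed (use A in simp_all)

text \<open>The counit law is \<open>mate_transpose\<close> composed with the inverse of \<zeta>. In
  the comultiplication law the inverse of \<zeta> first moves past \<eta>; then
  \<open>mate_unit\<close> produces a \<zeta> that cancels another copy of the inverse, and
  naturality of \<eta>' at the mate concludes.\<close>

lemma Cm1_cmd1 [simp]:
  assumes f: "is_adj1 f"
  shows "is_cmd1 (Cm1 f)"
proof (rule cmd1I)
  note [simp] = f
  fix Y assume "Y \<in> Ob (Src (cmK (mSrc (Cm1 f))))"
  then have Y [simp]: "Y \<in> Ob (Tgt (aL (lSrc f)))" by simp
  let ?C = "Tgt (aL (lTgt f))" and ?D = "Src (aL (lTgt f))" and ?L' = "aL (lTgt f)" and ?R' = "aR (lTgt f)"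
    and ?R = "aR (lSrc f)" and ?L = "aL (lSrc f)" and ?F = "lF f" and ?G = "lG f"
    and ?\<epsilon>' = "Ncp (aEps (lTgt f))" and ?\<epsilon> = "Ncp (aEps (lSrc f))" and ?\<eta>' = "Ncp (aEta (lTgt f))"
    and ?\<eta> = "Ncp (aEta (lSrc f))" and ?\<zeta> = "Ncp (lZ f)" and ?m = "Ncp (mate f)"
  let ?z = "\<lambda>B. inv_ar ?C (?\<zeta> B)"
  have "Cmp ?C (?\<epsilon>' (Fo ?F Y)) (Cmp ?C (Fa ?L' (?m Y)) (?z (Fo ?R Y))) = Fa ?F (?\<epsilon> Y)"
    by (subst Cmp_eq_extend[OF mate_transpose[OF f Y]]) simp_all
  then show "Cmp (Src (cmK (mTgt (Cm1 f)))) (Ncp (cmE (mTgt (Cm1 f))) (Fo (mH (Cm1 f)) Y)) (Ncp (mT (Cm1 f)) Y)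
      = Fa (mH (Cm1 f)) (Ncp (cmE (mSrc (Cm1 f))) Y)"
    by simp
  have nat: "Cmp ?C (Fa ?L' (?\<eta>' (Fo ?R' (Fo ?F Y)))) (Fa ?L' (?m Y))
    = Cmp ?C (Fa ?L' (Fa ?R' (Fa ?L' (?m Y)))) (Fa ?L' (?\<eta>' (Fo ?G (Fo ?R Y))))"
    using arg_cong[OF adjn_naturality(1)[of "lTgt f" "?m Y", OF _ _ refl], of "Fa ?L'"] by simp
  have unit: "Cmp ?C (Fa ?L' (?m (Fo ?L (Fo ?R Y)))) (Fa ?L' (Fa ?G (?\<eta> (Fo ?R Y))))
    = Cmp ?C (Fa ?L' (Fa ?R' (?\<zeta> (Fo ?R Y)))) (Fa ?L' (?\<eta>' (Fo ?G (Fo ?R Y))))"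
    using arg_cong[OF mate_unit[OF f, of "Fo ?R Y"], of "Fa ?L'"] by simp
  have inv: "Cmp ?C (Fa ?L' (Fa ?R' (?z (Fo ?R Y)))) (Fa ?L' (Fa ?R' (?\<zeta> (Fo ?R Y))))
    = Idn ?C (Fo ?L' (Fo ?R' (Fo ?L' (Fo ?G (Fo ?R Y)))))"
    using arg_cong[OF inv_ar(4)[of ?C "?\<zeta> (Fo ?R Y)"], of "\<lambda>x. Fa ?L' (Fa ?R' x)"] by (simp del: inv_ar(4))
  have zeta: "Cmp ?C (?z (Fo ?R (Fo ?L (Fo ?R Y)))) (Fa ?F (Fa ?L (?\<eta> (Fo ?R Y)))) = Cmp ?C (Fa ?L' (Fa ?G (?\<eta> (Fo ?R Y)))) (?z (Fo ?R Y))"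
    using adj1_naturality(2)[OF f, of "?\<eta> (Fo ?R Y)"] by simp
  \<comment> \<open>The calculation starts from the longer side of the law, the one containing the
    structure map twice.\<close>
  have "Cmp ?C (Fa ?L' (Fa ?R' (Cmp ?C (Fa ?L' (?m Y)) (?z (Fo ?R Y))))) (Cmp ?C (Fa ?L' (?m (Fo ?L (Fo ?R Y))))
      (Cmp ?C (?z (Fo ?R (Fo ?L (Fo ?R Y)))) (Fa ?F (Fa ?L (?\<eta> (Fo ?R Y))))))
    = Cmp ?C (Fa ?L' (Fa ?R' (Fa ?L' (?m Y)))) (Cmp ?C (Fa ?L' (Fa ?R' (?z (Fo ?R Y)))) (Cmp ?C (Fa ?L' (Fa ?R' (?\<zeta> (Fo ?R Y))))
      (Cmp ?C (Fa ?L' (?\<eta>' (Fo ?G (Fo ?R Y)))) (?z (Fo ?R Y)))))"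
    unfolding zeta by (subst Cmp_eq_extend[OF unit]) simp_all
  also have "\<dots> = Cmp ?C (Fa ?L' (Fa ?R' (Fa ?L' (?m Y)))) (Cmp ?C (Fa ?L' (?\<eta>' (Fo ?G (Fo ?R Y)))) (?z (Fo ?R Y)))"
    by (subst Cmp_eq_extend1[OF inv]) simp_all
  also have "\<dots> = Cmp ?C (Fa ?L' (?\<eta>' (Fo ?R' (Fo ?F Y)))) (Cmp ?C (Fa ?L' (?m Y)) (?z (Fo ?R Y)))"
    by (rule sym, rule Cmp_eq_extend[OF nat]) simp_all
  finally show "Cmp (Src (cmK (mTgt (Cm1 f)))) (Ncp (cmN (mTgt (Cm1 f))) (Fo (mH (Cm1 f)) Y)) (Ncp (mT (Cm1 f)) Y) =
      Cmp (Src (cmK (mTgt (Cm1 f)))) (Fa (cmK (mTgt (Cm1 f))) (Ncp (mT (Cm1 f)) Y))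
       (Cmp (Src (cmK (mTgt (Cm1 f)))) (Ncp (mT (Cm1 f)) (Fo (cmK (mSrc (Cm1 f))) Y))
         (Fa (mH (Cm1 f)) (Ncp (cmN (mSrc (Cm1 f))) Y)))"
    by simp
qed (use f in simp_all)

lemma Cm1_id:
  "is_adjn A \<Longrightarrow> Cm1 \<lparr>lSrc = A, lTgt = A, lF = fid (Tgt (aL A)), lG = fid (Src (aL A)), lZ = nid (aL A)\<rparr>
    = \<lparr>mSrc = Cm0 A, mTgt = Cm0 A, mH = fid (Tgt (aL A)), mT = nid (aL A \<odot> aR A)\<rparr>"
  by (rule cmd1.equality) (simp_all add: mate_id)

text \<open>By \<open>mate_cmp\<close> both structure maps have the same factors up to order;
  naturality of the inverse of \<zeta>' at the mate of \<open>f\<close> exchanges the two that are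
  out of place.\<close>

lemma Cm1_cmp:
  assumes f: "is_adj1 f" and g: "is_adj1 g" and fg: "lSrc g = lTgt f"
  shows "Cm1 (adj_cmp g f) = cmd_cmp (Cm1 g) (Cm1 f)"
proof (rule cmd1.equality)
  note [simp] = f g fg
  show "mT (Cm1 (adj_cmp g f)) = mT (cmd_cmp (Cm1 g) (Cm1 f))"
  proof (rule ntr_eqI)
    fix Y assume "Y \<in> Ob (Src (Nsrc (mT (cmd_cmp (Cm1 g) (Cm1 f)))))"
    then have Y [simp]: "Y \<in> Ob (Tgt (aL (lSrc f)))" by simp
    let ?C = "Tgt (aL (lTgt g))" and ?z = "inv_ar (Tgt (aL (lTgt f))) (Ncp (lZ f) (Fo (aR (lSrc f)) Y))"
      and ?z' = "\<lambda>B. inv_ar (Tgt (aL (lTgt g))) (Ncp (lZ g) B)"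
    have "Cmp ?C (Fa (aL (lTgt g)) (Fa (lG g) (Ncp (mate f) Y)))
        (Cmp ?C (?z' (Fo (lG f) (Fo (aR (lSrc f)) Y))) (Fa (lF g) ?z))
      = Cmp ?C (?z' (Fo (aR (lTgt f)) (Fo (lF f) Y))) (Cmp ?C (Fa (lF g) (Fa (aL (lTgt f)) (Ncp (mate f) Y))) (Fa (lF g) ?z))"
      by (rule Cmp_eq_extend) (use adj1_naturality(2)[OF g, of "Ncp (mate f) Y"] in simp_all)
    then show "Ncp (mT (Cm1 (adj_cmp g f))) Y = Ncp (mT (cmd_cmp (Cm1 g) (Cm1 f))) Y"
      by (simp add: mate_cmp)
  qed simp_all
qed simp_all

text \<open>Although C forgets \<psi>, the argument passes through it: \<open>mate_adj2\<close>
  turns \<phi> into \<psi>, and \<open>adj2_law_inv\<close> turns it back into \<phi> on the other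
  side.\<close>

lemma Cm2_cmd2 [simp]:
  assumes d: "is_adj2 d"
  shows "is_cmd2 (Cm2 d)"
proof (rule cmd2I)
  note [simp] = d
  fix Y assume "Y \<in> Ob (Src (cmK (mSrc (cSrc (Cm2 d)))))"
  then have Y [simp]: "Y \<in> Ob (Tgt (aL (lSrc (dSrc d))))" by simp
  let ?C = "Tgt (aL (lTgt (dSrc d)))" and ?L' = "aL (lTgt (dSrc d))" and ?R = "aR (lSrc (dSrc d))"
    and ?R' = "aR (lTgt (dSrc d))" and ?L = "aL (lSrc (dSrc d))"
    and ?\<phi> = "Ncp (dPhi d)" and ?\<psi> = "Ncp (dPsi d)"
    and ?z = "inv_ar (Tgt (aL (lTgt (dSrc d)))) (Ncp (lZ (dSrc d)) (Fo (aR (lSrc (dSrc d))) Y))"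
    and ?z2 = "inv_ar (Tgt (aL (lTgt (dSrc d)))) (Ncp (lZ (dTgt d)) (Fo (aR (lSrc (dSrc d))) Y))"
  have "Cmp ?C (Fa ?L' (Fa ?R' (?\<phi> Y))) (Cmp ?C (Fa ?L' (Ncp (mate (dSrc d)) Y)) ?z)
    = Cmp ?C (Fa ?L' (Ncp (mate (dTgt d)) Y)) (Cmp ?C (Fa ?L' (?\<psi> (Fo ?R Y))) ?z)"
    by (rule Cmp_eq_extend) (use arg_cong[OF mate_adj2[OF d Y], of "Fa ?L'"] in simp_all)
  also have "Cmp ?C (Fa ?L' (?\<psi> (Fo ?R Y))) ?z = Cmp ?C ?z2 (?\<phi> (Fo ?L (Fo ?R Y)))"
    using adj2_law_inv[OF d, of "Fo ?R Y"] by simp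
  finally show "Cmp (Src (cmK (mTgt (cSrc (Cm2 d))))) (Fa (cmK (mTgt (cSrc (Cm2 d)))) (Ncp (cPhi (Cm2 d)) Y)) (Ncp (mT (cSrc (Cm2 d))) Y)
    = Cmp (Src (cmK (mTgt (cSrc (Cm2 d))))) (Ncp (mT (cTgt (Cm2 d))) Y) (Ncp (cPhi (Cm2 d)) (Fo (cmK (mSrc (cSrc (Cm2 d)))) Y))"
    by simp
qed (use d in simp_all)

lemma Cm_iso_sel [simp]: "F0 Cm_iso = Cm0" "F1 Cm_iso = Cm1" "F2 Cm_iso = Cm2"
  by (simp_all add: Cm_iso_def)

lemma two_functor_Cm_iso: "two_functor LAdj_iso Cmd Cm_iso"
  by (rule two_functor.intro) (auto simp: Cm1_id Cm1_cmp intro!: cmd2.equality)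

lemma closed1_LAdj_iso_ps: "closed1 LAdj_iso (\<lambda>f. nat_iso (mate f))"
  by (simp add: closed1_def mate_id mate_cmp)

text \<open>An identity \<open>lZ g\<close> has equal source and target, which forces F' L' = L'' G'
  on the nose. Without this equation the composite could not be the identity of the functor named in
  the predicate.\<close>

lemma closed1_LAdj: "closed1 LAdj_iso (\<lambda>f. lZ f = nid (aL (lTgt f) \<odot> lG f))"
proof -
  have "(lF g \<lhd> lZ f) \<bullet> (lZ g \<rhd> lG f) = nid (aL (lTgt g) \<odot> lG g \<odot> lG f)"
    if f: "is_adj1 f" and g: "is_adj1 g" and fg: "lTgt f = lSrc g"
      and zf: "lZ f = nid (aL (lTgt f) \<odot> lG f)" and zg: "lZ g = nid (aL (lTgt g) \<odot> lG g)"
    for f g :: "'a adj1"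
  proof -
    note [simp] = f g fg
    have eq: "lF g \<odot> aL (lTgt f) = aL (lTgt g) \<odot> lG g"
      using adj1D(12)[OF g] by (simp add: zg)
    have "lF g \<odot> (aL (lTgt f) \<odot> lG f) = aL (lTgt g) \<odot> lG g \<odot> lG f"
      using arg_cong[OF eq, of "\<lambda>H. H \<odot> lG f"] by simp
    then show ?thesis by (simp add: zf zg)
  qed
  then show ?thesis by (simp add: closed1_def)
qed

section \<open>Categories of coalgebras\<close>

lemma CoAlg_ob_iff [simp]:
  "Coalg A a \<in> Ob (CoAlg Q) \<longleftrightarrow> A \<in> Ob (Src (cmK Q)) \<and> a \<in> Ar (Src (cmK Q)) \<and>
    Dom (Src (cmK Q)) a = A \<and> Cod (Src (cmK Q)) a = Fo (cmK Q) A \<and>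
    Cmp (Src (cmK Q)) (Ncp (cmE Q) A) a = Idn (Src (cmK Q)) A \<and>
    Cmp (Src (cmK Q)) (Ncp (cmN Q) A) a = Cmp (Src (cmK Q)) (Fa (cmK Q) a) a"
  by (auto simp: CoAlg_def coalg_ob_def Let_def Hom_iff)

lemma coalg_ob_eq: "coalg_ob Q = Ob (CoAlg Q)" and coalg_ar_eq: "coalg_ar Q = Ar (CoAlg Q)"
  by (simp_all add: CoAlg_def Let_def)

lemma Coalg_eq [simp]: "X \<in> Ob (CoAlg Q) \<Longrightarrow> Coalg (carr X) (struct X) = X"
  by (auto simp: CoAlg_def coalg_ob_def Let_def)

lemma CoAlg_ob [simp]:
  assumes "X \<in> Ob (CoAlg Q)"
  shows "carr X \<in> Ob (Src (cmK Q))" "struct X \<in> Ar (Src (cmK Q))" "Dom (Src (cmK Q)) (struct X) = carr X"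
    "Cod (Src (cmK Q)) (struct X) = Fo (cmK Q) (carr X)"
    "Cmp (Src (cmK Q)) (Ncp (cmE Q) (carr X)) (struct X) = Idn (Src (cmK Q)) (carr X)"
    "Cmp (Src (cmK Q)) (Ncp (cmN Q) (carr X)) (struct X) = Cmp (Src (cmK Q)) (Fa (cmK Q) (struct X)) (struct X)"
  using assms CoAlg_ob_iff[of "carr X" "struct X" Q] by (simp_all del: CoAlg_ob_iff)

lemma CoAlg_ar_iff [simp]:
  "Comor X f Y \<in> Ar (CoAlg Q) \<longleftrightarrow> X \<in> Ob (CoAlg Q) \<and> Y \<in> Ob (CoAlg Q) \<and> f \<in> Ar (Src (cmK Q)) \<and>
    Dom (Src (cmK Q)) f = carr X \<and> Cod (Src (cmK Q)) f = carr Y \<and>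
    Cmp (Src (cmK Q)) (struct Y) f = Cmp (Src (cmK Q)) (Fa (cmK Q) f) (struct X)"
  by (auto simp: CoAlg_def coalg_ar_def Let_def Hom_iff)

lemma CoAlg_Dom [simp]: "Comor X f Y \<in> Ar (CoAlg Q) \<Longrightarrow> Dom (CoAlg Q) (Comor X f Y) = X"
  and CoAlg_Cod [simp]: "Comor X f Y \<in> Ar (CoAlg Q) \<Longrightarrow> Cod (CoAlg Q) (Comor X f Y) = Y"
  unfolding CoAlg_def Let_def by simp_all

lemma Comor_eq: "f \<in> Ar (CoAlg Q) \<Longrightarrow> Comor (Dom (CoAlg Q) f) (under f) (Cod (CoAlg Q) f) = f"
  by (auto simp: CoAlg_def coalg_ar_def Let_def)

lemma cdom_eq: "f \<in> Ar (CoAlg Q) \<Longrightarrow> cdom f = Dom (CoAlg Q) f" and ccod_eq: "f \<in> Ar (CoAlg Q) \<Longrightarrow> ccod f = Cod (CoAlg Q) f"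
  by (auto simp: CoAlg_def Let_def)

lemma CoAlg_ar [simp]:
  assumes "f \<in> Ar (CoAlg Q)"
  shows "Dom (CoAlg Q) f \<in> Ob (CoAlg Q)" "Cod (CoAlg Q) f \<in> Ob (CoAlg Q)"
    "under f \<in> Ar (Src (cmK Q))" "Dom (Src (cmK Q)) (under f) = carr (Dom (CoAlg Q) f)"
    "Cod (Src (cmK Q)) (under f) = carr (Cod (CoAlg Q) f)"
  using assms Comor_eq[OF assms] CoAlg_ar_iff[of "Dom (CoAlg Q) f" "under f" "Cod (CoAlg Q) f" Q]
  by (simp_all del: CoAlg_ar_iff)

lemma CoAlg_ar_law:
  assumes "f \<in> Ar (CoAlg Q)"
  shows "Cmp (Src (cmK Q)) (struct (Cod (CoAlg Q) f)) (under f)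
    = Cmp (Src (cmK Q)) (Fa (cmK Q) (under f)) (struct (Dom (CoAlg Q) f))"
  using assms Comor_eq[OF assms] CoAlg_ar_iff[of "Dom (CoAlg Q) f" "under f" "Cod (CoAlg Q) f" Q]
  by (simp del: CoAlg_ar_iff)

text \<open>Faithfulness of the forgetful functor. It is immediate because a \<open>Comor\<close>
  stores its two ends and its underlying arrow and nothing else.\<close>

lemma CoAlg_ar_eqI:
  assumes "f \<in> Ar (CoAlg Q)" "g \<in> Ar (CoAlg Q)"
    "Dom (CoAlg Q) f = Dom (CoAlg Q) g" "Cod (CoAlg Q) f = Cod (CoAlg Q) g" "under f = under g"
  shows "f = g"
  by (metis Comor_eq assms)

lemma CoAlg_Idn: "X \<in> Ob (CoAlg Q) \<Longrightarrow> Idn (CoAlg Q) X = Comor X (Idn (Src (cmK Q)) (carr X)) X"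
  by (simp add: CoAlg_def Let_def)

lemma CoAlg_Cmp:
  assumes "f \<in> Ar (CoAlg Q)" "g \<in> Ar (CoAlg Q)" "Cod (CoAlg Q) f = Dom (CoAlg Q) g"
  shows "Cmp (CoAlg Q) g f = Comor (Dom (CoAlg Q) f) (Cmp (Src (cmK Q)) (under g) (under f)) (Cod (CoAlg Q) g)"
proof -
  have "Cmp (CoAlg Q) g f = (if f \<in> coalg_ar Q \<and> g \<in> coalg_ar Q \<and> ccod f = cdom g
    then Comor (cdom f) (Cmp (Src (cmK Q)) (under g) (under f)) (ccod g) else undefined)"
    by (simp add: CoAlg_def Let_def)
  then show ?thesis using assms by (simp add: coalg_ar_eq cdom_eq ccod_eq)
qed

lemma CoAlg_category [simp]:
  assumes Q: "is_comonad Q"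
  shows "category (CoAlg Q)"
proof -
  note [simp] = Q
  have Idn: "Comor X (Idn (Src (cmK Q)) (carr X)) X \<in> Ar (CoAlg Q)" if "X \<in> Ob (CoAlg Q)" for X
    using that by simp
  have Cmp: "Comor (Dom (CoAlg Q) f) (Cmp (Src (cmK Q)) (under g) (under f)) (Cod (CoAlg Q) g) \<in> Ar (CoAlg Q)"
    if fg [simp]: "f \<in> Ar (CoAlg Q)" "g \<in> Ar (CoAlg Q)" "Cod (CoAlg Q) f = Dom (CoAlg Q) g" for f g
  proof -
    let ?C = "Src (cmK Q)"
    have "Cmp ?C (struct (Cod (CoAlg Q) g)) (Cmp ?C (under g) (under f))
      = Cmp ?C (Fa (cmK Q) (under g)) (Cmp ?C (struct (Cod (CoAlg Q) f)) (under f))"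
      using Cmp_eq_extend[OF CoAlg_ar_law[OF fg(2)], of "under f"] by simp
    also have "\<dots> = Cmp ?C (Fa (cmK Q) (under g)) (Cmp ?C (Fa (cmK Q) (under f)) (struct (Dom (CoAlg Q) f)))"
      using CoAlg_ar_law[OF fg(1)] by simp
    finally show ?thesis by simp
  qed
  show ?thesis
  proof (rule categoryI)
    fix f assume f: "f \<in> Ar (CoAlg Q)"
    show "Cmp (CoAlg Q) (Idn (CoAlg Q) (Cod (CoAlg Q) f)) f = f" "Cmp (CoAlg Q) f (Idn (CoAlg Q) (Dom (CoAlg Q) f)) = f"
      \<comment> \<open>Here and often below \<open>CoAlg_ar_iff\<close> is switched off, so that
        memberships of \<open>Comor\<close> terms are used as proved beforehand instead of being
        unfolded into component equations.\<close>
      using f Idn[of "Cod (CoAlg Q) f"] Idn[of "Dom (CoAlg Q) f"]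
      by (simp_all add: CoAlg_Cmp CoAlg_Idn Comor_eq del: CoAlg_ar_iff)
  next
    fix f g h assume fgh: "f \<in> Ar (CoAlg Q)" "g \<in> Ar (CoAlg Q)" "h \<in> Ar (CoAlg Q)"
      "Cod (CoAlg Q) f = Dom (CoAlg Q) g" "Cod (CoAlg Q) g = Dom (CoAlg Q) h"
    show "Cmp (CoAlg Q) (Cmp (CoAlg Q) h g) f = Cmp (CoAlg Q) h (Cmp (CoAlg Q) g f)"
      using fgh Cmp[of f g] Cmp[of g h] by (simp add: CoAlg_Cmp del: CoAlg_ar_iff)
  qed (use Idn Cmp in \<open>simp_all add: CoAlg_Idn CoAlg_Cmp del: CoAlg_ar_iff\<close>)
qed

text \<open>\<open>is_adjn\<close> asks for normalized categories at both ends, and this is one end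
  of every Eilenberg-Moore adjunction.\<close>

lemma CoAlg_normalized [simp]: "normalized (CoAlg Q)"
  unfolding normalized_def
proof (intro conjI allI impI)
  fix g f assume "\<not> (f \<in> Ar (CoAlg Q) \<and> g \<in> Ar (CoAlg Q) \<and> Cod (CoAlg Q) f = Dom (CoAlg Q) g)"
  moreover have "Cmp (CoAlg Q) g f = (if f \<in> coalg_ar Q \<and> g \<in> coalg_ar Q \<and> ccod f = cdom g
    then Comor (cdom f) (Cmp (Src (cmK Q)) (under g) (under f)) (ccod g) else undefined)"
    by (simp add: CoAlg_def Let_def)
  ultimately show "Cmp (CoAlg Q) g f = undefined"
    by (auto simp: coalg_ar_eq cdom_eq ccod_eq)
qed (simp_all add: CoAlg_def Let_def)

lemma under_Idn [simp]: "X \<in> Ob (CoAlg Q) \<Longrightarrow> under (Idn (CoAlg Q) X) = Idn (Src (cmK Q)) (carr X)"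
  by (simp add: CoAlg_Idn)

lemma under_Cmp [simp]:
  "f \<in> Ar (CoAlg Q) \<Longrightarrow> g \<in> Ar (CoAlg Q) \<Longrightarrow> Cod (CoAlg Q) f = Dom (CoAlg Q) g \<Longrightarrow>
    under (Cmp (CoAlg Q) g f) = Cmp (Src (cmK Q)) (under g) (under f)"
  by (simp add: CoAlg_Cmp)

text \<open>The forgetful functor reflects isomorphisms: conjugating the morphism condition by the
  inverse of the underlying arrow gives the morphism condition for this inverse. Invertibility of
  mates and of the unit 2-cells is thereby reduced to the base category.\<close>

lemma coalg_iso:
  assumes Q: "is_comonad Q" and f: "f \<in> Ar (CoAlg Q)" and iso: "iso_ar (Src (cmK Q)) (under f)"
  shows "iso_ar (CoAlg Q) f" "under (inv_ar (CoAlg Q) f) = inv_ar (Src (cmK Q)) (under f)"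
proof -
  note [simp] = Q f iso
  let ?C = "Src (cmK Q)" and ?X = "Dom (CoAlg Q) f" and ?Y = "Cod (CoAlg Q) f"
  let ?g = "inv_ar ?C (under f)"
  have "Cmp ?C (struct ?X) ?g = Cmp ?C (Fa (cmK Q) ?g) (Cmp ?C (Cmp ?C (Fa (cmK Q) (under f)) (struct ?X)) ?g)"
    using arg_cong[OF inv_ar(4)[of ?C "under f"], of "Fa (cmK Q)"]
    by (simp del: inv_ar(4) flip: Cmp_assoc)
  also have "\<dots> = Cmp ?C (Fa (cmK Q) ?g) (struct ?Y)"
    by (subst CoAlg_ar_law[symmetric]) simp_all
  finally have g: "Comor ?Y ?g ?X \<in> Ar (CoAlg Q)"
    by simp
  note g' [simp] = CoAlg_Dom[OF g] CoAlg_Cod[OF g]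
  have "Cmp (CoAlg Q) (Comor ?Y ?g ?X) f = Idn (CoAlg Q) ?X" "Cmp (CoAlg Q) f (Comor ?Y ?g ?X) = Idn (CoAlg Q) ?Y"
    by - (rule CoAlg_ar_eqI[of _ Q]; use g in \<open>simp del: CoAlg_ar_iff\<close>)+
  then show "iso_ar (CoAlg Q) f" "under (inv_ar (CoAlg Q) f) = inv_ar (Src (cmK Q)) (under f)"
    using iso_arI[of "CoAlg Q" f "Comor ?Y ?g ?X"] g by (simp_all del: CoAlg_ar_iff)
qed

section \<open>Eilenberg-Moore adjunctions\<close>

lemma EM_U_sel [simp]: "Src (EM_U Q) = CoAlg Q" "Tgt (EM_U Q) = Src (cmK Q)"
  "X \<in> Ob (CoAlg Q) \<Longrightarrow> Fo (EM_U Q) X = carr X" "f \<in> Ar (CoAlg Q) \<Longrightarrow> Fa (EM_U Q) f = under f"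
  by (simp_all add: EM_U_def coalg_ob_eq coalg_ar_eq)

lemma EM_U_functor [simp]: "is_comonad Q \<Longrightarrow> is_functor (EM_U Q)"
  by (rule is_functorI) (simp_all, simp_all add: EM_U_def coalg_ob_eq coalg_ar_eq)

lemma cofree_sel [simp]: "carr (cofree Q A) = Fo (cmK Q) A" "struct (cofree Q A) = Ncp (cmN Q) A"
  by (simp_all add: cofree_def)

lemma cofree_ob [simp]: "is_comonad Q \<Longrightarrow> A \<in> Ob (Src (cmK Q)) \<Longrightarrow> cofree Q A \<in> Ob (CoAlg Q)"
  by (simp add: cofree_def comonad_laws)

lemma EM_R_sel [simp]: "Src (EM_R Q) = Src (cmK Q)" "Tgt (EM_R Q) = CoAlg Q"
  "A \<in> Ob (Src (cmK Q)) \<Longrightarrow> Fo (EM_R Q) A = cofree Q A"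
  "f \<in> Ar (Src (cmK Q)) \<Longrightarrow> Fa (EM_R Q) f
    = Comor (cofree Q (Dom (Src (cmK Q)) f)) (Fa (cmK Q) f) (cofree Q (Cod (Src (cmK Q)) f))"
  by (simp_all add: EM_R_def Let_def)

lemma EM_R_functor [simp]:
  assumes "is_comonad Q"
  shows "is_functor (EM_R Q)"
proof (rule is_functorI)
  note [simp] = assms comonad_naturality(2)
  fix f g assume "f \<in> Ar (Src (EM_R Q))" "g \<in> Ar (Src (EM_R Q))" "Cod (Src (EM_R Q)) f = Dom (Src (EM_R Q)) g"
  then show "Fa (EM_R Q) (Cmp (Src (EM_R Q)) g f) = Cmp (Tgt (EM_R Q)) (Fa (EM_R Q) g) (Fa (EM_R Q) f)"
    by (simp add: CoAlg_Cmp)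
qed (use assms in \<open>simp_all add: comonad_naturality(2) CoAlg_Idn\<close>, simp_all add: EM_R_def Let_def)

lemma EM_UR [simp]: "is_comonad Q \<Longrightarrow> EM_U Q \<odot> EM_R Q = cmK Q"
  by (rule ftr_eqI) (simp_all add: comonad_naturality(2))

lemma EM0_sel [simp]: "aL (EM0 Q) = EM_U Q" "aR (EM0 Q) = EM_R Q" "aEps (EM0 Q) = cmE Q"
  "Nsrc (aEta (EM0 Q)) = fid (CoAlg Q)" "Ntgt (aEta (EM0 Q)) = EM_R Q \<odot> EM_U Q"
  "X \<in> Ob (CoAlg Q) \<Longrightarrow> Ncp (aEta (EM0 Q)) X = Comor X (struct X) (cofree Q (carr X))"
  by (simp_all add: EM0_def coalg_ob_eq)

lemma EM0_unit_nat [simp]: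
  assumes Q: "is_comonad Q"
  shows "nat_trans (aEta (EM0 Q))"
proof (rule nat_transI)
  note [simp] = Q comonad_naturality(2)
  fix f assume "f \<in> Ar (Src (Nsrc (aEta (EM0 Q))))"
  then have f [simp]: "f \<in> Ar (CoAlg Q)" by simp
  show "Cmp (Tgt (Nsrc (aEta (EM0 Q)))) (Ncp (aEta (EM0 Q)) (Cod (Src (Nsrc (aEta (EM0 Q)))) f)) (Fa (Nsrc (aEta (EM0 Q))) f)
    = Cmp (Tgt (Nsrc (aEta (EM0 Q)))) (Fa (Ntgt (aEta (EM0 Q))) f) (Ncp (aEta (EM0 Q)) (Dom (Src (Nsrc (aEta (EM0 Q)))) f))"
    by (simp add: CoAlg_Cmp CoAlg_ar_law)
qed (use Q in \<open>simp_all\<close>, simp_all add: EM0_def coalg_ob_eq)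

text \<open>One triangle identity is the counit axiom of a coalgebra, the other is the first counit
  law of the comonad.\<close>

lemma EM0_adjn [simp]:
  assumes Q: "is_comonad Q"
  shows "is_adjn (EM0 Q)"
proof -
  have "normalized (Src (cmK Q))"
    using Q unfolding is_comonad_def Let_def by blast
  then show ?thesis
    by (intro adjnI) (use Q in \<open>simp_all add: comonad_naturality(2) comonad_laws CoAlg_Cmp CoAlg_Idn\<close>)
qed

text \<open>The unit at a cofree coalgebra is its structure map, which is the comultiplication; so
  whiskering the unit by both functors gives back \<open>cmN Q\<close>.\<close>

lemma Cm0_EM0 [simp]:
  assumes Q: "is_comonad Q"
  shows "Cm0 (EM0 Q) = Q"
proof (rule comonad.equality)
  show "cmN (Cm0 (EM0 Q)) = cmN Q"
    using Q fcmp_assoc[of "cmK Q" "EM_R Q" "EM_U Q"] by (intro ntr_eqI) (simp_all add: comonad_laws)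
qed (use Q in simp_all)

section \<open>The functor between coalgebras induced by a comonad morphism\<close>

lemma coalg_map_sel [simp]: "carr (coalg_map m X) = Fo (mH m) (carr X)"
  "struct (coalg_map m X) = Cmp (Tgt (mH m)) (Ncp (mT m) (carr X)) (Fa (mH m) (struct X))"
  by (simp_all add: coalg_map_def)

text \<open>Each axiom of a comonad morphism supplies one axiom of the new coalgebra.
  Coassociativity also uses naturality of \<theta> at the old structure map.\<close>

lemma coalg_map_ob [simp]:
  assumes m: "is_cmd1 m" and X: "X \<in> Ob (CoAlg (mSrc m))" and Q: "mTgt m = Q"
  shows "coalg_map m X \<in> Ob (CoAlg Q)"
proof -
  note [simp] = m X Q[symmetric]
  let ?C = "Src (cmK (mTgt m))" and ?H = "mH m" and ?\<theta> = "Ncp (mT m)" and ?K = "cmK (mSrc m)" and ?K' = "cmK (mTgt m)"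
    and ?A = "carr X" and ?a = "struct X"
  have counit: "Cmp ?C (Ncp (cmE (mTgt m)) (Fo ?H ?A)) (Cmp ?C (?\<theta> ?A) (Fa ?H ?a)) = Idn ?C (Fo ?H ?A)"
    using arg_cong[OF CoAlg_ob(5)[OF X], of "Fa ?H"]
    by (subst Cmp_eq_extend1[OF cmd1_laws(1)[OF m, of ?A]]) (simp_all del: CoAlg_ob(5))
  have nat: "Cmp ?C (?\<theta> (Fo ?K ?A)) (Fa ?H (Fa ?K ?a)) = Cmp ?C (Fa ?K' (Fa ?H ?a)) (?\<theta> ?A)"
    using cmd1_naturality[OF m, of ?a] by simp
  have coassoc: "Cmp ?C (Fa ?H (Ncp (cmN (mSrc m)) ?A)) (Fa ?H ?a) = Cmp ?C (Fa ?H (Fa ?K ?a)) (Fa ?H ?a)"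
    using arg_cong[OF CoAlg_ob(6)[OF X], of "Fa ?H"] by (simp del: CoAlg_ob(6))
  have "Cmp ?C (Ncp (cmN (mTgt m)) (Fo ?H ?A)) (Cmp ?C (?\<theta> ?A) (Fa ?H ?a))
    = Cmp ?C (Fa ?K' (?\<theta> ?A)) (Cmp ?C (?\<theta> (Fo ?K ?A)) (Cmp ?C (Fa ?H (Fa ?K ?a)) (Fa ?H ?a)))"
    by (subst Cmp_eq_extend1[OF cmd1_laws(2)[OF m, of ?A]]) (simp_all add: coassoc)
  also have "\<dots> = Cmp ?C (Fa ?K' (Cmp ?C (?\<theta> ?A) (Fa ?H ?a))) (Cmp ?C (?\<theta> ?A) (Fa ?H ?a))"
    by (subst Cmp_eq_extend[OF nat]) simp_all
  finally show ?thesis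
    using counit by (simp add: coalg_map_def)
qed

lemma CoAlg1_sel [simp]: "Src (CoAlg1 m) = CoAlg (mSrc m)" "Tgt (CoAlg1 m) = CoAlg (mTgt m)"
  "X \<in> Ob (CoAlg (mSrc m)) \<Longrightarrow> Fo (CoAlg1 m) X = coalg_map m X"
  "f \<in> Ar (CoAlg (mSrc m)) \<Longrightarrow> Fa (CoAlg1 m) f
    = Comor (coalg_map m (Dom (CoAlg (mSrc m)) f)) (Fa (mH m) (under f)) (coalg_map m (Cod (CoAlg (mSrc m)) f))"
  by (simp_all add: CoAlg1_def coalg_ob_eq coalg_ar_eq cdom_eq ccod_eq)

lemma CoAlg1_ar [simp]:
  assumes m: "is_cmd1 m" and f: "f \<in> Ar (CoAlg (mSrc m))" and Q: "mTgt m = Q"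
  shows "Comor (coalg_map m (Dom (CoAlg (mSrc m)) f)) (Fa (mH m) (under f)) (coalg_map m (Cod (CoAlg (mSrc m)) f))
    \<in> Ar (CoAlg Q)"
proof -
  note [simp] = m f Q[symmetric]
  let ?C = "Src (cmK (mTgt m))" and ?X = "Dom (CoAlg (mSrc m)) f" and ?Y = "Cod (CoAlg (mSrc m)) f"
    and ?H = "mH m" and ?\<theta> = "Ncp (mT m)" and ?K = "cmK (mSrc m)" and ?K' = "cmK (mTgt m)"
  have nat: "Cmp ?C (?\<theta> (carr ?Y)) (Fa ?H (Fa ?K (under f))) = Cmp ?C (Fa ?K' (Fa ?H (under f))) (?\<theta> (carr ?X))"
    using cmd1_naturality[OF m, of "under f"] by simp
  have "Cmp ?C (Cmp ?C (?\<theta> (carr ?Y)) (Fa ?H (struct ?Y))) (Fa ?H (under f))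
    = Cmp ?C (?\<theta> (carr ?Y)) (Cmp ?C (Fa ?H (Fa ?K (under f))) (Fa ?H (struct ?X)))"
    using arg_cong[OF CoAlg_ar_law[OF f], of "Fa ?H"] by simp
  also have "\<dots> = Cmp ?C (Fa ?K' (Fa ?H (under f))) (Cmp ?C (?\<theta> (carr ?X)) (Fa ?H (struct ?X)))"
    by (rule Cmp_eq_extend[OF nat]) simp_all
  finally show ?thesis by simp
qed

lemma CoAlg1_functor [simp]:
  assumes m: "is_cmd1 m"
  shows "is_functor (CoAlg1 m)"
proof (rule is_functorI)
  note [simp] = m
  note [simp del] = CoAlg_ar_iff
  fix f g assume fg: "f \<in> Ar (Src (CoAlg1 m))" "g \<in> Ar (Src (CoAlg1 m))" "Cod (Src (CoAlg1 m)) f = Dom (Src (CoAlg1 m)) g"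
  then have "f \<in> Ar (CoAlg (mSrc m))" "g \<in> Ar (CoAlg (mSrc m))" "Cod (CoAlg (mSrc m)) f = Dom (CoAlg (mSrc m)) g"
    by simp_all
  then show "Fa (CoAlg1 m) (Cmp (Src (CoAlg1 m)) g f) = Cmp (Tgt (CoAlg1 m)) (Fa (CoAlg1 m) g) (Fa (CoAlg1 m) f)"
    using CoAlg1_ar[OF m _ refl, of f] CoAlg1_ar[OF m _ refl, of g]
    by (simp add: CoAlg_Cmp[of _ "mTgt m"])
qed (use m in \<open>simp_all add: CoAlg_Idn del: CoAlg_ar_iff\<close>, simp_all add: CoAlg1_def coalg_ob_eq coalg_ar_eq)

text \<open>This strict commutation makes the identity a legitimate value of
  \<open>lZ (EM1 m)\<close>, so that EM lands in \<open>LAdj\<close>.\<close>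

lemma EM_U_CoAlg1: "is_cmd1 m \<Longrightarrow> EM_U (mTgt m) \<odot> CoAlg1 m = mH m \<odot> EM_U (mSrc m)"
  by (rule ftr_eqI) (simp_all del: CoAlg_ar_iff)

lemma EM1_sel [simp]: "lSrc (EM1 m) = EM0 (mSrc m)" "lTgt (EM1 m) = EM0 (mTgt m)" "lF (EM1 m) = mH m"
  "lG (EM1 m) = CoAlg1 m" "lZ (EM1 m) = nid (EM_U (mTgt m) \<odot> CoAlg1 m)"
  by (simp_all add: EM1_def)

lemma EM1_adj1 [simp]: "is_cmd1 m \<Longrightarrow> is_adj1 (EM1 m)"
  by (rule adj1I) (simp_all add: EM_U_CoAlg1)

text \<open>The mate unfolds to K' H \<epsilon> after \<theta> K after H \<nu>. Naturality of
  \<theta> at \<epsilon> moves it to the front, and a counit law of the source comonad cancels the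
  rest.\<close>

lemma under_mate_EM1:
  assumes m: "is_cmd1 m" and A: "A \<in> Ob (Src (cmK (mSrc m)))"
  shows "under (Ncp (mate (EM1 m)) A) = Ncp (mT m) A"
proof -
  note [simp] = m A
  let ?C = "Src (cmK (mTgt m))" and ?H = "mH m" and ?\<theta> = "Ncp (mT m)" and ?K = "cmK (mSrc m)" and ?K' = "cmK (mTgt m)"
    and ?\<epsilon> = "Ncp (cmE (mSrc m)) A" and ?\<nu> = "Ncp (cmN (mSrc m)) A"
  have nat: "Cmp ?C (Fa ?K' (Fa ?H ?\<epsilon>)) (?\<theta> (Fo ?K A)) = Cmp ?C (?\<theta> A) (Fa ?H (Fa ?K ?\<epsilon>))"
    using cmd1_naturality[OF m, of ?\<epsilon>] by simp
  have counit: "Cmp ?C (Fa ?H (Fa ?K ?\<epsilon>)) (Fa ?H ?\<nu>) = Idn ?C (Fo ?H (Fo ?K A))"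
    using arg_cong[OF comonad_laws(1)[of "mSrc m" A], of "Fa ?H"] by simp
  have "Cmp ?C (Fa ?K' (Fa ?H ?\<epsilon>)) (Cmp ?C (?\<theta> (Fo ?K A)) (Fa ?H ?\<nu>)) = ?\<theta> A"
    by (subst Cmp_eq_extend[OF nat]) (simp_all add: counit)
  then show ?thesis
    \<comment> \<open>Coassociativity of the image of the cofree coalgebra certifies the unit
      component in the mate as an arrow of \<open>CoAlg\<close>.\<close>
    using CoAlg_ob(6)[of "coalg_map m (cofree (mSrc m) A)" "mTgt m"]
    by (simp add: mate_sel(4) comonad_naturality(2) CoAlg_Idn)
qed

lemma EM_mate_pseudo:
  assumes m: "is_cmd1 m" and iso: "nat_iso (mT m)"
  shows "nat_iso (mate (EM1 m))"
proof (rule nat_isoI)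
  note [simp] = m iso
  show "nat_trans (mate (EM1 m))" by simp
  fix A assume "A \<in> Ob (Src (Nsrc (mate (EM1 m))))"
  then have A [simp]: "A \<in> Ob (Src (cmK (mSrc m)))" by simp
  have "iso_ar (CoAlg (mTgt m)) (Ncp (mate (EM1 m)) A)"
    by (rule coalg_iso(1)) (use mate_ar(1)[of "EM1 m" A] in \<open>simp_all add: under_mate_EM1\<close>)
  then show "iso_ar (Tgt (Nsrc (mate (EM1 m)))) (Ncp (mate (EM1 m)) A)" by simp
qed

lemma Cm1_EM1 [simp]:
  assumes m: "is_cmd1 m"
  shows "Cm1 (EM1 m) = m"
proof (rule cmd1.equality)
  show "mT (Cm1 (EM1 m)) = mT m"
  proof (rule ntr_eqI)
    note [simp] = m
    \<comment> \<open>Right-nesting separates \<open>EM_U\<close> from the functor following it, so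
      the strict equations \<open>EM_U_CoAlg1\<close> and \<open>EM_UR\<close> are composed with the
      third functor beforehand.\<close>
    have assoc: "EM_U (mTgt m) \<odot> CoAlg1 m \<odot> EM_R (mSrc m) = mH m \<odot> cmK (mSrc m)"
      using arg_cong[OF EM_U_CoAlg1[OF m], of "\<lambda>F. F \<odot> EM_R (mSrc m)"] by simp
    have assoc': "EM_U (mTgt m) \<odot> EM_R (mTgt m) \<odot> mH m = cmK (mTgt m) \<odot> mH m"
      using fcmp_assoc[of "mH m" "EM_R (mTgt m)" "EM_U (mTgt m)"] by simp
    show "nat_trans (mT (Cm1 (EM1 m)))" using Cm1_cmd1[of "EM1 m"] cmd1D(6) EM1_adj1 m by blast
    show "Nsrc (mT (Cm1 (EM1 m))) = Nsrc (mT m)" "Ntgt (mT (Cm1 (EM1 m))) = Ntgt (mT m)"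
      using assoc assoc' by (simp_all add: EM_U_CoAlg1)
    fix A assume "A \<in> Ob (Src (Nsrc (mT m)))"
    then have A [simp]: "A \<in> Ob (Src (cmK (mSrc m)))" by simp
    have [simp]: "Ncp (mate (EM1 m)) A \<in> Ar (CoAlg (mTgt m))"
      using mate_ar(1)[of "EM1 m" A] by simp
    show "Ncp (mT (Cm1 (EM1 m))) A = Ncp (mT m) A"
      by (simp add: under_mate_EM1)
  qed (use m in simp_all)
qed (use m in simp_all)

section \<open>Transformations between coalgebra functors, and 2-functoriality of EM\<close>

lemma CoAlg2_sel [simp]: "Nsrc (CoAlg2 c) = CoAlg1 (cSrc c)" "Ntgt (CoAlg2 c) = CoAlg1 (cTgt c)"
  "X \<in> Ob (CoAlg (mSrc (cSrc c))) \<Longrightarrow>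
    Ncp (CoAlg2 c) X = Comor (coalg_map (cSrc c) X) (Ncp (cPhi c) (carr X)) (coalg_map (cTgt c) X)"
  by (simp_all add: CoAlg2_def coalg_ob_eq)

lemma CoAlg2_ar [simp]:
  assumes c: "is_cmd2 c" and X: "X \<in> Ob (CoAlg (mSrc (cSrc c)))" and Q: "mTgt (cSrc c) = Q"
  shows "Comor (coalg_map (cSrc c) X) (Ncp (cPhi c) (carr X)) (coalg_map (cTgt c) X) \<in> Ar (CoAlg Q)"
proof -
  note [simp] = c X Q[symmetric]
  let ?C = "Src (cmK (mTgt (cSrc c)))" and ?A = "carr X" and ?a = "struct X" and ?K = "cmK (mSrc (cSrc c))"
    and ?K' = "cmK (mTgt (cSrc c))"
    and ?H = "mH (cSrc c)" and ?G = "mH (cTgt c)" and ?\<phi> = "Ncp (cPhi c)"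
  have nat: "Cmp ?C (?\<phi> (Fo ?K ?A)) (Fa ?H ?a) = Cmp ?C (Fa ?G ?a) (?\<phi> ?A)"
    using cmd2_naturality[OF c, of ?a] by simp
  have "Cmp ?C (Fa ?K' (?\<phi> ?A)) (Cmp ?C (Ncp (mT (cSrc c)) ?A) (Fa ?H ?a))
    = Cmp ?C (Ncp (mT (cTgt c)) ?A) (Cmp ?C (?\<phi> (Fo ?K ?A)) (Fa ?H ?a))"
    by (rule Cmp_eq_extend) (use cmd2_law[OF c, of ?A] in simp_all)
  then show ?thesis by (simp add: nat)
qed

lemma CoAlg2_nat [simp]:
  assumes c: "is_cmd2 c"
  shows "nat_trans (CoAlg2 c)"
proof (rule nat_transI)
  note [simp] = c
  note [simp del] = CoAlg_ar_iff
  fix f assume "f \<in> Ar (Src (Nsrc (CoAlg2 c)))"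
  then have f [simp]: "f \<in> Ar (CoAlg (mSrc (cSrc c)))" by simp
  have [simp]: "Comor (coalg_map (cTgt c) (Dom (CoAlg (mSrc (cSrc c))) f)) (Fa (mH (cTgt c)) (under f))
      (coalg_map (cTgt c) (Cod (CoAlg (mSrc (cSrc c))) f)) \<in> Ar (CoAlg (mTgt (cSrc c)))"
    using CoAlg1_ar[of "cTgt c" f "mTgt (cSrc c)"] by simp
  show "Cmp (Tgt (Nsrc (CoAlg2 c))) (Ncp (CoAlg2 c) (Cod (Src (Nsrc (CoAlg2 c))) f)) (Fa (Nsrc (CoAlg2 c)) f)
    = Cmp (Tgt (Nsrc (CoAlg2 c))) (Fa (Ntgt (CoAlg2 c)) f) (Ncp (CoAlg2 c) (Dom (Src (Nsrc (CoAlg2 c))) f))"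
    using cmd2_naturality[OF c, of "under f"] by (simp add: CoAlg_Cmp[of _ "mTgt (cSrc c)"])
qed (use c in \<open>simp_all del: CoAlg_ar_iff\<close>, simp_all add: CoAlg2_def coalg_ob_eq)

lemma EM2_sel [simp]: "dSrc (EM2 c) = EM1 (cSrc c)" "dTgt (EM2 c) = EM1 (cTgt c)" "dPhi (EM2 c) = cPhi c"
  "dPsi (EM2 c) = CoAlg2 c"
  by (simp_all add: EM2_def)

lemma EM2_adj2 [simp]: "is_cmd2 c \<Longrightarrow> is_adj2 (EM2 c)"
  by (rule adj2I) (simp_all del: CoAlg_ar_iff)

lemma Cm2_EM2 [simp]: "is_cmd2 c \<Longrightarrow> Cm2 (EM2 c) = c"
  by (rule cmd2.equality) simp_all

lemma CoAlg1_id: "is_comonad Q \<Longrightarrow>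
    CoAlg1 \<lparr>mSrc = Q, mTgt = Q, mH = fid (Src (cmK Q)), mT = nid (cmK Q)\<rparr> = fid (CoAlg Q)"
proof (rule ftr_eqI)
  assume Q [simp]: "is_comonad Q"
  let ?m = "\<lparr>mSrc = Q, mTgt = Q, mH = fid (Src (cmK Q)), mT = nid (cmK Q)\<rparr>"
  have map: "coalg_map ?m X = X" if "X \<in> Ob (CoAlg Q)" for X
    using that by (simp add: coalg_map_def)
  show "Fo (CoAlg1 ?m) X = Fo (fid (CoAlg Q)) X" if "X \<in> Ob (Src (fid (CoAlg Q)))" for X
    using that by (simp add: map)
  show "Fa (CoAlg1 ?m) f = Fa (fid (CoAlg Q)) f" if "f \<in> Ar (Src (fid (CoAlg Q)))" for f
    using that by (simp add: map Comor_eq)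
qed simp_all

lemma coalg_map_cmp:
  assumes "is_cmd1 m" "is_cmd1 n" "mSrc n = mTgt m" "X \<in> Ob (CoAlg (mSrc m))"
  shows "coalg_map (cmd_cmp n m) X = coalg_map n (coalg_map m X)"
  using assms by (simp add: coalg_map_def)

lemma CoAlg1_cmp:
  assumes m: "is_cmd1 m" and n: "is_cmd1 n" and mn: "mSrc n = mTgt m"
  shows "CoAlg1 (cmd_cmp n m) = CoAlg1 n \<odot> CoAlg1 m"
proof (rule ftr_eqI)
  note [simp] = m n mn
  show "Fa (CoAlg1 (cmd_cmp n m)) f = Fa (CoAlg1 n \<odot> CoAlg1 m) f" if "f \<in> Ar (Src (CoAlg1 n \<odot> CoAlg1 m))" for f
    using that by (simp add: coalg_map_cmp del: CoAlg_ar_iff)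
qed (use assms in \<open>simp_all add: coalg_map_cmp\<close>)

lemma EM1_cmp:
  assumes m: "is_cmd1 m" and n: "is_cmd1 n" and mn: "mSrc n = mTgt m"
  shows "EM1 (cmd_cmp n m) = adj_cmp (EM1 n) (EM1 m)"
proof (rule adj1.equality)
  note [simp] = m n mn
  have "mH n \<odot> EM_U (mTgt m) = EM_U (mTgt n) \<odot> CoAlg1 n"
    using EM_U_CoAlg1[OF n] by simp
  from arg_cong[OF this, of "\<lambda>F. F \<odot> CoAlg1 m"]
  have "mH n \<odot> EM_U (mTgt m) \<odot> CoAlg1 m = EM_U (mTgt n) \<odot> CoAlg1 n \<odot> CoAlg1 m"
    by simp
  then show "lZ (EM1 (cmd_cmp n m)) = lZ (adj_cmp (EM1 n) (EM1 m))"
    by (simp add: CoAlg1_cmp)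
qed (use assms in \<open>simp_all add: CoAlg1_cmp\<close>)

lemma EM1_id: "is_comonad Q \<Longrightarrow> EM1 \<lparr>mSrc = Q, mTgt = Q, mH = fid (Src (cmK Q)), mT = nid (cmK Q)\<rparr>
    = \<lparr>lSrc = EM0 Q, lTgt = EM0 Q, lF = fid (Src (cmK Q)), lG = fid (CoAlg Q), lZ = nid (EM_U Q)\<rparr>"
  by (rule adj1.equality) (simp_all add: CoAlg1_id)

lemma CoAlg2_id:
  assumes m: "is_cmd1 m"
  shows "CoAlg2 \<lparr>cSrc = m, cTgt = m, cPhi = nid (mH m)\<rparr> = nid (CoAlg1 m)"
proof (rule ntr_eqI)
  note [simp] = m
  fix X assume "X \<in> Ob (Src (Nsrc (nid (CoAlg1 m))))"
  then show "Ncp (CoAlg2 \<lparr>cSrc = m, cTgt = m, cPhi = nid (mH m)\<rparr>) X = Ncp (nid (CoAlg1 m)) X"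
    by (simp add: CoAlg_Idn)
qed (use m in simp_all)

lemma CoAlg2_vcmp:
  assumes c: "is_cmd2 c" and d: "is_cmd2 d" and cd: "cSrc d = cTgt c"
  shows "CoAlg2 \<lparr>cSrc = cSrc c, cTgt = cTgt d, cPhi = cPhi d \<bullet> cPhi c\<rparr> = CoAlg2 d \<bullet> CoAlg2 c"
proof (rule ntr_eqI)
  note [simp] = c d cd
  fix X assume "X \<in> Ob (Src (Nsrc (CoAlg2 d \<bullet> CoAlg2 c)))"
  then have X [simp]: "X \<in> Ob (CoAlg (mSrc (cSrc c)))" by simp
  have [simp]: "Comor (coalg_map (cTgt c) X) (Ncp (cPhi d) (carr X)) (coalg_map (cTgt d) X) \<in> Ar (CoAlg (mTgt (cSrc c)))"
    using CoAlg2_ar[OF d, of X "mTgt (cSrc c)"] by (simp del: CoAlg_ar_iff CoAlg2_ar)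
  show "Ncp (CoAlg2 \<lparr>cSrc = cSrc c, cTgt = cTgt d, cPhi = cPhi d \<bullet> cPhi c\<rparr>) X = Ncp (CoAlg2 d \<bullet> CoAlg2 c) X"
    by (simp add: CoAlg_Cmp[of _ "mTgt (cSrc c)"] del: CoAlg_ar_iff)
qed (use c d cd in simp_all)

lemma CoAlg2_hcmp:
  assumes c: "is_cmd2 c" and d: "is_cmd2 d" and cd: "mSrc (cSrc d) = mTgt (cSrc c)"
  shows "CoAlg2 \<lparr>cSrc = cmd_cmp (cSrc d) (cSrc c), cTgt = cmd_cmp (cTgt d) (cTgt c), cPhi = nhcmp (cPhi d) (cPhi c)\<rparr>
    = nhcmp (CoAlg2 d) (CoAlg2 c)"
proof (rule ntr_eqI)
  note [simp] = c d cd
  note [simp del] = CoAlg_ar_iff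
  fix X assume "X \<in> Ob (Src (Nsrc (nhcmp (CoAlg2 d) (CoAlg2 c))))"
  then have X [simp]: "X \<in> Ob (CoAlg (mSrc (cSrc c)))" by simp
  let ?x = "Comor (coalg_map (cSrc c) X) (Ncp (cPhi c) (carr X)) (coalg_map (cTgt c) X)"
  have x [simp]: "?x \<in> Ar (CoAlg (mTgt (cSrc c)))"
    by simp
  have [simp]: "Comor (coalg_map (cSrc d) (coalg_map (cSrc c) X)) (Fa (mH (cSrc d)) (Ncp (cPhi c) (carr X)))
      (coalg_map (cSrc d) (coalg_map (cTgt c) X)) \<in> Ar (CoAlg (mTgt (cSrc d)))"
    using CoAlg1_ar[of "cSrc d" ?x, OF _ _ refl] by simp
  have Y [simp]: "coalg_map (cTgt c) X \<in> Ob (CoAlg (mTgt (cSrc c)))"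
    by simp
  have [simp]: "Comor (coalg_map (cSrc d) (coalg_map (cTgt c) X)) (Ncp (cPhi d) (Fo (mH (cTgt c)) (carr X)))
      (coalg_map (cTgt d) (coalg_map (cTgt c) X)) \<in> Ar (CoAlg (mTgt (cSrc d)))"
    using CoAlg2_ar[OF d, of "coalg_map (cTgt c) X", OF _ refl] by simp
  show "Ncp (CoAlg2 \<lparr>cSrc = cmd_cmp (cSrc d) (cSrc c), cTgt = cmd_cmp (cTgt d) (cTgt c),
      cPhi = nhcmp (cPhi d) (cPhi c)\<rparr>) X = Ncp (nhcmp (CoAlg2 d) (CoAlg2 c)) X"
    by (simp add: CoAlg_Cmp[of _ "mTgt (cSrc d)"] coalg_map_cmp)
qed (use assms in \<open>simp_all add: CoAlg1_cmp\<close>)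

lemma EM_iso_sel [simp]: "F0 EM_iso = EM0" "F1 EM_iso = EM1" "F2 EM_iso = EM2"
  by (auto simp: EM_iso_def EM_def incl_def)

lemma two_functor_EM_iso: "two_functor (Cmd :: 'u univ cmd_cat2) LAdj_iso EM_iso"
proof (rule two_functor.intro)
  fix m :: "'u univ cmd1" assume m: "m \<in> C1 Cmd"
  show "F2 EM_iso (id2 Cmd m) = id2 LAdj_iso (F1 EM_iso m)"
    by (rule adj2.equality) (use m in \<open>simp_all add: CoAlg2_id\<close>)
next
  fix c d :: "'u univ cmd2" assume "c \<in> C2 Cmd" "d \<in> C2 Cmd" "tgt2 Cmd c = src2 Cmd d"
  then show "F2 EM_iso (vcmp Cmd d c) = vcmp LAdj_iso (F2 EM_iso d) (F2 EM_iso c)"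
    by (intro adj2.equality) (simp_all add: CoAlg2_vcmp)
next
  fix c d :: "'u univ cmd2" assume "c \<in> C2 Cmd" "d \<in> C2 Cmd" "tgt1 Cmd (src2 Cmd c) = src1 Cmd (src2 Cmd d)"
  then show "F2 EM_iso (hcmp Cmd d c) = hcmp LAdj_iso (F2 EM_iso d) (F2 EM_iso c)"
    by (intro adj2.equality) (simp_all add: CoAlg2_hcmp EM1_cmp)
qed (simp_all add: EM1_id EM1_cmp)

section \<open>The unit\<close>

text \<open>Since the forgetful functor is faithful, a 2-cell into an Eilenberg-Moore adjunction is determined
  by its first component; this reduces all equations for the unit to equations between identities.\<close>

lemma adj2_eqI_EM:
  assumes d: "is_adj2 d" and e: "is_adj2 e" and Q: "lTgt (dSrc e) = EM0 Q" "is_comonad Q"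
    and eq: "dSrc d = dSrc e" "dTgt d = dTgt e" "dPhi d = dPhi e"
  shows "d = e"
proof (rule adj2.equality)
  note [simp] = d e Q eq
  show "dPsi d = dPsi e"
  proof (rule ntr_eqI)
    fix B assume "B \<in> Ob (Src (Nsrc (dPsi e)))"
    then have B [simp]: "B \<in> Ob (Src (aL (lSrc (dSrc e))))" by simp
    let ?C = "Src (cmK Q)" and ?z = "Ncp (lZ (dTgt e)) B"
    have iso [simp]: "iso_ar ?C ?z" by simp
    have [simp]: "Cod (CoAlg Q) (Ncp (dPsi e) B) = Fo (lG (dTgt e)) B" "Cod (CoAlg Q) (Ncp (dPsi d) B) = Fo (lG (dTgt e)) B"
      "Dom (CoAlg Q) (Ncp (dPsi e) B) = Fo (lG (dSrc e)) B" "Dom (CoAlg Q) (Ncp (dPsi d) B) = Fo (lG (dSrc e)) B"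
      "Ncp (dPsi e) B \<in> Ar (CoAlg Q)" "Ncp (dPsi d) B \<in> Ar (CoAlg Q)"
      by simp_all
    have [simp]: "Fo (lG (dSrc e)) B \<in> Ob (CoAlg Q)" "Fo (lG (dTgt e)) B \<in> Ob (CoAlg Q)"
      by simp_all
    have [simp]: "Dom ?C ?z = carr (Fo (lG (dTgt e)) B)" by simp
    have "Cmp ?C ?z (under (Ncp (dPsi d) B)) = Cmp ?C ?z (under (Ncp (dPsi e) B))"
      using adj2_law[OF d, of B] adj2_law[OF e, of B] by simp
    from arg_cong[OF this, of "Cmp ?C (inv_ar ?C ?z)"] have "under (Ncp (dPsi d) B) = under (Ncp (dPsi e) B)"
      by simp
    then show "Ncp (dPsi d) B = Ncp (dPsi e) B"
      by (rule CoAlg_ar_eqI[of _ Q, rotated 4]) simp_all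
  qed simp_all
qed (use eq in simp_all)

section \<open>Invertible 2-cells between left loose morphisms\<close>

lemma nvcmp_ninv:
  assumes "nat_iso \<alpha>"
  shows "ninv \<alpha> \<bullet> \<alpha> = nid (Nsrc \<alpha>)" "\<alpha> \<bullet> ninv \<alpha> = nid (Ntgt \<alpha>)"
  using assms by (auto intro!: ntr_eqI)

text \<open>The law of a 2-cell, conjugated by the inverses of its components, is the law for the
  pair of inverses.\<close>

lemma iso2_LAdj_iso:
  assumes d: "is_adj2 d" and "nat_iso (dPhi d)" "nat_iso (dPsi d)"
  shows "iso2 LAdj_iso d"
  unfolding iso2_def
proof (rule iso_arI(1))
  note [simp] = assms
  let ?e = "\<lparr>dSrc = dTgt d, dTgt = dSrc d, dPhi = ninv (dPhi d), dPsi = ninv (dPsi d)\<rparr>"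
  have "is_adj2 ?e"
  proof (rule adj2I)
    fix B assume "B \<in> Ob (Src (aL (lSrc (dSrc ?e))))"
    then have B [simp]: "B \<in> Ob (Src (aL (lSrc (dSrc d))))" by simp
    let ?C = "Tgt (aL (lTgt (dSrc d)))" and ?L = "aL (lSrc (dSrc d))" and ?L' = "aL (lTgt (dSrc d))"
      and ?D = "Src (aL (lTgt (dSrc d)))"
    let ?\<phi> = "Ncp (dPhi d) (Fo ?L B)" and ?\<psi> = "Fa ?L' (Ncp (dPsi d) B)" and ?\<phi>' = "inv_ar ?C (Ncp (dPhi d) (Fo ?L B))"
      and ?\<psi>' = "Fa ?L' (inv_ar ?D (Ncp (dPsi d) B))"
    have inv: "Cmp ?C ?\<psi> ?\<psi>' = Idn ?C (Fo ?L' (Fo (lG (dTgt d)) B))"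
      using arg_cong[OF inv_ar(5)[of ?D "Ncp (dPsi d) B"], of "Fa ?L'"] by (simp del: inv_ar(5))
    have "Cmp ?C ?\<phi>' (Ncp (lZ (dTgt d)) B) = Cmp ?C ?\<phi>' (Cmp ?C (Cmp ?C (Ncp (lZ (dTgt d)) B) ?\<psi>) ?\<psi>')"
      by (simp add: inv)
    also have "\<dots> = Cmp ?C (Ncp (lZ (dSrc d)) B) ?\<psi>'"
      by (subst adj2_law[OF d B, symmetric]) simp
    finally show "Cmp (Tgt (aL (lTgt (dSrc ?e)))) (Ncp (dPhi ?e) (Fo (aL (lSrc (dSrc ?e))) B)) (Ncp (lZ (dSrc ?e)) B)
      = Cmp (Tgt (aL (lTgt (dSrc ?e)))) (Ncp (lZ (dTgt ?e)) B) (Fa (aL (lTgt (dSrc ?e))) (Ncp (dPsi ?e) B))"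
      by simp
  qed simp_all
  then show "?e \<in> Ar (cat12 LAdj_iso)" by simp
qed (use assms in \<open>simp_all add: nvcmp_ninv\<close>)

section \<open>Comparison functors as components of the unit\<close>

lemma comparison_sel [simp]: "Src (comparison A) = Src (aL A)" "Tgt (comparison A) = CoAlg (Cm0 A)"
  "B \<in> Ob (Src (aL A)) \<Longrightarrow> Fo (comparison A) B = Coalg (Fo (aL A) B) (Fa (aL A) (Ncp (aEta A) B))"
  "f \<in> Ar (Src (aL A)) \<Longrightarrow> Fa (comparison A) f =
    Comor (Coalg (Fo (aL A) (Dom (Src (aL A)) f)) (Fa (aL A) (Ncp (aEta A) (Dom (Src (aL A)) f)))) (Fa (aL A) f)
      (Coalg (Fo (aL A) (Cod (Src (aL A)) f)) (Fa (aL A) (Ncp (aEta A) (Cod (Src (aL A)) f))))"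
  by (simp_all add: comparison_def Let_def)

text \<open>The counit axiom is a triangle identity; coassociativity is the L-image of the
  naturality of \<eta> at \<eta> itself.\<close>

lemma comparison_ob [simp]:
  assumes A: "is_adjn A" and B: "B \<in> Ob (Src (aL A))"
  shows "Coalg (Fo (aL A) B) (Fa (aL A) (Ncp (aEta A) B)) \<in> Ob (CoAlg (Cm0 A))"
  using assms arg_cong[OF adjn_naturality(1)[OF A, of "Ncp (aEta A) B", OF _ refl], of "Fa (aL A)"]
  by (simp add: adjn_triangles)

lemma comparison_ar [simp]:
  assumes A: "is_adjn A" and f: "f \<in> Ar (Src (aL A))"
  shows "Comor (Coalg (Fo (aL A) (Dom (Src (aL A)) f)) (Fa (aL A) (Ncp (aEta A) (Dom (Src (aL A)) f)))) (Fa (aL A) f)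
      (Coalg (Fo (aL A) (Cod (Src (aL A)) f)) (Fa (aL A) (Ncp (aEta A) (Cod (Src (aL A)) f)))) \<in> Ar (CoAlg (Cm0 A))"
  using assms arg_cong[OF adjn_naturality(1)[OF A f refl], of "Fa (aL A)"] by (simp del: CoAlg_ob_iff)

lemma comparison_functor [simp]:
  assumes A: "is_adjn A"
  shows "is_functor (comparison A)"
proof (rule is_functorI)
  note [simp] = A
  note [simp del] = CoAlg_ob_iff CoAlg_ar_iff
  fix f g assume "f \<in> Ar (Src (comparison A))" "g \<in> Ar (Src (comparison A))"
    "Cod (Src (comparison A)) f = Dom (Src (comparison A)) g"
  then have fg [simp]: "f \<in> Ar (Src (aL A))" "g \<in> Ar (Src (aL A))" "Cod (Src (aL A)) f = Dom (Src (aL A)) g"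
    by simp_all
  show "Fa (comparison A) (Cmp (Src (comparison A)) g f) = Cmp (Tgt (comparison A)) (Fa (comparison A) g) (Fa (comparison A) f)"
    using comparison_ar[OF A fg(1)] by (simp add: CoAlg_Cmp)
qed (use A in \<open>simp_all add: CoAlg_Idn del: CoAlg_ob_iff CoAlg_ar_iff\<close>, simp_all add: comparison_def Let_def)

text \<open>A name for the 1-cell that \<open>EM_unit\<close> binds locally; the strict unit and the
  pseudo-natural one share it.\<close>

definition comparison1 :: "'u univ adjn \<Rightarrow> 'u univ adj1"
  where "comparison1 A = P0 EM_unit A"

lemma comparison1_sel [simp]: "lSrc (comparison1 A) = A" "lTgt (comparison1 A) = EM0 (Cm0 A)"
  "lF (comparison1 A) = fid (Tgt (aL A))" "lG (comparison1 A) = comparison A"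
  "lZ (comparison1 A) = nid (EM_U (Cm0 A) \<odot> comparison A)"
  by (simp_all add: comparison1_def EM_unit_def Let_def)

lemma EM_unit_P1: "P1 EM_unit f = id2 LAdj_iso (adj_cmp (comparison1 (lTgt f)) f)"
  by (simp add: EM_unit_def comparison1_def Let_def LAdj_def)

lemma EM_U_comparison: "is_adjn A \<Longrightarrow> EM_U (Cm0 A) \<odot> comparison A = aL A"
  by (rule ftr_eqI) (simp_all del: CoAlg_ob_iff CoAlg_ar_iff)

lemma comparison1_adj1 [simp]: "is_adjn A \<Longrightarrow> is_adj1 (comparison1 A)"
  by (rule adj1I) (simp_all add: EM_U_comparison)

text \<open>With \<open>lZ\<close> an identity, the mate lies over L R \<epsilon> after L \<eta> R,
  the L-image of a triangle identity.\<close>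

lemma under_mate_comparison1:
  assumes A: "is_adjn A" and Y: "Y \<in> Ob (Tgt (aL A))"
  shows "under (Ncp (mate (comparison1 A)) Y) = Idn (Tgt (aL A)) (Fo (aL A) (Fo (aR A) Y))"
proof -
  note [simp] = A Y
  have triangle: "Cmp (Tgt (aL A)) (Fa (aL A) (Fa (aR A) (Ncp (aEps A) Y))) (Fa (aL A) (Ncp (aEta A) (Fo (aR A) Y)))
    = Idn (Tgt (aL A)) (Fo (aL A) (Fo (aR A) Y))"
    using arg_cong[OF adjn_triangles(2)[OF A Y], of "Fa (aL A)"] by simp
  let ?X = "Coalg (Fo (aL A) (Fo (aR A) Y)) (Fa (aL A) (Ncp (aEta A) (Fo (aR A) Y)))"
  have X: "?X \<in> Ob (CoAlg (Cm0 A))" by (simp del: CoAlg_ob_iff)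
  show ?thesis
    using CoAlg_ob(6)[OF X] comonad_naturality(2)[of "Cm0 A" "Ncp (aEps A) Y", OF _ _ refl]
      comonad_laws(3)[of "Cm0 A"]
    by (simp add: mate_sel(4) CoAlg_Idn triangle del: CoAlg_ob_iff)
qed

lemma comparison1_pseudo:
  assumes A: "is_adjn A"
  shows "nat_iso (mate (comparison1 A))"
proof (rule nat_isoI)
  note [simp] = A
  show "nat_trans (mate (comparison1 A))" by simp
  fix Y assume "Y \<in> Ob (Src (Nsrc (mate (comparison1 A))))"
  then have Y [simp]: "Y \<in> Ob (Tgt (aL A))" by simp
  have "iso_ar (CoAlg (Cm0 A)) (Ncp (mate (comparison1 A)) Y)"
    by (rule coalg_iso(1)) (use mate_ar(1)[of "comparison1 A" Y] in \<open>simp_all add: under_mate_comparison1\<close>)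
  then show "iso_ar (Tgt (Nsrc (mate (comparison1 A)))) (Ncp (mate (comparison1 A)) Y)" by simp
qed

text \<open>The right-hand side is \<open>id1 Cmd (Cm0 A)\<close> written out. The structure map is
  an identity because both \<zeta> and the arrows underlying the mate are.\<close>

lemma Cm1_comparison1:
  assumes A: "is_adjn A"
  shows "Cm1 (comparison1 A) = \<lparr>mSrc = Cm0 A, mTgt = Cm0 A, mH = fid (Tgt (aL A)), mT = nid (aL A \<odot> aR A)\<rparr>"
proof (rule cmd1.equality)
  note [simp] = A
  let ?m = "\<lparr>mSrc = Cm0 A, mTgt = Cm0 A, mH = fid (Tgt (aL A)), mT = nid (aL A \<odot> aR A)\<rparr>"
  show "mT (Cm1 (comparison1 A)) = mT ?m"
  proof (rule ntr_eqI)
    have "EM_U (Cm0 A) \<odot> comparison A \<odot> aR A = aL A \<odot> aR A"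
      using arg_cong[OF EM_U_comparison[OF A], of "\<lambda>F. F \<odot> aR A"] by simp
    then show "Nsrc (mT (Cm1 (comparison1 A))) = Nsrc (mT ?m)" "Ntgt (mT (Cm1 (comparison1 A))) = Ntgt (mT ?m)"
      by (simp_all add: EM_U_comparison)
    show "nat_trans (mT (Cm1 (comparison1 A)))" "nat_trans (mT ?m)"
      using Cm1_cmd1[of "comparison1 A"] cmd1D(6) by (blast intro: comparison1_adj1 A, simp)
    fix Y assume "Y \<in> Ob (Src (Nsrc (mT ?m)))"
    then have Y [simp]: "Y \<in> Ob (Tgt (aL A))" by simp
    have [simp]: "Ncp (mate (comparison1 A)) Y \<in> Ar (CoAlg (Cm0 A))"
      using mate_ar(1)[of "comparison1 A" Y] by simp
    show "Ncp (mT (Cm1 (comparison1 A))) Y = Ncp (mT ?m) Y"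
      by (simp add: under_mate_comparison1)
  qed
qed (use A in simp_all)

text \<open>Only \<open>P1\<close> differs from \<open>EM_unit\<close>, whose 2-cells are identities
  and thus have the wrong source for a general \<zeta>. The orientation required by
  \<open>pseudo_natural\<close>, towards the composite that contains f, is the reason for the
  inverse of \<zeta>. The restriction makes \<open>dPsi\<close> extensional.\<close>

definition bi_unit :: "('u univ adjn, 'u univ adj1, 'u univ adj1, 'u univ adj2) ptr"
  where "bi_unit = \<lparr>P0 = comparison1, P1 = (\<lambda>f.
    \<lparr>dSrc = adj_cmp (EM1 (Cm1 f)) (comparison1 (lSrc f)), dTgt = adj_cmp (comparison1 (lTgt f)) f, dPhi = nid (lF f),
     dPsi = \<lparr>Nsrc = CoAlg1 (Cm1 f) \<odot> comparison (lSrc f), Ntgt = comparison (lTgt f) \<odot> lG f,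
       Ncp = (\<lambda>B \<in> Ob (Src (aL (lSrc f))). Comor (coalg_map (Cm1 f) (Fo (comparison (lSrc f)) B))
         (inv_ar (Tgt (aL (lTgt f))) (Ncp (lZ f) B)) (Fo (comparison (lTgt f)) (Fo (lG f) B)))\<rparr>\<rparr>)\<rparr>"

lemma bi_unit_sel [simp]: "P0 bi_unit = comparison1"
  "dSrc (P1 bi_unit f) = adj_cmp (EM1 (Cm1 f)) (comparison1 (lSrc f))"
  "dTgt (P1 bi_unit f) = adj_cmp (comparison1 (lTgt f)) f"
  "dPhi (P1 bi_unit f) = nid (lF f)"
  "Nsrc (dPsi (P1 bi_unit f)) = CoAlg1 (Cm1 f) \<odot> comparison (lSrc f)"
  "Ntgt (dPsi (P1 bi_unit f)) = comparison (lTgt f) \<odot> lG f"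
  "is_adj1 f \<Longrightarrow> B \<in> Ob (Src (aL (lSrc f))) \<Longrightarrow> Ncp (dPsi (P1 bi_unit f)) B =
    Comor (coalg_map (Cm1 f) (Coalg (Fo (aL (lSrc f)) B) (Fa (aL (lSrc f)) (Ncp (aEta (lSrc f)) B))))
      (inv_ar (Tgt (aL (lTgt f))) (Ncp (lZ f) B))
      (Coalg (Fo (aL (lTgt f)) (Fo (lG f) B)) (Fa (aL (lTgt f)) (Ncp (aEta (lTgt f)) (Fo (lG f) B))))"
  by (simp_all add: bi_unit_def)

text \<open>The inverse of \<zeta> moves past \<eta> by naturality, \<open>mate_unit\<close>
  produces L' R' \<zeta>, and this cancels against L' R' of the inverse that the morphism condition
  puts in front.\<close>

lemma bi_unit_ar:
  assumes f: "is_adj1 f" and B: "B \<in> Ob (Src (aL (lSrc f)))"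
  shows "Comor (coalg_map (Cm1 f) (Coalg (Fo (aL (lSrc f)) B) (Fa (aL (lSrc f)) (Ncp (aEta (lSrc f)) B))))
      (inv_ar (Tgt (aL (lTgt f))) (Ncp (lZ f) B))
      (Coalg (Fo (aL (lTgt f)) (Fo (lG f) B)) (Fa (aL (lTgt f)) (Ncp (aEta (lTgt f)) (Fo (lG f) B))))
    \<in> Ar (CoAlg (Cm0 (lTgt f)))"
proof -
  note [simp] = f B
  note [simp del] = CoAlg_ob_iff
  let ?C = "Tgt (aL (lTgt f))" and ?D = "Src (aL (lTgt f))" and ?L' = "aL (lTgt f)" and ?R' = "aR (lTgt f)"
    and ?R = "aR (lSrc f)" and ?L = "aL (lSrc f)" and ?F = "lF f" and ?G = "lG f"
    and ?\<eta>' = "Ncp (aEta (lTgt f))" and ?\<eta> = "Ncp (aEta (lSrc f))" and ?\<zeta> = "Ncp (lZ f)" and ?m = "Ncp (mate f)"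
  let ?z = "\<lambda>B. inv_ar ?C (?\<zeta> B)"
  have zeta: "Cmp ?C (?z (Fo ?R (Fo ?L B))) (Fa ?F (Fa ?L (?\<eta> B))) = Cmp ?C (Fa ?L' (Fa ?G (?\<eta> B))) (?z B)"
    using adj1_naturality(2)[OF f, of "?\<eta> B"] by simp
  have unit: "Cmp ?C (Fa ?L' (?m (Fo ?L B))) (Fa ?L' (Fa ?G (?\<eta> B))) = Cmp ?C (Fa ?L' (Fa ?R' (?\<zeta> B))) (Fa ?L' (?\<eta>' (Fo ?G B)))"
    using arg_cong[OF mate_unit[OF f B], of "Fa ?L'"] by simp
  have inv: "Cmp ?C (Fa ?L' (Fa ?R' (?z B))) (Fa ?L' (Fa ?R' (?\<zeta> B))) = Idn ?C (Fo ?L' (Fo ?R' (Fo ?L' (Fo ?G B))))"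
    using arg_cong[OF inv_ar(4)[of ?C "?\<zeta> B"], of "\<lambda>x. Fa ?L' (Fa ?R' x)"] by (simp del: inv_ar(4))
  have "Cmp ?C (Fa ?L' (Fa ?R' (?z B))) (Cmp ?C (Fa ?L' (?m (Fo ?L B))) (Cmp ?C (?z (Fo ?R (Fo ?L B))) (Fa ?F (Fa ?L (?\<eta> B)))))
    = Cmp ?C (Fa ?L' (Fa ?R' (?z B))) (Cmp ?C (Fa ?L' (Fa ?R' (?\<zeta> B))) (Cmp ?C (Fa ?L' (?\<eta>' (Fo ?G B))) (?z B)))"
    unfolding zeta by (subst Cmp_eq_extend[OF unit]) simp_all
  also have "\<dots> = Cmp ?C (Fa ?L' (?\<eta>' (Fo ?G B))) (?z B)"
    by (subst Cmp_eq_extend1[OF inv]) simp_all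
  finally show ?thesis by simp
qed

lemma bi_unit_nat [simp]:
  assumes f: "is_adj1 f"
  shows "nat_trans (dPsi (P1 bi_unit f))"
proof (rule nat_transI)
  note [simp] = f bi_unit_ar
  note [simp del] = CoAlg_ob_iff CoAlg_ar_iff
  fix x assume "x \<in> Ar (Src (Nsrc (dPsi (P1 bi_unit f))))"
  then have x [simp]: "x \<in> Ar (Src (aL (lSrc f)))" by simp
  \<comment> \<open>These instances certify the arrows that are composed in \<open>CoAlg\<close>;
    what then remains is the naturality of the inverse of \<zeta>.\<close>
  note [simp] = comparison_ar[OF _ x]
    CoAlg1_ar[of "Cm1 f" "Fa (comparison (lSrc f)) x", simplified, OF refl]
    comparison_ar[of "lTgt f" "Fa (lG f) x", simplified]
  show "Cmp (Tgt (Nsrc (dPsi (P1 bi_unit f)))) (Ncp (dPsi (P1 bi_unit f)) (Cod (Src (Nsrc (dPsi (P1 bi_unit f)))) x))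
      (Fa (Nsrc (dPsi (P1 bi_unit f))) x)
    = Cmp (Tgt (Nsrc (dPsi (P1 bi_unit f)))) (Fa (Ntgt (dPsi (P1 bi_unit f))) x)
      (Ncp (dPsi (P1 bi_unit f)) (Dom (Src (Nsrc (dPsi (P1 bi_unit f)))) x))"
    using adj1_naturality(2)[OF f x refl]
    by (simp add: CoAlg_Cmp[of _ "Cm0 (lTgt f)"])
qed (use f in \<open>simp_all add: bi_unit_ar del: CoAlg_ob_iff CoAlg_ar_iff\<close>, simp_all add: bi_unit_def)

text \<open>The source composite has an identity and the target composite has \<zeta> as structural
  isomorphism, so the law says that \<zeta> cancels its inverse.\<close>

lemma bi_unit_adj2 [simp]:
  assumes f: "is_adj1 f"
  shows "is_adj2 (P1 bi_unit f)"
proof (rule adj2I)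
  note [simp] = f bi_unit_ar
  note [simp del] = CoAlg_ob_iff CoAlg_ar_iff
  fix B assume "B \<in> Ob (Src (aL (lSrc (dSrc (P1 bi_unit f)))))"
  then have B [simp]: "B \<in> Ob (Src (aL (lSrc f)))" by simp
  show "Cmp (Tgt (aL (lTgt (dSrc (P1 bi_unit f)))))
      (Ncp (dPhi (P1 bi_unit f)) (Fo (aL (lSrc (dSrc (P1 bi_unit f)))) B)) (Ncp (lZ (dSrc (P1 bi_unit f))) B)
    = Cmp (Tgt (aL (lTgt (dSrc (P1 bi_unit f))))) (Ncp (lZ (dTgt (P1 bi_unit f))) B)
      (Fa (aL (lTgt (dSrc (P1 bi_unit f)))) (Ncp (dPsi (P1 bi_unit f)) B))"
    by simp
qed (use f in simp_all)

lemma bi_unit_iso2: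
  assumes f: "is_adj1 f"
  shows "iso2 LAdj_iso (P1 bi_unit f)"
proof (rule iso2_LAdj_iso)
  note [simp] = f
  show "nat_iso (dPsi (P1 bi_unit f))"
  proof (rule nat_isoI)
    fix B assume "B \<in> Ob (Src (Nsrc (dPsi (P1 bi_unit f))))"
    then have B [simp]: "B \<in> Ob (Src (aL (lSrc f)))" by simp
    have "iso_ar (CoAlg (Cm0 (lTgt f))) (Ncp (dPsi (P1 bi_unit f)) B)"
      by (rule coalg_iso(1)) (use bi_unit_ar[OF f B] in \<open>simp_all del: CoAlg_ob_iff CoAlg_ar_iff\<close>)
    then show "iso_ar (Tgt (Nsrc (dPsi (P1 bi_unit f)))) (Ncp (dPsi (P1 bi_unit f)) B)" by simp
  qed simp
qed (use f in simp_all)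

text \<open>Closure of the 2-cells in terms of the operations of \<open>LAdj_iso\<close>, for
  descending through the pasting diagrams of the coherence axioms.\<close>

lemma adj2_ops:
  "is_adj1 f \<Longrightarrow> is_adj2 (id2 LAdj_iso f)"
  "is_adj2 d \<Longrightarrow> is_adj2 e \<Longrightarrow> dSrc e = dTgt d \<Longrightarrow> is_adj2 (vcmp LAdj_iso e d)"
  "is_adj2 d \<Longrightarrow> is_adj2 e \<Longrightarrow> lSrc (dSrc e) = lTgt (dSrc d) \<Longrightarrow> is_adj2 (hcmp LAdj_iso e d)"
  by simp_all

lemma pseudo_natural_bi_unit:
  "pseudo_natural (LAdj_iso :: 'u univ adj_cat2) LAdj_iso id_fun2 (EM_iso \<odot>\<^sub>2 Cm_iso) bi_unit"
proof (rule pseudo_natural.intro)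
  show "two_functor LAdj_iso LAdj_iso (EM_iso \<odot>\<^sub>2 Cm_iso)"
    by (rule two_functor_cmp[OF two_functor_Cm_iso two_functor_EM_iso])
next
  fix \<alpha> :: "'u univ adj2" and f g a b
  assume "\<alpha> \<in> Hom (cat12 LAdj_iso) f g" "f \<in> Hom (cat01 LAdj_iso) a b"
  then have *: "is_adj2 \<alpha>" "f = dSrc \<alpha>" "g = dTgt \<alpha>" "a = lSrc (dSrc \<alpha>)" "b = lTgt (dSrc \<alpha>)"
    by (auto simp: Hom_def)
  then show "vcmp LAdj_iso (P1 bi_unit g) (hcmp LAdj_iso (F2 (EM_iso \<odot>\<^sub>2 Cm_iso) \<alpha>) (id2 LAdj_iso (P0 bi_unit a)))
    = vcmp LAdj_iso (hcmp LAdj_iso (id2 LAdj_iso (P0 bi_unit b)) (F2 id_fun2 \<alpha>)) (P1 bi_unit f)"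
    \<comment> \<open>\<open>Q\<close> is the comonad of the target adjunction, since both pastings
      end in its Eilenberg-Moore adjunction. Their first components are both that of
      \<alpha>.\<close>
    by (intro adj2_eqI_EM[where Q = "Cm0 (lTgt (dSrc \<alpha>))"] adj2_ops) simp_all
next
  fix a :: "'u univ adjn" assume "a \<in> C0 LAdj_iso"
  then show "P1 bi_unit (id1 LAdj_iso a) = id2 LAdj_iso (P0 bi_unit a)"
    using EM1_id[of "Cm0 a"] adj_cmp_id[of "comparison1 a", OF _ refl]
    by (intro adj2_eqI_EM[where Q = "Cm0 a"]) (simp_all add: Cm1_id)
next
  fix f g :: "'u univ adj1" and a b c
  assume "f \<in> Hom (cat01 LAdj_iso) a b" "g \<in> Hom (cat01 LAdj_iso) b c"
  then have *: "is_adj1 f" "is_adj1 g" "lSrc g = lTgt f"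
    by (auto simp: Hom_def)
  then show "P1 bi_unit (cmp1 LAdj_iso g f)
    = vcmp LAdj_iso (hcmp LAdj_iso (P1 bi_unit g) (id2 LAdj_iso (F1 id_fun2 f)))
        (hcmp LAdj_iso (id2 LAdj_iso (F1 (EM_iso \<odot>\<^sub>2 Cm_iso) g)) (P1 bi_unit f))"
    by (intro adj2_eqI_EM[where Q = "Cm0 (lTgt g)"] adj2_ops) (simp_all add: Cm1_cmp EM1_cmp adj_cmp_assoc)
qed (auto simp: Hom_def two_functor_id bi_unit_iso2)

text \<open>The Eilenberg-Moore unit at a coalgebra is its structure map, so the comparison functor
  takes a coalgebra apart and rebuilds the same one.\<close>

lemma comparison_EM0:
  assumes Q: "is_comonad Q"
  shows "comparison (EM0 Q) = fid (CoAlg Q)"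
proof (rule ftr_eqI)
  note [simp] = Q
  note [simp del] = CoAlg_ob_iff CoAlg_ar_iff
  have [simp]: "Comor X (struct X) (cofree Q (carr X)) \<in> Ar (CoAlg Q)" if "X \<in> Ob (CoAlg Q)" for X
    using Ncp_ar(1)[of "aEta (EM0 Q)" X] that by simp
  show "is_functor (comparison (EM0 Q))"
    by (rule comparison_functor) simp
  show "Fo (comparison (EM0 Q)) X = Fo (fid (CoAlg Q)) X" if "X \<in> Ob (Src (fid (CoAlg Q)))" for X
    using that by simp
  show "Fa (comparison (EM0 Q)) f = Fa (fid (CoAlg Q)) f" if "f \<in> Ar (Src (fid (CoAlg Q)))" for f
    using that by (simp add: Comor_eq Coalg_eq[of _ Q])
qed (use Q in simp_all)

lemma comparison1_EM0: "is_comonad Q \<Longrightarrow> comparison1 (EM0 Q)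
    = \<lparr>lSrc = EM0 Q, lTgt = EM0 Q, lF = fid (Src (cmK Q)), lG = fid (CoAlg Q), lZ = nid (EM_U Q)\<rparr>"
  by (rule adj1.equality) (simp_all add: comparison_EM0)

lemma Cm_EM_iso: "eq_fun2 Cmd (Cm_iso \<odot>\<^sub>2 EM_iso) id_fun2"
  by (simp add: eq_fun2_def)

lemma strict_reflection_iso: "strict_reflection LAdj_iso Cmd Cm_iso EM_iso bi_unit"
proof (rule strict_reflection.intro)
  show "F2 Cm_iso (P1 bi_unit f) = id2 Cmd (F1 Cm_iso f)" if "f \<in> C1 LAdj_iso" for f
  proof -
    have f: "is_adj1 f" using that by simp
    \<comment> \<open>C keeps only the first component of a 2-cell, here an identity; what is left
      to see is that both boundary composites collapse to C f.\<close>
    have "cmd_cmp (Cm1 f) (Cm1 (comparison1 (lSrc f))) = Cm1 f" "cmd_cmp (Cm1 (comparison1 (lTgt f))) (Cm1 f) = Cm1 f"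
      using f cmd_cmp_id[of "Cm1 f", OF _ refl] by (simp_all add: Cm1_comparison1)
    then show ?thesis
      using f by (intro cmd2.equality) (simp_all add: Cm1_cmp)
  qed
  show "P1 bi_unit (F1 EM_iso m) = id2 LAdj_iso (F1 EM_iso m)" if "m \<in> C1 Cmd" for m
  proof -
    have m: "is_cmd1 m" using that by simp
    have "adj_cmp (EM1 m) (comparison1 (EM0 (mSrc m))) = EM1 m" "adj_cmp (comparison1 (EM0 (mTgt m))) (EM1 m) = EM1 m"
      using m adj_cmp_id[of "EM1 m", OF _ refl] by (simp_all add: comparison1_EM0)
    then show ?thesis
      using m by (intro adj2_eqI_EM[where Q = "mTgt m"]) simp_all
  qed
qed (simp_all add: two_functor_Cm_iso two_functor_EM_iso pseudo_natural_bi_unit Cm_EM_iso Cm1_comparison1 comparison1_EM0)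

interpretation iso: strict_reflection LAdj_iso Cmd Cm_iso EM_iso bi_unit
  by (rule strict_reflection_iso)

text \<open>Over an identity the morphism condition equates the two structure maps. This converts
  the existence of a morphism into strict equality of coalgebras.\<close>

lemma Comor_Idn_eq:
  assumes Q: "is_comonad Q" and A: "A \<in> Ob (Src (cmK Q))"
    and ar: "Comor X (Idn (Src (cmK Q)) A) Y \<in> Ar (CoAlg Q)"
  shows "X = Y"
proof -
  have ob: "X \<in> Ob (CoAlg Q)" "Y \<in> Ob (CoAlg Q)" and carr: "carr X = A" "carr Y = A"
    using ar Q A by auto
  have "Cmp (Src (cmK Q)) (struct Y) (Idn (Src (cmK Q)) A) = Cmp (Src (cmK Q)) (Fa (cmK Q) (Idn (Src (cmK Q)) A)) (struct X)"
    using ar unfolding CoAlg_ar_iff by blast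
  then have "struct Y = struct X"
    using Q A ob carr CoAlg_ob(2-4)[OF ob(1)] CoAlg_ob(2-4)[OF ob(2)] by simp
  then show ?thesis
    using carr Coalg_eq[OF ob(1)] Coalg_eq[OF ob(2)] by simp
qed

text \<open>When \<zeta> is an identity, the arrow of \<open>bi_unit_ar\<close> lies over an
  identity, so by \<open>Comor_Idn_eq\<close> its two ends coincide. Strict naturality of the
  comparison functors thus comes without a new calculation, and the 2-cells then agree because their
  boundaries and first components do.\<close>

lemma bi_unit_LAdj:
  assumes f: "is_adj1 f" and zeta: "lZ f = nid (aL (lTgt f) \<odot> lG f)"
  shows "P1 bi_unit f = P1 EM_unit f"
proof -
  note [simp] = f
  note [simp del] = CoAlg_ob_iff CoAlg_ar_iff
  let ?K = "comparison (lSrc f)" and ?K' = "comparison (lTgt f)" and ?C = "Tgt (aL (lTgt f))"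
  have L: "lF f \<odot> aL (lSrc f) = aL (lTgt f) \<odot> lG f"
    using adj1D(12)[OF f] zeta by simp
  have Fo: "Fo (lF f) (Fo (aL (lSrc f)) B) = Fo (aL (lTgt f)) (Fo (lG f) B)" if "B \<in> Ob (Src (aL (lSrc f)))" for B
    using arg_cong[OF L, of "\<lambda>F. Fo F B"] that by simp
  have Fa: "Fa (lF f) (Fa (aL (lSrc f)) x) = Fa (aL (lTgt f)) (Fa (lG f) x)" if "x \<in> Ar (Src (aL (lSrc f)))" for x
    using arg_cong[OF L, of "\<lambda>F. Fa F x"] that by simp
  have ob: "coalg_map (Cm1 f) (Fo ?K B) = Fo ?K' (Fo (lG f) B)" if B: "B \<in> Ob (Src (aL (lSrc f)))" for B
  proof -
    note [simp] = B
    have "Comor (coalg_map (Cm1 f) (Fo ?K B)) (Idn (Src (cmK (Cm0 (lTgt f)))) (Fo (aL (lTgt f)) (Fo (lG f) B)))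
        (Fo ?K' (Fo (lG f) B)) \<in> Ar (CoAlg (Cm0 (lTgt f)))"
      using bi_unit_ar[OF f B] by (simp add: zeta)
    then show ?thesis
      by (rule Comor_Idn_eq[rotated 2]) simp_all
  qed
  have K: "CoAlg1 (Cm1 f) \<odot> ?K = ?K' \<odot> lG f"
  proof (rule ftr_eqI)
    show "Fo (CoAlg1 (Cm1 f) \<odot> ?K) B = Fo (?K' \<odot> lG f) B" if "B \<in> Ob (Src (?K' \<odot> lG f))" for B
      using that ob[of B] by simp
    show "Fa (CoAlg1 (Cm1 f) \<odot> ?K) x = Fa (?K' \<odot> lG f) x" if "x \<in> Ar (Src (?K' \<odot> lG f))" for x
      using that ob[of "Dom (Src (aL (lSrc f))) x"] ob[of "Cod (Src (aL (lSrc f))) x"] by (simp add: Fa)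
  qed simp_all
  have src: "adj_cmp (EM1 (Cm1 f)) (comparison1 (lSrc f)) = adj_cmp (comparison1 (lTgt f)) f"
  proof (rule adj1.equality)
    have "EM_U (Cm0 (lTgt f)) \<odot> CoAlg1 (Cm1 f) \<odot> ?K = aL (lTgt f) \<odot> lG f"
      using EM_U_CoAlg1[of "Cm1 f"] arg_cong[OF EM_U_comparison[of "lTgt f"], of "\<lambda>F. F \<odot> lG f"] K by simp
    then show "lZ (adj_cmp (EM1 (Cm1 f)) (comparison1 (lSrc f))) = lZ (adj_cmp (comparison1 (lTgt f)) f)"
      using arg_cong[OF EM_U_CoAlg1[of "Cm1 f"], of "\<lambda>F. F \<odot> ?K"] by (simp add: EM_U_comparison zeta L)
  qed (simp_all add: K)
  show ?thesis
    by (rule adj2_eqI_EM[where Q = "Cm0 (lTgt f)"])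
      (simp_all add: EM_unit_P1 src)
qed

theorem theorem2p11:
  shows "two_adjunction (LAdj :: 'u univ adj_cat2) Cmd Cm EM EM_unit id_counit \<and>
    (\<exists>\<eta> s t.
      (\<forall>A \<in> C0 (LAdj :: 'u univ adj_cat2). P0 \<eta> A = P0 EM_unit A) \<and>
      (\<forall>f \<in> C1 (LAdj :: 'u univ adj_cat2). P1 \<eta> f = P1 EM_unit f) \<and>
      bireflection (LAdj_iso :: 'u univ adj_cat2) Cmd Cm_iso EM_iso \<eta> id_counit s t \<and>
      biadjunction LAdj_iso_ps Cmd_ps Cm_iso EM_iso \<eta> id_counit s t) \<and>
    eq_fun2 (Cmd :: 'u univ cmd_cat2) (Cm_iso \<odot>\<^sub>2 EM_iso) id_fun2 \<and>
    inj_on (F0 (EM_iso :: 'u univ cmd_to_adj)) (C0 Cmd) \<and>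
    fully_faithful2 (Cmd :: 'u univ cmd_cat2) LAdj_iso EM_iso"
proof (intro conjI exI ballI)
  \<comment> \<open>The trivial predicate presents \<open>Cmd\<close> as a sub-2-category of itself,
    so that \<open>iso.wide_full\<close> can cut down the side of adjunctions alone.\<close>
  have Cmd: "wide_full Cmd (\<lambda>_. True) = (Cmd :: 'u univ cmd_cat2)"
    by (rule cat2.equality) simp_all
  interpret LAdj: strict_reflection "LAdj :: 'u univ adj_cat2" "wide_full Cmd (\<lambda>_. True)" Cm_iso EM_iso bi_unit
    unfolding LAdj_def by (rule iso.wide_full[OF closed1_LAdj]) (simp_all add: closed1_def)
  have unit0: "P0 bi_unit A = P0 EM_unit A" for A :: "'u univ adjn"
    by (simp add: comparison1_def)
  have unit1: "P1 bi_unit f = P1 EM_unit f" if "f \<in> C1 LAdj" for f :: "'u univ adj1"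
    using that by (intro bi_unit_LAdj) (simp_all add: LAdj_def)
  \<comment> \<open>On \<open>LAdj\<close> the pseudo-natural unit is exchanged for
    \<open>EM_unit\<close>, whose 2-cells are identities by definition.\<close>
  interpret LAdj': strict_reflection "LAdj :: 'u univ adj_cat2" Cmd Cm_iso EM_iso EM_unit
    using LAdj.cong[of EM_unit] unit0 unit1 by (simp add: Cmd)
  have "Cm = (Cm_iso :: 'u univ adj_to_cmd)" "EM = (EM_iso :: 'u univ cmd_to_adj)"
    by (auto simp: Cm_def EM_iso_def incl_def cmp_fun2_def)
  moreover have "two_adjunction (LAdj :: 'u univ adj_cat2) Cmd Cm_iso EM_iso EM_unit (pid Cmd id_fun2)"
    by (rule LAdj'.two_adjunction) (simp add: EM_unit_P1 LAdj_def flip: comparison1_def)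
  ultimately show "two_adjunction (LAdj :: 'u univ adj_cat2) Cmd Cm EM EM_unit id_counit"
    by (simp add: id_counit_def)
  show "P0 bi_unit A = P0 EM_unit A" for A :: "'u univ adjn"
    by (rule unit0)
  show "P1 bi_unit f = P1 EM_unit f" if "f \<in> C1 LAdj" for f :: "'u univ adj1"
    using that by (rule unit1)
  show "bireflection (LAdj_iso :: 'u univ adj_cat2) Cmd Cm_iso EM_iso bi_unit id_counit
      (\<lambda>a. id2 Cmd (id1 Cmd (F0 Cm_iso a))) (\<lambda>b. id2 LAdj_iso (id1 LAdj_iso (F0 EM_iso b)))"
    unfolding id_counit_def by (rule iso.bireflection)
  interpret ps: strict_reflection "LAdj_iso_ps :: 'u univ adj_cat2" Cmd_ps Cm_iso EM_iso bi_unit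
    unfolding LAdj_iso_ps_def Cmd_ps_def
    by (rule iso.wide_full[OF closed1_LAdj_iso_ps closed1_Cmd_ps])
      (simp_all add: EM_mate_pseudo comparison1_pseudo)
  \<comment> \<open>Sub-2-categories keep the identities of the ambient ones, so the same
    modifications and the same counit serve for both biadjunctions.\<close>
  have ops: "id1 Cmd_ps = (id1 Cmd :: 'u univ comonad \<Rightarrow> _)" "id2 Cmd_ps = (id2 Cmd :: 'u univ cmd1 \<Rightarrow> _)"
    "id1 LAdj_iso_ps = (id1 LAdj_iso :: 'u univ adjn \<Rightarrow> _)" "id2 LAdj_iso_ps = (id2 LAdj_iso :: 'u univ adj1 \<Rightarrow> _)"
    unfolding Cmd_ps_def LAdj_iso_ps_def wide_full_sel by (rule refl)+
  show "biadjunction (LAdj_iso_ps :: 'u univ adj_cat2) Cmd_ps Cm_iso EM_iso bi_unit id_counit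
      (\<lambda>a. id2 Cmd (id1 Cmd (F0 Cm_iso a))) (\<lambda>b. id2 LAdj_iso (id1 LAdj_iso (F0 EM_iso b)))"
    using bireflection.axioms(1)[OF ps.bireflection] unfolding id_counit_def pid_def ops .
  show "eq_fun2 (Cmd :: 'u univ cmd_cat2) (Cm_iso \<odot>\<^sub>2 EM_iso) id_fun2"
    by (rule Cm_EM_iso)
  show "inj_on (F0 (EM_iso :: 'u univ cmd_to_adj)) (C0 Cmd)"
    by (rule inj_on_inverseI[of _ Cm0]) simp
  show "fully_faithful2 (Cmd :: 'u univ cmd_cat2) LAdj_iso EM_iso"
    by (rule iso.fully_faithful)
qed

end
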